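(* There exists a randomized algorithm that, given a directed graph $G$ with $n(G)$ vertices whose maximum independent set has size $\alpha(G)$, decides whether $G$ has a Hamiltonian cycle in $O^*(3^{n(G)-\alpha(G)})$ time and polynomial space, with negligible probability of reporting a false negative.
   Context: Directed graphs are without loops and parallel arcs. An independent set in $G$ is a set of vertices no two of which are joined by an arc (in either direction). A Hamiltonian cycle is a directed cycle passing through every vertex exactly once. The notation $O^*(\cdot)$ suppresses a multiplicative factor polynomial in the input size. An event has negligible probability if its probability tends to zero as the number of vertices tends to infinity. *)

theory Defs
  imports
    "HOL-Probability.Probability_Mass_Function"
    "HOL-Library.Log_Nat"
    "HOL-Computational_Algebra.Polynomial"
    "Graph_Theory.Arc_Walk"
begin

section \<open>Directed graphs\<close>

definition independent_set :: "('a, 'b) pre_digraph \<Rightarrow> 'a set \<Rightarrow> bool" where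
  "independent_set G S \<longleftrightarrow>
     S \<subseteq> verts G \<and> (\<forall>u\<in>S. \<forall>v\<in>S. u \<noteq> v \<longrightarrow> \<not> u \<rightarrow>\<^bsub>G\<^esub> v)"

definition independence_number :: "('a, 'b) pre_digraph \<Rightarrow> nat" where
  "independence_number G = Max (card ` {S. independent_set G S})"

text \<open>
  The library notion of a cycle already excludes the empty walk and repeated vertices.
  Two antiparallel arcs form a cycle of length 2.
\<close>

definition hamiltonian_cycle :: "('a, 'b) pre_digraph \<Rightarrow> 'b list \<Rightarrow> bool" where
  "hamiltonian_cycle G p \<longleftrightarrow> pre_digraph.cycle G p \<and> tail G ` set p = verts G"

definition hamiltonian :: "('a, 'b) pre_digraph \<Rightarrow> bool" where
  "hamiltonian G \<longleftrightarrow> (\<exists>p. hamiltonian_cycle G p)"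


section \<open>Randomized algorithms\<close>

text \<open>
  Algorithms are programs of a structured random access machine with fair coin flips, under
  the logarithmic cost criterion. A memory consists of named arrays of natural numbers; a
  scalar variable is an array used at index 0 only. A program is a finite object that is
  independent of its input, hence mentions only finitely many array names. Up to polynomial
  factors depending on the space used, time and space agree with those of probabilistic
  Turing machines.
\<close>

type_synonym memory = "string \<Rightarrow> nat \<Rightarrow> nat"

datatype binop = Add | Sub | Mul | Div | Mod | Less | Equal

datatype expr = Const nat | Read string expr | Op binop expr expr

datatype com =
    Skip
  | Assign string expr expr
  | Flip string expr
  | Seq com com
  | Cond expr com com
  | While expr com

text \<open>Subtraction is truncated, and division by 0 follows the conventions of HOL.\<close>

fun binop_val :: "binop \<Rightarrow> nat \<Rightarrow> nat \<Rightarrow> nat" where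
  "binop_val Add a b = a + b"
| "binop_val Sub a b = a - b"
| "binop_val Mul a b = a * b"
| "binop_val Div a b = a div b"
| "binop_val Mod a b = a mod b"
| "binop_val Less a b = of_bool (a < b)"
| "binop_val Equal a b = of_bool (a = b)"

fun expr_val :: "expr \<Rightarrow> memory \<Rightarrow> nat" where
  "expr_val (Const k) m = k"
| "expr_val (Read x e) m = m x (expr_val e m)"
| "expr_val (Op f e1 e2) m = binop_val f (expr_val e1 m) (expr_val e2 m)"

text \<open>
  Every subexpression is charged the binary length \<open>floorlog 2\<close> of its value, plus one; so an
  operation pays for its operands and its result, and a memory access for its address.
\<close>

fun expr_cost :: "expr \<Rightarrow> memory \<Rightarrow> nat" where
  "expr_cost (Const k) m = 1 + floorlog 2 k"
| "expr_cost (Read x e) m = expr_cost e m + 1 + floorlog 2 (expr_val (Read x e) m)"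
| "expr_cost (Op f e1 e2) m =
     expr_cost e1 m + expr_cost e2 m + 1 + floorlog 2 (expr_val (Op f e1 e2) m)"

definition store :: "memory \<Rightarrow> string \<Rightarrow> nat \<Rightarrow> nat \<Rightarrow> memory" where
  "store m x i v = m(x := (m x)(i := v))"

type_synonym config = "com \<times> memory"

text \<open>The configurations \<open>(Skip, m)\<close> are the halted ones.\<close>

fun step :: "com \<Rightarrow> memory \<Rightarrow> config pmf" where
  "step Skip m = return_pmf (Skip, m)"
| "step (Assign x e1 e2) m = return_pmf (Skip, store m x (expr_val e1 m) (expr_val e2 m))"
| "step (Flip x e) m =
     map_pmf (\<lambda>b. (Skip, store m x (expr_val e m) (of_bool b))) (bernoulli_pmf (1/2))"
| "step (Seq c1 c2) m =
     (if c1 = Skip then return_pmf (c2, m)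
      else map_pmf (\<lambda>(c1', m'). (Seq c1' c2, m')) (step c1 m))"
| "step (Cond e c1 c2) m = return_pmf (if expr_val e m \<noteq> 0 then c1 else c2, m)"
| "step (While e c) m = return_pmf (if expr_val e m \<noteq> 0 then Seq c (While e c) else Skip, m)"

fun step_cost :: "com \<Rightarrow> memory \<Rightarrow> nat" where
  "step_cost Skip m = 0"
| "step_cost (Assign x e1 e2) m = 1 + expr_cost e1 m + expr_cost e2 m"
| "step_cost (Flip x e) m = 1 + expr_cost e m"
| "step_cost (Seq c1 c2) m = (if c1 = Skip then 1 else step_cost c1 m)"
| "step_cost (Cond e c1 c2) m = 1 + expr_cost e m"
| "step_cost (While e c) m = 1 + expr_cost e m"

text \<open>
  Space is the number of bits needed to list the nonzero cells with their addresses, the input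
  included. All memories reachable from an input have only finitely many nonzero cells. The
  intermediate values of an expression are not counted: by the choice of operations, for a fixed
  program they exceed this quantity by at most a constant factor and summand.
\<close>

definition space :: "memory \<Rightarrow> nat" where
  "space m = (\<Sum>(x, i)\<in>{(x, i). m x i \<noteq> 0}. floorlog 2 i + floorlog 2 (m x i))"

text \<open>
  \<open>run k (c, m)\<close> is the joint distribution of the configuration after \<open>k\<close> steps, the time
  spent and the peak space on the way.
\<close>

primrec run :: "nat \<Rightarrow> config \<Rightarrow> (config \<times> nat \<times> nat) pmf" where
  "run 0 cf = return_pmf (cf, 0, space (snd cf))"
| "run (Suc k) cf =
     bind_pmf (step (fst cf) (snd cf)) (\<lambda>cf'.
       map_pmf (\<lambda>(final, t, s). (final, step_cost (fst cf) (snd cf) + t, max (space (snd cf)) s))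
         (run k cf'))"

text \<open>
  Worst case over the coin flips: every run of \<open>c\<close> from \<open>m\<close> halts within time \<open>T\<close> and
  space \<open>S\<close>. The distribution \<open>\<mu>\<close> of the final memory does not depend on the witness
  \<open>k\<close>, as halted configurations no longer change.
\<close>

definition halts_within :: "com \<Rightarrow> memory \<Rightarrow> nat \<Rightarrow> nat \<Rightarrow> memory pmf \<Rightarrow> bool" where
  "halts_within c m T S \<mu> \<longleftrightarrow>
     (\<exists>k. (\<forall>((c', m'), t, s) \<in> set_pmf (run k (c, m)). c' = Skip \<and> t \<le> T \<and> s \<le> S) \<and>
          \<mu> = map_pmf (\<lambda>((c', m'), t, s). m') (run k (c, m)))"

definition accepting :: "memory set" where
  "accepting = {m. m ''out'' 0 \<noteq> 0}"

definition rejecting :: "memory set" where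
  "rejecting = {m. m ''out'' 0 = 0}"

text \<open>
  A graph with vertex set \<open>{..<n}\<close> is given by \<open>n\<close> and its adjacency matrix in row-major
  order, so that polynomial in the input size means polynomial in \<open>n\<close>.
\<close>

definition graph_input :: "(nat, 'b) pre_digraph \<Rightarrow> memory" where
  "graph_input G x i =
     (let n = card (verts G) in
      if x = ''n'' \<and> i = 0 then n
      else if x = ''arc'' \<and> i < n * n \<and> (i div n) \<rightarrow>\<^bsub>G\<^esub> (i mod n) then 1
      else 0)"

end

theory Submission
  imports
    Defs
    "Jordan_Normal_Form.Determinant"
    "HOL-Number_Theory.Cong"
    "HOL-Real_Asymp.Real_Asymp"
begin

text \<open>
  Let \<open>C\<close> be a vertex cover of size \<open>k = n - \<alpha>\<close>; the other \<open>a\<close> vertices form an independent set.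
  A Hamiltonian cycle is a cyclic order of \<open>C\<close> in which \<open>a\<close> of the steps pass through the
  independent vertices, one each, and the remaining \<open>k - a\<close> steps are arcs. So provide one matrix
  row for each of the \<open>k\<close> steps, namely the randomly weighted sum of \<open>e\<^sub>u - e\<^sub>v\<close> over the steps
  \<open>u \<rightarrow> v\<close> that it admits; row 0 contributes its total weight instead, and vertex 0 is the root of
  the spanning trees counted by the determinant. By multilinearity the determinant is a sum over
  assignments of steps to rows that connect \<open>C\<close>, and \<open>k\<close> steps that connect \<open>C\<close> form a Hamiltonian
  cycle iff every vertex has in- and outdegree at least 1. As no vertex is isolated, these conditions
  are sieved by inclusion-exclusion over only three states per vertex: admitted as head only, as
  tail only, or both. The resulting polynomial in the weights is multiaffine, and it is nonzero
  iff the graph is Hamiltonian.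

  The determinant of an integer matrix \<open>A\<close> is obtained from the leading term of \<open>det (1 + t A)\<close>
  for a huge power \<open>t\<close> of 2: modulo a power of \<open>t\<close>, Gaussian elimination of \<open>1 + t A\<close> meets only
  invertible pivots. A minimum vertex cover is found by branching on uncovered arcs.
\<close>

section \<open>Reasoning about programs\<close>

subsection \<open>Size and cost bounds\<close>

text \<open>The signs of determinant and sieve vary with the assignment, so different assignments
  might cancel. Therefore each pair of a row and a step has a weight of its own: an assignment can
  be recovered from its monomial, and its coefficient can be studied alone. With n^3 weights drawn
  uniformly below 2^n, a nonzero multiaffine polynomial vanishes with probability at most n^3 / 2^n.
  The error is one-sided, since a cycle can be read off any nonzero coefficient.

  Elimination over the integers would need pivot search and fractions; here all numbers are residues
  of polynomially many bits. Modulo t the matrix 1 + t A is the identity and elimination preserves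
  this, so pivots are 1 modulo t and hence units modulo every power of t. The modulus is large
  enough to recover the signed sum over all 3^k states, not just one determinant. So the states are
  processed one after the other in the same memory.

  The weights, t and the modulus are fixed before the cover is known; hence their sizes depend on n
  only. The guesses for the cover are enumerated, at most 3^c of them for c = n - \<alpha>, and the
  sieve that follows has at most 3^c states.\<close>

fun expr_size :: "expr \<Rightarrow> nat" where
  "expr_size (Const k) = k + 1"
| "expr_size (Read x e) = expr_size e + 1"
| "expr_size (Op f e1 e2) = expr_size e1 + expr_size e2 + 1"

fun max_expr_size :: "com \<Rightarrow> nat" where
  "max_expr_size Skip = 0"
| "max_expr_size (Assign x e1 e2) = expr_size e1 + expr_size e2"
| "max_expr_size (Flip x e) = expr_size e"
| "max_expr_size (Seq c1 c2) = max (max_expr_size c1) (max_expr_size c2)"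
| "max_expr_size (Cond e c1 c2) = max (expr_size e) (max (max_expr_size c1) (max_expr_size c2))"
| "max_expr_size (While e c) = max (expr_size e) (max_expr_size c)"

fun writes :: "com \<Rightarrow> string set" where
  "writes Skip = {}"
| "writes (Assign x e1 e2) = {x}"
| "writes (Flip x e) = {x}"
| "writes (Seq c1 c2) = writes c1 \<union> writes c2"
| "writes (Cond e c1 c2) = writes c1 \<union> writes c2"
| "writes (While e c) = writes c"

lemma finite_writes: "finite (writes c)"
  by (induction c) auto

text \<open>One invariant serves both resources: names and addresses limit the number of cells in
  use and hence the space, the bit length \<open>L\<close> limits the cost of each step.\<close>

definition bounded_memory :: "nat \<Rightarrow> nat \<Rightarrow> string set \<Rightarrow> memory \<Rightarrow> bool" where
  "bounded_memory L I X m \<longleftrightarrow> (\<forall>x i. m x i < 2 ^ L \<and> (m x i \<noteq> 0 \<longrightarrow> x \<in> X \<and> i < I))"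

lemma bounded_memory_store:
  assumes "bounded_memory L I X m" "x \<in> X" "i < I" "v < 2 ^ L"
  shows "bounded_memory L I X (store m x i v)"
  using assms unfolding bounded_memory_def store_def by (auto split: if_splits)

lemma expr_size_pos: "0 < expr_size e"
  by (cases e) auto

lemma add_power2_le:
  assumes "0 < x" "0 < y" shows "(2::nat) ^ x + 2 ^ y \<le> 2 ^ (x + y)"
proof -
  have "(2::nat) ^ 1 \<le> 2 ^ x" "(2::nat) ^ 1 \<le> 2 ^ y"
    using assms by (intro power_increasing; simp)+
  then obtain a b where "(2::nat) ^ x = 2 + a" "(2::nat) ^ y = 2 + b"
    by (metis le_Suc_ex power_one_right)
  then show ?thesis by (simp add: power_add algebra_simps)
qed

text \<open>Reduces the seven operations to sum, product and truth value, the only cases in which a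
  size estimate is made.\<close>

lemma binop_val_le: "binop_val f a b \<le> a + b \<or> binop_val f a b \<le> a * b \<or> binop_val f a b \<le> 1"
  by (cases f) (auto simp: of_bool_def le_diff_conv intro: order_trans[OF div_le_dividend] order_trans[OF mod_less_eq_dividend])

text \<open>An operation at most adds up the bit lengths of its operands. So for a fixed program the
  values are longer than the cells by a constant factor only.\<close>

lemma expr_val_less:
  assumes "bounded_memory L I X m" "0 < L"
  shows "expr_val e m < 2 ^ (expr_size e * L)"
proof (induction e)
  case (Const k)
  \<comment> \<open>\<open>expr_size\<close> counts a constant with its value in unary, which makes
    this crude bound sufficient.\<close>
  have "k < 2 ^ k" by (rule less_exp)
  also have "(2::nat) ^ k \<le> 2 ^ ((k + 1) * L)" using assms(2)
    by (intro power_increasing) (cases L, auto)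
  finally show ?case by simp
next
  case (Read x e)
  have "m x (expr_val e m) < 2 ^ L" using assms(1) by (simp add: bounded_memory_def)
  also have "(2::nat) ^ L \<le> 2 ^ (expr_size (Read x e) * L)" by (intro power_increasing) auto
  finally show ?case by simp
next
  case (Op f e1 e2)
  let ?a = "expr_val e1 m" and ?b = "expr_val e2 m"
  let ?x = "expr_size e1 * L" and ?y = "expr_size e2 * L"
  have pos: "0 < ?x" "0 < ?y" using assms(2) expr_size_pos by auto
  have "?a + ?b < 2 ^ ?x + 2 ^ ?y" using Op by simp
  also have "\<dots> \<le> 2 ^ (?x + ?y)" by (rule add_power2_le[OF pos])
  finally have 1: "?a + ?b < 2 ^ (?x + ?y)" .
  have 2: "?a * ?b < 2 ^ (?x + ?y)"
    unfolding power_add using Op by (intro mult_strict_mono) auto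
  have "(2::nat) ^ 1 \<le> 2 ^ (?x + ?y)" by (intro power_increasing) (use pos in linarith)+
  then have 3: "1 < (2::nat) ^ (?x + ?y)" by simp
  have "binop_val f ?a ?b < 2 ^ (?x + ?y)"
    using binop_val_le[of f ?a ?b] 1 2 3 by auto
  also have "(2::nat) ^ (?x + ?y) \<le> 2 ^ (expr_size (Op f e1 e2) * L)"
    by (intro power_increasing) (auto simp: algebra_simps)
  finally show ?case by simp
qed

lemma floorlog_le_of_less_power: "v < 2 ^ b \<Longrightarrow> floorlog 2 v \<le> b"
  by (rule floorlog_leI) auto

lemma expr_cost_le:
  assumes "bounded_memory L I X m" "0 < L"
  shows "expr_cost e m \<le> expr_size e * (1 + expr_size e * L)"
proof (induction e)
  case (Const k)
  show ?case using floorlog_le_of_less_power[OF expr_val_less[OF assms, of "Const k"]]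
    by (simp add: algebra_simps)
next
  case (Read x e)
  show ?case using floorlog_le_of_less_power[OF expr_val_less[OF assms, of "Read x e"]] Read
    by (simp add: algebra_simps)
next
  case (Op f e1 e2)
  define a b where "a = expr_size e1" and "b = expr_size e2"
  have "floorlog 2 (expr_val (Op f e1 e2) m) \<le> (a + b + 1) * L"
    using floorlog_le_of_less_power[OF expr_val_less[OF assms, of "Op f e1 e2"]] by (simp add: a_def b_def)
  moreover have "expr_cost e1 m \<le> a * (1 + a * L)" "expr_cost e2 m \<le> b * (1 + b * L)"
    using Op by (simp_all add: a_def b_def)
  ultimately have "expr_cost (Op f e1 e2) m \<le> a * (1 + a * L) + b * (1 + b * L) + 1 + (a + b + 1) * L"
    by simp
  also have "\<dots> \<le> (a + b + 1) * (1 + (a + b + 1) * L)"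
    by (simp add: algebra_simps)
  finally show ?case by (simp add: a_def b_def)
qed

text \<open>At most \<open>C\<close> subexpressions are charged, each for a value of at most
  \<open>C * L\<close> bits.\<close>

definition step_bound :: "nat \<Rightarrow> nat \<Rightarrow> nat" where
  "step_bound C L = 1 + C * (1 + C * L)"

lemma expr_cost_step_bound:
  assumes "bounded_memory L I X m" "0 < L" "expr_size e \<le> C"
  shows "1 + expr_cost e m \<le> step_bound C L"
proof -
  have "expr_size e * (1 + expr_size e * L) \<le> C * (1 + C * L)"
    using assms(3) by (intro mult_mono add_mono) auto
  then show ?thesis using expr_cost_le[OF assms(1,2), of e] by (simp add: step_bound_def)
qed

lemma expr_cost2_step_bound:
  assumes "bounded_memory L I X m" "0 < L" "expr_size e1 + expr_size e2 \<le> C"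
  shows "1 + expr_cost e1 m + expr_cost e2 m \<le> step_bound C L"
proof -
  define a b where "a = expr_size e1" and "b = expr_size e2"
  have "a * (1 + a * L) + b * (1 + b * L) \<le> (a + b) * (1 + (a + b) * L)"
    by (simp add: algebra_simps)
  also have "\<dots> \<le> C * (1 + C * L)"
    using assms(3) by (intro mult_mono add_mono) (auto simp: a_def b_def)
  finally show ?thesis using expr_cost_le[OF assms(1,2), of e1] expr_cost_le[OF assms(1,2), of e2]
    by (simp add: step_bound_def a_def b_def)
qed

text \<open>\<open>K\<close> arrays with \<open>I\<close> cells each; the length of an address is
  estimated by \<open>I\<close> itself.\<close>

definition space_bound :: "nat \<Rightarrow> nat \<Rightarrow> nat \<Rightarrow> nat" where
  "space_bound K L I = K * I * (I + L)"

lemma space_le: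
  assumes "bounded_memory L I X m" "finite X" "card X \<le> K"
  shows "space m \<le> space_bound K L I"
proof -
  let ?A = "{(x, i). m x i \<noteq> 0}"
  have sub: "?A \<subseteq> X \<times> {..<I}" using assms(1) by (auto simp: bounded_memory_def)
  have "space m \<le> (\<Sum>(x, i)\<in>?A. I + L)"
    unfolding space_def
  proof (intro sum_mono, clarify)
    fix x i assume "0 < m x i"
    then have "i < I" "m x i < 2 ^ L" using assms(1) by (auto simp: bounded_memory_def)
    moreover have "i < 2 ^ I" using \<open>i < I\<close> less_exp[of I] by linarith
    ultimately show "floorlog 2 i + floorlog 2 (m x i) \<le> I + L"
      by (intro add_mono floorlog_le_of_less_power)
  qed
  also have "\<dots> = card ?A * (I + L)" by (simp add: case_prod_unfold)
  also have "\<dots> \<le> card (X \<times> {..<I}) * (I + L)"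
    using sub assms(2) by (intro mult_right_mono card_mono) auto
  also have "\<dots> \<le> space_bound K L I"
    using assms(3) by (simp add: space_bound_def card_cartesian_product)
  finally show ?thesis .
qed

subsection \<open>Halting runs\<close>

text \<open>Here \<open>k\<close> is an upper bound on the number of steps, whereas \<open>run k\<close> makes exactly \<open>k\<close> steps.\<close>

inductive halts :: "nat \<Rightarrow> nat \<Rightarrow> nat \<Rightarrow> com \<Rightarrow> memory \<Rightarrow> memory pmf \<Rightarrow> bool" for W S where
  halt: "space m \<le> S \<Longrightarrow> halts W S k Skip m (return_pmf m)"
| move: "c \<noteq> Skip \<Longrightarrow> space m \<le> S \<Longrightarrow> step_cost c m \<le> W \<Longrightarrow>
     (\<And>c' m'. (c', m') \<in> set_pmf (step c m) \<Longrightarrow> halts W S k c' m' (\<nu> (c', m'))) \<Longrightarrow>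
     halts W S (Suc k) c m (bind_pmf (step c m) \<nu>)"

lemma halts_mono: "halts W S k c m \<mu> \<Longrightarrow> k \<le> k' \<Longrightarrow> halts W S k' c m \<mu>"
proof (induction arbitrary: k' rule: halts.induct)
  case (move c m k \<nu>)
  from move.prems obtain k'' where k': "k' = Suc k''" "k \<le> k''" by (cases k') auto
  show ?case unfolding k'(1) using move.hyps k'(2) by (intro halts.move move.IH) auto
qed (auto intro: halts.halt)

text \<open>A run that halts early spends the remaining steps on \<open>Skip\<close>, at no cost and
  without effect. This reconciles the upper bound \<open>k\<close> with the exact count of
  \<open>run\<close>.\<close>

lemma halts_run:
  assumes "halts W S k c m \<mu>"
  shows "(\<forall>((c', m'), t, s) \<in> set_pmf (run k (c, m)). c' = Skip \<and> t \<le> k * W \<and> s \<le> S) \<and>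
    \<mu> = map_pmf (\<lambda>((c', m'), t, s). m') (run k (c, m))"
  using assms
proof (induction rule: halts.induct)
  case (halt m k)
  have "run k (Skip, m) = return_pmf ((Skip, m), 0, space m)"
    by (induction k) (simp_all add: bind_return_pmf)
  with halt show ?case by auto
next
  case (move c m k \<nu>)
  have "bind_pmf (step c m) \<nu> =
    bind_pmf (step c m) (\<lambda>cf. map_pmf (\<lambda>((c', m'), t, s). m') (run k cf))"
    using move.IH by (intro bind_pmf_cong) (auto simp: case_prod_unfold)
  then have 1: "bind_pmf (step c m) \<nu> = map_pmf (\<lambda>((c', m'), t, s). m') (run (Suc k) (c, m))"
    by (simp add: map_bind_pmf pmf.map_comp o_def case_prod_unfold)
  have 2: "c' = Skip \<and> t \<le> Suc k * W \<and> s \<le> S" if "((c', m'), t, s) \<in> set_pmf (run (Suc k) (c, m))" for c' m' t s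
  proof -
    from that obtain c1 m1 t1 s1 where *: "(c1, m1) \<in> set_pmf (step c m)"
      "((c', m'), t1, s1) \<in> set_pmf (run k (c1, m1))" "t = step_cost c m + t1" "s = max (space m) s1"
      by (auto simp: case_prod_unfold)
    from move.IH[OF *(1)] *(2) have "c' = Skip" "t1 \<le> k * W" "s1 \<le> S" by auto
    with move.hyps * show ?thesis by auto
  qed
  have "\<forall>((c', m'), t, s) \<in> set_pmf (run (Suc k) (c, m)). c' = Skip \<and> t \<le> Suc k * W \<and> s \<le> S"
    unfolding Ball_def split_paired_All case_prod_conv using 2 by blast
  with 1 show ?case by blast
qed

lemma halts_within_if_halts:
  assumes "halts W S k c m \<mu>" "k * W \<le> T" "S \<le> S'"
  shows "halts_within c m T S' \<mu>"
  unfolding halts_within_def using halts_run[OF assms(1)] assms(2,3)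
  by (intro exI[of _ k]) fastforce

lemma halts_Seq:
  assumes "halts W S k1 c1 m \<mu>1" "\<And>m1. m1 \<in> set_pmf \<mu>1 \<Longrightarrow> halts W S k2 c2 m1 (\<nu>2 m1)" "1 \<le> W"
  shows "halts W S (k1 + k2 + 1) (Seq c1 c2) m (bind_pmf \<mu>1 \<nu>2)"
  using assms(1,2)
proof (induction rule: halts.induct)
  case (halt m k)
  have "halts W S (Suc (k + k2)) (Seq Skip c2) m
      (bind_pmf (step (Seq Skip c2) m) (\<lambda>(c', m'). \<nu>2 m'))"
    using halt assms(3) by (intro halts.move) (auto intro: halts_mono)
  then show ?case by (simp add: bind_return_pmf)
next
  case (move c m k \<nu>)
  \<comment> \<open>\<open>halts.move\<close> takes the continuation as a function of the
    configuration, so the rest of the first command is read back from \<open>Seq c1 _\<close>. The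
    fallback is never reached.\<close>
  let ?\<nu> = "\<lambda>(c', m'). case c' of Seq c1 _ \<Rightarrow> bind_pmf (\<nu> (c1, m')) \<nu>2 | _ \<Rightarrow> return_pmf m'"
  have "halts W S (Suc (k + k2 + 1)) (Seq c c2) m (bind_pmf (step (Seq c c2) m) ?\<nu>)"
  proof (rule halts.move)
    fix c' m' assume "(c', m') \<in> set_pmf (step (Seq c c2) m)"
    then obtain c1 where c1: "(c1, m') \<in> set_pmf (step c m)" "c' = Seq c1 c2"
      using move.hyps(1) by auto
    have "halts W S (k + k2 + 1) (Seq c1 c2) m' (bind_pmf (\<nu> (c1, m')) \<nu>2)"
      using c1(1) move.prems by (intro move.IH) auto
    then show "halts W S (k + k2 + 1) c' m' (?\<nu> (c', m'))" by (simp add: c1(2))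
  qed (use move.hyps in auto)
  moreover have "bind_pmf (step (Seq c c2) m) ?\<nu> = bind_pmf (bind_pmf (step c m) \<nu>) \<nu>2"
    using move.hyps(1) by (simp add: bind_assoc_pmf bind_map_pmf case_prod_unfold)
  ultimately show ?case by simp
qed

subsection \<open>Deterministic programs\<close>

text \<open>
  The bounds \<open>V\<close> on values and \<open>I\<close> on addresses are checked at every write, so that the number \<open>t\<close>
  of steps alone determines bounds on time and space.
\<close>

inductive big :: "nat \<Rightarrow> nat \<Rightarrow> com \<Rightarrow> memory \<Rightarrow> nat \<Rightarrow> memory \<Rightarrow> bool" for V I where
  Skip: "big V I Skip m 0 m"
| Assign: "expr_val e1 m < I \<Longrightarrow> expr_val e2 m < V \<Longrightarrow>
    big V I (Assign x e1 e2) m 1 (store m x (expr_val e1 m) (expr_val e2 m))"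
| Seq: "big V I c1 m t1 m1 \<Longrightarrow> big V I c2 m1 t2 m2 \<Longrightarrow> big V I (Seq c1 c2) m (t1 + t2 + 1) m2"
| CondT: "expr_val e m \<noteq> 0 \<Longrightarrow> big V I c1 m t m' \<Longrightarrow> big V I (Cond e c1 c2) m (t + 1) m'"
| CondF: "expr_val e m = 0 \<Longrightarrow> big V I c2 m t m' \<Longrightarrow> big V I (Cond e c1 c2) m (t + 1) m'"
| WhileF: "expr_val e m = 0 \<Longrightarrow> big V I (While e c) m 1 m"
| WhileT: "expr_val e m \<noteq> 0 \<Longrightarrow> big V I c m t1 m1 \<Longrightarrow> big V I (While e c) m1 t2 m2 \<Longrightarrow>
    big V I (While e c) m (t1 + t2 + 2) m2"

lemma big_frame: "big V I c m t m' \<Longrightarrow> x \<notin> writes c \<Longrightarrow> m' x = m x"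
  by (induction rule: big.induct) (auto simp: store_def)

text \<open>The checks that \<open>big\<close> makes at every write carry
  \<open>bounded_memory\<close> through all intermediate memories, so one cost bound and one space
  bound hold for every step.\<close>

lemma halts_big:
  assumes "big (2 ^ L) I c m t m'" "bounded_memory L I X m" "writes c \<subseteq> X" "max_expr_size c \<le> C"
    "0 < L" "finite X" "card X \<le> K"
  shows "halts (step_bound C L) (space_bound K L I) t c m (return_pmf m') \<and> bounded_memory L I X m'"
  using assms(1-4)
proof (induction rule: big.induct)
  case (Skip m)
  then show ?case using space_le[OF _ assms(6,7)] by (auto intro: halts.halt)
next
  case (Assign e1 m e2 x)
  let ?m = "store m x (expr_val e1 m) (expr_val e2 m)"
  have b: "bounded_memory L I X ?m" using Assign by (intro bounded_memory_store) auto
  have "halts (step_bound C L) (space_bound K L I) (Suc 0) (Assign x e1 e2) m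
     (bind_pmf (step (Assign x e1 e2) m) (\<lambda>(c', m'). return_pmf m'))"
    using Assign b expr_cost2_step_bound[of L I X m e1 e2 C] assms(5)
    by (intro halts.move) (auto intro!: halts.halt space_le[OF _ assms(6,7)])
  with b show ?case by (simp add: bind_return_pmf)
next
  case (Seq c1 m t1 m1 c2 t2 m2)
  then have "halts (step_bound C L) (space_bound K L I) (t1 + t2 + 1) (Seq c1 c2) m
     (bind_pmf (return_pmf m1) (\<lambda>_. return_pmf m2))"
    by (intro halts_Seq) (auto simp: step_bound_def)
  with Seq show ?case by (simp add: bind_return_pmf)
next
  case (CondT e m c1 t m' c2)
  have "halts (step_bound C L) (space_bound K L I) (Suc t) (Cond e c1 c2) m
     (bind_pmf (step (Cond e c1 c2) m) (\<lambda>_. return_pmf m'))"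
    using CondT expr_cost_step_bound[of L I X m e C] assms(5)
    by (intro halts.move) (auto intro!: space_le[OF _ assms(6,7)])
  with CondT show ?case by (simp add: bind_return_pmf)
next
  case (CondF e m c2 t m' c1)
  have "halts (step_bound C L) (space_bound K L I) (Suc t) (Cond e c1 c2) m
     (bind_pmf (step (Cond e c1 c2) m) (\<lambda>_. return_pmf m'))"
    using CondF expr_cost_step_bound[of L I X m e C] assms(5)
    by (intro halts.move) (auto intro!: space_le[OF _ assms(6,7)])
  with CondF show ?case by (simp add: bind_return_pmf)
next
  case (WhileF e m c)
  have "halts (step_bound C L) (space_bound K L I) (Suc 0) (While e c) m
     (bind_pmf (step (While e c) m) (\<lambda>_. return_pmf m))"
    using WhileF expr_cost_step_bound[of L I X m e C] assms(5)
    by (intro halts.move) (auto intro!: halts.halt space_le[OF _ assms(6,7)])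
  with WhileF show ?case by (simp add: bind_return_pmf)
next
  case (WhileT e m c t1 m1 t2 m2)
  then have "halts (step_bound C L) (space_bound K L I) (t1 + t2 + 1) (Seq c (While e c)) m
     (bind_pmf (return_pmf m1) (\<lambda>_. return_pmf m2))"
    by (intro halts_Seq) (auto simp: step_bound_def)
  then have *: "halts (step_bound C L) (space_bound K L I) (t1 + t2 + 1) (Seq c (While e c)) m (return_pmf m2)"
    by (simp add: bind_return_pmf)
  have "halts (step_bound C L) (space_bound K L I) (Suc (t1 + t2 + 1)) (While e c) m
     (bind_pmf (step (While e c) m) (\<lambda>_. return_pmf m2))"
    using WhileT * expr_cost_step_bound[of L I X m e C] assms(5)
    by (intro halts.move) (auto intro!: space_le[OF _ assms(6,7)])
  with WhileT show ?case by (simp add: bind_return_pmf)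
qed

section \<open>Total correctness with a step budget\<close>

definition tot :: "nat \<Rightarrow> nat \<Rightarrow> com \<Rightarrow> memory \<Rightarrow> nat \<Rightarrow> (memory \<Rightarrow> bool) \<Rightarrow> bool" where
  "tot V I c m k Q \<longleftrightarrow> (\<exists>t m'. big V I c m t m' \<and> t \<le> k \<and> Q m')"

text \<open>The frame condition is handed over to the consequence, so postconditions can omit
  whatever the command does not write.\<close>

lemma tot_mono:
  assumes "tot V I c m k Q" "k \<le> k'"
    "\<And>s. Q s \<Longrightarrow> (\<And>x. x \<notin> writes c \<Longrightarrow> s x = m x) \<Longrightarrow> Q' s"
  shows "tot V I c m k' Q'"
  using assms big_frame unfolding tot_def by (meson order_trans)

lemma tot_Seq:
  assumes "tot V I c1 m k1 Q1" "\<And>s. Q1 s \<Longrightarrow> (\<And>x. x \<notin> writes c1 \<Longrightarrow> s x = m x) \<Longrightarrow> tot V I c2 s k2 Q"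
    "k1 + k2 + 1 \<le> k"
  shows "tot V I (Seq c1 c2) m k Q"
proof -
  from assms(1) obtain t m1 where 1: "big V I c1 m t m1" "t \<le> k1" "Q1 m1" by (auto simp: tot_def)
  from assms(2)[OF 1(3) big_frame[OF 1(1)]] obtain t' m2 where
    "big V I c2 m1 t' m2" "t' \<le> k2" "Q m2" by (auto simp: tot_def)
  with 1 big.Seq[OF 1(1)] assms(3) show ?thesis unfolding tot_def
    by (intro exI[of _ "t + t' + 1"] exI[of _ m2]) auto
qed

lemma tot_Cond:
  assumes "expr_val e m \<noteq> 0 \<Longrightarrow> tot V I c1 m k Q" "expr_val e m = 0 \<Longrightarrow> tot V I c2 m k Q" "k + 1 \<le> k'"
  shows "tot V I (Cond e c1 c2) m k' Q"
proof (cases "expr_val e m = 0")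
  case True
  with assms(2) obtain t m' where "big V I c2 m t m'" "t \<le> k" "Q m'" by (auto simp: tot_def)
  with True assms(3) show ?thesis unfolding tot_def
    by (intro exI[of _ "t + 1"] exI[of _ m']) (auto intro: big.CondF[simplified])
next
  case False
  with assms(1) obtain t m' where "big V I c1 m t m'" "t \<le> k" "Q m'" by (auto simp: tot_def)
  with False assms(3) show ?thesis unfolding tot_def
    by (intro exI[of _ "t + 1"] exI[of _ m']) (auto intro: big.CondT[simplified])
qed

text \<open>Meant for loop-free code. Loops get rules with invariants, and coin flips have no
  counterpart in the deterministic \<open>big\<close>; both are mapped to
  \<open>False\<close>.\<close>

fun wp :: "nat \<Rightarrow> nat \<Rightarrow> com \<Rightarrow> (memory \<Rightarrow> bool) \<Rightarrow> memory \<Rightarrow> bool" where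
  "wp V I Skip Q m = Q m"
| "wp V I (Assign x e1 e2) Q m =
     (expr_val e1 m < I \<and> expr_val e2 m < V \<and> Q (store m x (expr_val e1 m) (expr_val e2 m)))"
| "wp V I (Flip x e) Q m = False"
| "wp V I (Seq c1 c2) Q m = wp V I c1 (wp V I c2 Q) m"
| "wp V I (Cond e c1 c2) Q m = (if expr_val e m \<noteq> 0 then wp V I c1 Q m else wp V I c2 Q m)"
| "wp V I (While e c) Q m = False"

fun steps :: "com \<Rightarrow> nat" where
  "steps (Seq c1 c2) = steps c1 + steps c2 + 1"
| "steps (Cond e c1 c2) = steps c1 + steps c2 + 1"
| "steps c = 1"

lemma tot_wp: "wp V I c Q m \<Longrightarrow> steps c \<le> k \<Longrightarrow> tot V I c m k Q"
proof (induction c arbitrary: m Q k)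
  case Skip
  then show ?case by (auto simp: tot_def intro: big.Skip)
next
  case (Assign x e1 e2)
  then show ?case unfolding tot_def
    by (intro exI[of _ 1] exI[of _ "store m x (expr_val e1 m) (expr_val e2 m)"]) (auto intro: big.Assign[simplified])
next
  case (Seq c1 c2)
  have "tot V I c1 m (steps c1) (wp V I c2 Q)" using Seq.prems(1) by (intro Seq.IH(1)) auto
  from this _ show ?case
    by (rule tot_Seq[where ?k2.0 = "steps c2"]) (use Seq.prems in \<open>auto intro: Seq.IH(2)\<close>)
next
  case (Cond e c1 c2)
  show ?case using Cond.IH(1)[of Q m "steps c1 + steps c2"] Cond.IH(2)[of Q m "steps c1 + steps c2"] Cond.prems
    by (intro tot_Cond[where k="steps c1 + steps c2"]) (auto split: if_splits)
qed auto

abbreviation Var :: "string \<Rightarrow> expr" where "Var x \<equiv> Read x (Const 0)"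
abbreviation Set :: "string \<Rightarrow> expr \<Rightarrow> com" where "Set x e \<equiv> Assign x (Const 0) e"

definition For :: "string \<Rightarrow> expr \<Rightarrow> com \<Rightarrow> com" where
  "For i e c = Seq (Set i (Const 0)) (While (Op Less (Var i) e) (Seq c (Set i (Op Add (Var i) (Const 1)))))"

lemma writes_For [simp]: "writes (For i e c) = insert i (writes c)"
  by (auto simp: For_def)

lemma max_expr_size_For [simp]: "max_expr_size (For i e c) = max (expr_size e + 3) (max (max_expr_size c) 6)"
  by (auto simp: For_def)

text \<open>A round costs \<open>k\<close> for the body, 1 for the increment, 1 for their
  \<open>Seq\<close> and 2 for unfolding the loop. The final 3 are the initialization, its
  \<open>Seq\<close> and the last test. The bound \<open>e\<close> is evaluated anew in each round,
  hence the hypothesis \<open>bnd\<close>.\<close>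

lemma tot_For:
  assumes init: "P 0 (store m i 0 0)"
    and body: "\<And>j s. j < b \<Longrightarrow> P j s \<Longrightarrow> s i 0 = j \<Longrightarrow> (\<And>x. x \<noteq> i \<Longrightarrow> x \<notin> writes c \<Longrightarrow> s x = m x) \<Longrightarrow>
      tot V I c s k (\<lambda>s'. P (Suc j) (store s' i 0 (Suc j)))"
    and bnd: "\<And>j s. P j s \<Longrightarrow> (\<And>x. x \<noteq> i \<Longrightarrow> x \<notin> writes c \<Longrightarrow> s x = m x) \<Longrightarrow> expr_val e s = b"
    and post: "\<And>s. P b s \<Longrightarrow> s i 0 = b \<Longrightarrow> (\<And>x. x \<noteq> i \<Longrightarrow> x \<notin> writes c \<Longrightarrow> s x = m x) \<Longrightarrow> Q s"
    and "i \<notin> writes c" "b < V" "0 < I" "b * (k + 4) + 3 \<le> K"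
  shows "tot V I (For i e c) m K Q"
proof -
  let ?body = "Seq c (Set i (Op Add (Var i) (Const 1)))"
  let ?w = "While (Op Less (Var i) e) ?body"
  have loop: "\<exists>t s'. big V I ?w s t s' \<and> t \<le> (b - j) * (k + 4) + 1 \<and> P b s' \<and> s' i 0 = b \<and>
      (\<forall>x. x \<noteq> i \<longrightarrow> x \<notin> writes c \<longrightarrow> s' x = m x)"
    if "P j s" "s i 0 = j" "j \<le> b" "\<And>x. x \<noteq> i \<Longrightarrow> x \<notin> writes c \<Longrightarrow> s x = m x" for j s
    using that
  proof (induction "b - j" arbitrary: j s)
    case 0
    then have "j = b" by simp
    with 0 bnd[OF 0(2,5)] have "big V I ?w s 1 s" by (intro big.WhileF) auto
    with 0 \<open>j = b\<close> show ?case by (intro exI[of _ 1] exI[of _ s]) auto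
  next
    case (Suc d)
    then have j: "j < b" by simp
    from body[OF j Suc(3,4,6)] obtain t s' where 1: "big V I c s t s'" "t \<le> k"
      "P (Suc j) (store s' i 0 (Suc j))" by (auto simp: tot_def)
    have fr: "s' x = s x" if "x \<notin> writes c" for x using big_frame[OF 1(1) that] .
    let ?s = "store s' i 0 (Suc j)"
    have si: "s' i 0 = j" using fr assms(5) Suc(4) by simp
    have "big V I (Set i (Op Add (Var i) (Const 1))) s' 1 ?s"
      using big.Assign[of "Const 0" s' I "Op Add (Var i) (Const 1)" V i] assms(6,7) j si by simp
    from big.Seq[OF 1(1) this] have 2: "big V I ?body s (t + 2) ?s" by simp
    have "\<exists>t s'. big V I ?w ?s t s' \<and> t \<le> (b - Suc j) * (k + 4) + 1 \<and> P b s' \<and> s' i 0 = b \<and>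
      (\<forall>x. x \<noteq> i \<longrightarrow> x \<notin> writes c \<longrightarrow> s' x = m x)"
      using Suc(2) j 1(3) fr Suc(6) by (intro Suc(1)) (auto simp: store_def)
    then obtain t' s'' where 3: "big V I ?w ?s t' s''" "t' \<le> (b - Suc j) * (k + 4) + 1" "P b s''"
      "s'' i 0 = b" "\<forall>x. x \<noteq> i \<longrightarrow> x \<notin> writes c \<longrightarrow> s'' x = m x" by blast
    have "big V I ?w s (t + 2 + t' + 2) s''"
      using bnd[OF Suc(3,6)] j Suc(4) by (intro big.WhileT[OF _ 2 3(1)]) auto
    moreover have "t + 2 + t' + 2 \<le> (b - j) * (k + 4) + 1"
    proof -
      have "b - j = Suc (b - Suc j)" using j by simp
      then have "(b - j) * (k + 4) = (b - Suc j) * (k + 4) + (k + 4)" by simp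
      with 1(2) 3(2) show ?thesis by linarith
    qed
    ultimately show ?case using 3 by blast
  qed
  have 0: "big V I (Set i (Const 0)) m 1 (store m i 0 0)"
    using big.Assign[of "Const 0" m I "Const 0" V i] assms(6,7) by simp
  from loop[of 0 "store m i 0 0"] init obtain t s' where "big V I ?w (store m i 0 0) t s'"
     "t \<le> b * (k + 4) + 1" "P b s'" "s' i 0 = b" "\<forall>x. x \<noteq> i \<longrightarrow> x \<notin> writes c \<longrightarrow> s' x = m x"
    by (auto simp: store_def)
  with big.Seq[OF 0 this(1)] post assms(8) show ?thesis unfolding tot_def For_def
    by (intro exI[of _ "1 + t + 1"] exI[of _ s']) auto
qed

text \<open>The measure has to drop only if the loop goes on, so there are at most
  \<open>f m + 1\<close> rounds, each with 2 steps for unfolding the loop.\<close>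

lemma tot_While:
  assumes "P m"
    and body: "\<And>s. P s \<Longrightarrow> expr_val e s \<noteq> 0 \<Longrightarrow> (\<And>x. x \<notin> writes c \<Longrightarrow> s x = m x) \<Longrightarrow>
        tot V I c s k (\<lambda>s'. P s' \<and> (expr_val e s' \<noteq> 0 \<longrightarrow> f s' < f s))"
    and post: "\<And>s. P s \<Longrightarrow> expr_val e s = 0 \<Longrightarrow> (\<And>x. x \<notin> writes c \<Longrightarrow> s x = m x) \<Longrightarrow> Q s"
    and "(f m + 1) * (k + 2) + 1 \<le> K"
  shows "tot V I (While e c) m K Q"
proof -
  have loop: "\<exists>t s'. big V I (While e c) s t s' \<and>
      t \<le> (if expr_val e s = 0 then 0 else (f s + 1) * (k + 2)) + 1 \<and> P s' \<and> expr_val e s' = 0 \<and>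
      (\<forall>x. x \<notin> writes c \<longrightarrow> s' x = m x)"
    if "P s" "\<And>x. x \<notin> writes c \<Longrightarrow> s x = m x" for s
    using that
  proof (induction "f s" arbitrary: s rule: less_induct)
    case less
    show ?case
    proof (cases "expr_val e s = 0")
      case True
      then have "big V I (While e c) s 1 s" by (intro big.WhileF)
      with True less show ?thesis by (intro exI[of _ 1] exI[of _ s]) auto
    next
      case False
      from body[OF less(2) False less(3)] obtain t s' where 1: "big V I c s t s'" "t \<le> k" "P s'"
        "expr_val e s' \<noteq> 0 \<longrightarrow> f s' < f s" by (auto simp: tot_def)
      have fr: "s' x = m x" if "x \<notin> writes c" for x using big_frame[OF 1(1) that] less(3) that by simp
      have "\<exists>t2 s2. big V I (While e c) s' t2 s2 \<and> t2 \<le> f s * (k + 2) + 1 \<and> P s2 \<and> expr_val e s2 = 0 \<and>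
         (\<forall>x. x \<notin> writes c \<longrightarrow> s2 x = m x)"
      proof (cases "expr_val e s' = 0")
        case True
        then have "big V I (While e c) s' 1 s'" by (intro big.WhileF)
        with True 1 fr show ?thesis by (intro exI[of _ 1] exI[of _ s']) auto
      next
        case False
        with less(1)[OF _ 1(3) fr] 1(4) obtain t2 s2 where 2: "big V I (While e c) s' t2 s2"
          "t2 \<le> (f s' + 1) * (k + 2) + 1" "P s2" "expr_val e s2 = 0" "\<forall>x. x \<notin> writes c \<longrightarrow> s2 x = m x" by auto
        have "(f s' + 1) * (k + 2) \<le> f s * (k + 2)" using 1(4) False by (intro mult_right_mono) auto
        with 2 show ?thesis by (intro exI[of _ t2] exI[of _ s2]) auto
      qed
      then obtain t2 s2 where 2: "big V I (While e c) s' t2 s2" "t2 \<le> f s * (k + 2) + 1" "P s2"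
        "expr_val e s2 = 0" "\<forall>x. x \<notin> writes c \<longrightarrow> s2 x = m x" by blast
      from big.WhileT[OF False 1(1) 2(1)] 1(2) 2 False show ?thesis
        by (intro exI[of _ "t + t2 + 2"] exI[of _ s2]) auto
    qed
  qed
  from loop[OF assms(1)] obtain t s' where "big V I (While e c) m t s'"
     "t \<le> (f m + 1) * (k + 2) + 1" "P s'" "expr_val e s' = 0" "\<forall>x. x \<notin> writes c \<longrightarrow> s' x = m x"
    by (auto split: if_splits)
  with post assms(4) show ?thesis unfolding tot_def
    by (intro exI[of _ t] exI[of _ s']) auto
qed

section \<open>Multiaffine functions and random digits\<close>

text \<open>Degree at most 1 in each variable, expressed through values. This is all that root
  counting uses, and it avoids polynomials in several variables.\<close>

definition multiaffine :: "((nat \<Rightarrow> nat) \<Rightarrow> int) \<Rightarrow> bool" where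
  "multiaffine F \<longleftrightarrow> (\<forall>f j. \<exists>a b. \<forall>v. F (f(j := v)) = a + b * int v)"

lemma multiaffine_const_mult: "multiaffine F \<Longrightarrow> multiaffine (\<lambda>f. c * F f)"
proof -
  assume *: "multiaffine F"
  show ?thesis unfolding multiaffine_def
  proof (intro allI)
    fix f j
    obtain a b where "\<forall>v. F (f(j := v)) = a + b * int v" using * unfolding multiaffine_def by blast
    then show "\<exists>a b. \<forall>v. c * F (f(j := v)) = a + b * int v"
      by (intro exI[of _ "c * a"] exI[of _ "c * b"]) (simp add: algebra_simps)
  qed
qed

lemma multiaffine_sum: "(\<And>i. i \<in> S \<Longrightarrow> multiaffine (F i)) \<Longrightarrow> multiaffine (\<lambda>f. \<Sum>i\<in>S. F i f)"
proof -
  assume *: "\<And>i. i \<in> S \<Longrightarrow> multiaffine (F i)"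
  show ?thesis unfolding multiaffine_def
  proof (intro allI)
    fix f j
    have "\<forall>i\<in>S. \<exists>a b. \<forall>v. F i (f(j := v)) = a + b * int v" using * unfolding multiaffine_def by blast
    then obtain a b where "\<forall>i\<in>S. \<forall>v. F i (f(j := v)) = a i + b i * int v" by metis
    then show "\<exists>a b. \<forall>v. (\<Sum>i\<in>S. F i (f(j := v))) = a + b * int v"
      by (intro exI[of _ "sum a S"] exI[of _ "sum b S"]) (simp add: sum.distrib sum_distrib_right)
  qed
qed

text \<open>Injectivity of \<open>h\<close> means that no variable occurs twice in the
  product.\<close>

lemma multiaffine_monomial:
  assumes "finite S" "inj_on h S"
  shows "multiaffine (\<lambda>f. \<Prod>i\<in>S. int (f (h i)))"
  unfolding multiaffine_def
proof (intro allI)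
  fix f :: "nat \<Rightarrow> nat" and j
  show "\<exists>a b. \<forall>v. (\<Prod>i\<in>S. int ((f(j := v)) (h i))) = a + b * int v"
  proof (cases "j \<in> h ` S")
    case False
    then have "(\<Prod>i\<in>S. int ((f(j := v)) (h i))) = (\<Prod>i\<in>S. int (f (h i))) + 0 * int v" for v
      by (auto intro!: prod.cong)
    then show ?thesis by blast
  next
    case True
    then obtain i where i: "i \<in> S" "h i = j" by auto
    have "(\<Prod>i\<in>S. int ((f(j := v)) (h i))) = 0 + (\<Prod>i\<in>S - {i}. int (f (h i))) * int v" for v
    proof -
      have "(\<Prod>i\<in>S - {i}. int ((f(j := v)) (h i))) = (\<Prod>i\<in>S - {i}. int (f (h i)))"
        using i assms(2) by (intro prod.cong) (auto dest: inj_onD)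
      then show ?thesis using prod.remove[OF assms(1) i(1), of "\<lambda>i. int ((f(j := v)) (h i))"] i(2) by simp
    qed
    then show ?thesis by blast
  qed
qed

section \<open>Digit vectors and zeros of multiaffine functions\<close>

definition digit :: "nat \<Rightarrow> nat \<Rightarrow> nat \<Rightarrow> nat" where
  "digit q Z j = Z div q ^ j mod q"

text \<open>Peels off the most significant digit, for inductions on the number of digits. The two
  sides agree as functions because all digits beyond position \<open>K\<close> vanish.\<close>

lemma digit_append:
  assumes "v < q" "Z < q ^ K"
  shows "digit q (v * q ^ K + Z) = (digit q Z)(K := v)"
proof
  fix j
  have q: "0 < q" using assms(1) by simp
  show "digit q (v * q ^ K + Z) j = ((digit q Z)(K := v)) j"
  proof (cases "j < K")
    case True
    then have K: "q ^ K = q ^ (K - Suc j) * q * q ^ j" by (simp flip: power_add power_Suc add: mult.assoc)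
    have "v * q ^ K + Z = Z + q ^ j * (v * q ^ (K - Suc j) * q)" using K by (simp add: ac_simps)
    then have "(v * q ^ K + Z) div q ^ j = Z div q ^ j + v * q ^ (K - Suc j) * q"
      using q by (simp only: div_mult_self2 power_eq_0_iff) simp
    with True show ?thesis by (simp add: digit_def)
  next
    case False
    have 1: "(v * q ^ K + Z) div q ^ K = v" using assms(2) q by simp
    have "q ^ j = q ^ K * q ^ (j - K)" using False by (simp flip: power_add)
    then have 2: "(v * q ^ K + Z) div q ^ j = v div q ^ (j - K)" by (simp only: div_mult2_eq 1)
    show ?thesis
    proof (cases "j = K")
      case True
      with 2 assms(1) show ?thesis by (simp add: digit_def)
    next
      case False
      have "q ^ 1 \<le> q ^ (j - K)" using False \<open>\<not> j < K\<close> q by (intro power_increasing) auto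
      then have "v < q ^ (j - K)" using assms(1) by simp
      moreover have "Z < q ^ j" using assms(2) \<open>\<not> j < K\<close> q power_increasing[of K j q] by simp
      ultimately show ?thesis using 2 False by (simp add: digit_def)
    qed
  qed
qed

lemma sum_lessThan_append:
  fixes g :: "nat \<Rightarrow> 'a::comm_monoid_add"
  shows "(\<Sum>x<n * k. g x) = (\<Sum>v<n. \<Sum>x<k. g (v * k + x))"
proof -
  have "sum g {m * k..<m * k + k} = (\<Sum>x<k. g (m * k + x))" for m
    using sum.shift_bounds_nat_ivl[of g 0 "m * k" k] by (simp add: lessThan_atLeast0 add.commute)
  then show ?thesis using sum.nat_group[of g k n] by simp
qed

text \<open>The Schwartz--Zippel argument, by induction on the number of digits.\<close>

lemma multiaffine_zeros:
  assumes "multiaffine F" "F f \<noteq> 0" "\<And>j. K \<le> j \<Longrightarrow> f j = 0" "0 < q"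
  shows "q * card {Z. Z < q ^ K \<and> F (digit q Z) = 0} \<le> K * q ^ K"
  using assms(1-3)
proof (induction K arbitrary: F f)
  case 0
  have "digit q 0 = f" using 0(3) by (auto simp: digit_def)
  with 0(2) have "{Z. Z < q ^ 0 \<and> F (digit q Z) = 0} = {}" by auto
  then show ?case by simp
next
  case (Suc K)
  \<comment> \<open>The leading variable is frozen at its value in the witness \<open>f\<close>, so
    \<open>?G\<close> is again nonzero at some point, namely at \<open>f(K := 0)\<close>.\<close>
  let ?G = "\<lambda>g. F (g(K := f K))"
  have aff: "multiaffine ?G"
    unfolding multiaffine_def
  proof (intro allI)
    fix g j
    show "\<exists>a b. \<forall>v. F ((g(j := v))(K := f K)) = a + b * int v"
    proof (cases "j = K")
      case True
      then show ?thesis by (intro exI[of _ "F (g(K := f K))"] exI[of _ 0]) simp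
    next
      case False
      then have "(g(j := v))(K := f K) = (g(K := f K))(j := v)" for v by auto
      then show ?thesis using Suc(2) unfolding multiaffine_def by metis
    qed
  qed
  have IH: "q * card {Z. Z < q ^ K \<and> ?G (digit q Z) = 0} \<le> K * q ^ K"
  proof (rule Suc.IH[OF aff, of "f(K := 0)"])
    show "F ((f(K := 0))(K := f K)) \<noteq> 0" using Suc(3) by simp
  qed (use Suc(4) in \<open>auto simp: Suc_le_eq\<close>)
  \<comment> \<open>If \<open>?G\<close> vanishes at the lower digits, all \<open>q\<close> leading
    digits are given up. Otherwise the value is an affine function of the leading digit that is not
    identically zero, hence has at most one root.\<close>
  have inner: "(\<Sum>v<q. of_bool (F (digit q (v * q ^ K + Z)) = 0)) \<le>
      q * of_bool (?G (digit q Z) = 0) + (1::nat)" if Z: "Z < q ^ K" for Z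
  proof -
    have "(\<Sum>v<q. of_bool (F (digit q (v * q ^ K + Z)) = 0) :: nat) =
        (\<Sum>v<q. of_bool (F ((digit q Z)(K := v)) = 0))"
      using digit_append[OF _ Z] by (intro sum.cong) auto
    also have "\<dots> \<le> q * of_bool (?G (digit q Z) = 0) + 1"
    proof (cases "?G (digit q Z) = 0")
      case True
      have "(\<Sum>v<q. of_bool (F ((digit q Z)(K := v)) = 0) :: nat) \<le> (\<Sum>v<q. 1)"
        by (intro sum_mono) simp
      with True show ?thesis by simp
    next
      case False
      obtain a b where ab: "\<And>v. F ((digit q Z)(K := v)) = a + b * int v"
        using Suc(2) unfolding multiaffine_def by metis
      have "\<exists>v0. \<forall>v<q. F ((digit q Z)(K := v)) = 0 \<longrightarrow> v = v0"
      proof (cases "b = 0")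
        case True
        then show ?thesis using False ab by auto
      next
        case False
        then have "v = v'" if "a + b * int v = 0" "a + b * int v' = 0" for v v'
          using that by (metis add_left_cancel mult_left_cancel of_nat_eq_iff)
        then show ?thesis unfolding ab by blast
      qed
      then obtain v0 where "\<And>v. v < q \<Longrightarrow> F ((digit q Z)(K := v)) = 0 \<Longrightarrow> v = v0" by blast
      then have "(\<Sum>v<q. of_bool (F ((digit q Z)(K := v)) = 0) :: nat) \<le> (\<Sum>v<q. if v = v0 then 1 else 0)"
        by (intro sum_mono) auto
      also have "\<dots> \<le> 1" by simp
      finally show ?thesis by simp
    qed
    finally show ?thesis .
  qed
  have card_sum: "card {Z. Z < M \<and> P Z} = (\<Sum>Z<M. of_bool (P Z))" for M and P :: "nat \<Rightarrow> bool"
  proof -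
    have "(\<Sum>Z<M. of_bool (P Z) :: nat) = (\<Sum>Z\<in>{Z\<in>{..<M}. P Z}. 1)"
      by (subst sum.inter_filter) (auto simp: of_bool_def)
    then show ?thesis by simp
  qed
  have "card {Z. Z < q ^ Suc K \<and> F (digit q Z) = 0} = (\<Sum>v<q. \<Sum>Z<q ^ K. of_bool (F (digit q (v * q ^ K + Z)) = 0))"
    unfolding card_sum power_Suc by (rule sum_lessThan_append)
  also have "\<dots> = (\<Sum>Z<q ^ K. \<Sum>v<q. of_bool (F (digit q (v * q ^ K + Z)) = 0))"
    by (rule sum.swap)
  also have "\<dots> \<le> (\<Sum>Z<q ^ K. q * of_bool (?G (digit q Z) = 0) + 1)"
    using inner by (intro sum_mono) auto
  also have "\<dots> = q * card {Z. Z < q ^ K \<and> ?G (digit q Z) = 0} + q ^ K"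
    unfolding card_sum sum.distrib sum_distrib_left by simp
  also have "\<dots> \<le> Suc K * q ^ K" using IH by simp
  finally have "q * card {Z. Z < q ^ Suc K \<and> F (digit q Z) = 0} \<le> q * (Suc K * q ^ K)"
    using mult_le_mono2 by blast
  then show ?case by (simp add: ac_simps)
qed

text \<open>The distributive law, with a choice of one summand per factor encoded as a number of
  \<open>k\<close> digits. It lets a sum over states factor over the positions.\<close>

lemma sum_prod_digit:
  fixes h :: "nat \<Rightarrow> nat \<Rightarrow> 'a::comm_semiring_1"
  shows "(\<Sum>x<b ^ k. \<Prod>p<k. h p (digit b x p)) = (\<Prod>p<k. \<Sum>d<b. h p d)"
proof (induction k)
  case (Suc k)
  have "(\<Sum>x<b ^ Suc k. \<Prod>p<Suc k. h p (digit b x p)) =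
      (\<Sum>v<b. \<Sum>x<b ^ k. \<Prod>p<Suc k. h p (digit b (v * b ^ k + x) p))"
    using sum_lessThan_append[of _ b "b ^ k"] by simp
  also have "\<dots> = (\<Sum>v<b. \<Sum>x<b ^ k. (\<Prod>p<k. h p (digit b x p)) * h k v)"
    by (intro sum.cong refl) (auto simp: digit_append intro!: arg_cong2[of _ _ _ _ "(*)"] prod.cong)
  also have "\<dots> = (\<Sum>x<b ^ k. \<Prod>p<k. h p (digit b x p)) * (\<Sum>v<b. h k v)"
    by (subst sum.swap) (simp add: sum_product)
  finally show ?case using Suc by simp
qed simp


section \<open>Determinants\<close>

text \<open>Entries given by a function can be shifted, and rewritten modulo \<open>N\<close>,
  without carrying matrix dimensions along.\<close>

definition det_fun :: "nat \<Rightarrow> (nat \<Rightarrow> nat \<Rightarrow> int) \<Rightarrow> int" where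
  "det_fun n f = det (mat n n (\<lambda>(i, j). f i j))"

lemma det_fun_Leibniz: "det_fun n f = (\<Sum>p | p permutes {0..<n}. signof p * (\<Prod>i = 0..<n. f i (p i)))"
proof -
  have "(\<Prod>i = 0..<n. mat n n (\<lambda>(i, j). f i j) $$ (i, p i)) = (\<Prod>i = 0..<n. f i (p i))"
    if "p permutes {0..<n}" for p
  proof (intro prod.cong refl)
    fix i assume "i \<in> {0..<n}"
    moreover from this have "p i \<in> {0..<n}" using permutes_in_image[OF that] by blast
    ultimately show "mat n n (\<lambda>(i, j). f i j) $$ (i, p i) = f i (p i)" by simp
  qed
  then show ?thesis by (simp add: det_fun_def det_def'[of _ n])
qed

lemma det_fun_cong:
  assumes "\<And>i j. i < n \<Longrightarrow> j < n \<Longrightarrow> f i j = g i j"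
  shows "det_fun n f = det_fun n g"
  using assms unfolding det_fun_def by (intro arg_cong[of _ _ det]) auto

lemma det_fun_cong_mod:
  assumes "\<And>i j. i < n \<Longrightarrow> j < n \<Longrightarrow> [f i j = g i j] (mod N)"
  shows "[det_fun n f = det_fun n g] (mod N)"
  unfolding det_fun_Leibniz
proof (intro cong_sum cong_mult cong_refl cong_prod, clarify)
  fix p i assume p: "p permutes {0..<n}" and i: "i \<in> {0..<n}"
  from permutes_in_image[OF p] i have "p i < n" by auto
  with assms i show "[f i (p i) = g i (p i)] (mod N)" by auto
qed

text \<open>Multilinearity in the rows: each row \<open>i\<close> picks one summand
  \<open>f i\<close>.\<close>

lemma det_fun_expand:
  assumes "finite E"
  shows "det_fun n (\<lambda>i j. \<Sum>e\<in>E. w i e * g i e j) =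
    (\<Sum>f\<in>{0..<n} \<rightarrow>\<^sub>E E. (\<Prod>i = 0..<n. w i (f i)) * det_fun n (\<lambda>i j. g i (f i) j))"
proof -
  have "det_fun n (\<lambda>i j. \<Sum>e\<in>E. w i e * g i e j) =
     (\<Sum>p | p permutes {0..<n}. \<Sum>f\<in>{0..<n} \<rightarrow>\<^sub>E E. signof p * (\<Prod>i = 0..<n. w i (f i) * g i (f i) (p i)))"
    unfolding det_fun_Leibniz
    by (subst prod_sum_PiE) (auto simp: assms sum_distrib_left)
  also have "\<dots> = (\<Sum>f\<in>{0..<n} \<rightarrow>\<^sub>E E. \<Sum>p | p permutes {0..<n}. signof p * (\<Prod>i = 0..<n. w i (f i) * g i (f i) (p i)))"
    by (rule sum.swap)
  also have "\<dots> = (\<Sum>f\<in>{0..<n} \<rightarrow>\<^sub>E E. (\<Prod>i = 0..<n. w i (f i)) * det_fun n (\<lambda>i j. g i (f i) j))"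
    unfolding det_fun_Leibniz by (simp add: prod.distrib sum_distrib_left ac_simps)
  finally show ?thesis .
qed

lemma abs_signof: "\<bar>signof p :: int\<bar> = 1"
  by (simp add: sign_def)

lemma abs_det_fun_le:
  assumes "\<And>i j. i < n \<Longrightarrow> j < n \<Longrightarrow> \<bar>f i j\<bar> \<le> C"
  shows "\<bar>det_fun n f\<bar> \<le> fact n * C ^ n"
proof -
  have "\<bar>det_fun n f\<bar> \<le> (\<Sum>p | p permutes {0..<n}. \<bar>signof p * (\<Prod>i = 0..<n. f i (p i))\<bar>)"
    unfolding det_fun_Leibniz by (rule sum_abs)
  also have "\<dots> \<le> (\<Sum>p | p permutes {0..<n}. C ^ n)"
  proof (intro sum_mono, clarify)
    fix p assume p: "p permutes {0..<n}"
    have "(\<Prod>i = 0..<n. \<bar>f i (p i)\<bar>) \<le> (\<Prod>i = 0..<n. C)"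
      using permutes_in_image[OF p] assms by (intro prod_mono) auto
    then show "\<bar>signof p * (\<Prod>i = 0..<n. f i (p i))\<bar> \<le> C ^ n"
      by (simp add: abs_mult abs_signof abs_prod)
  qed
  also have "\<dots> = fact n * C ^ n" by (simp add: card_permutations[of _ n])
  finally show ?thesis .
qed

text \<open>The difference from the leading term has order \<open>t ^ (n - 1)\<close>; multiplying
  by \<open>t\<close> avoids this exponent, which would be truncated at
  \<open>n = 0\<close>.\<close>

lemma prod_perturb:
  fixes a d :: "nat \<Rightarrow> int"
  assumes "\<And>i. i < n \<Longrightarrow> \<bar>a i\<bar> \<le> B" "\<And>i. i < n \<Longrightarrow> \<bar>d i\<bar> \<le> 1" "1 \<le> t" "0 \<le> B"
  shows "t * \<bar>(\<Prod>i = 0..<n. d i + t * a i) - t ^ n * (\<Prod>i = 0..<n. a i)\<bar> \<le> int n * (t * (B + 1)) ^ n"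
  using assms(1,2)
proof (induction n)
  case (Suc n)
  define P where "P = (\<Prod>i = 0..<n. d i + t * a i)"
  define A where "A = (\<Prod>i = 0..<n. a i)"
  have IH: "t * \<bar>P - t ^ n * A\<bar> \<le> int n * (t * (B + 1)) ^ n" unfolding P_def A_def using Suc by auto
  have "\<bar>d n + t * a n\<bar> \<le> \<bar>d n\<bar> + \<bar>t * a n\<bar>" by (rule abs_triangle_ineq)
  also have "\<dots> \<le> t + t * B" using Suc.prems(1)[of n] Suc.prems(2)[of n] assms(3)
    by (intro add_mono) (auto simp: abs_mult)
  finally have dn: "\<bar>d n + t * a n\<bar> \<le> t * (B + 1)" by (simp add: algebra_simps)
  have "\<bar>A\<bar> \<le> (\<Prod>i = 0..<n. B)" unfolding A_def abs_prod using Suc.prems(1) by (intro prod_mono) auto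
  also have "\<dots> \<le> (B + 1) ^ n" using assms(4) by (simp add: power_mono)
  finally have A: "\<bar>A\<bar> \<le> (B + 1) ^ n" .
  \<comment> \<open>The old error is multiplied by the new factor; the new error is the contribution
    of \<open>d n\<close> times the old leading term.\<close>
  have eq: "(d n + t * a n) * P - t ^ Suc n * (a n * A) = (d n + t * a n) * (P - t ^ n * A) + d n * (t ^ n * A)"
    by (simp add: algebra_simps)
  have "t * \<bar>(d n + t * a n) * P - t ^ Suc n * (a n * A)\<bar> \<le>
      t * (\<bar>(d n + t * a n) * (P - t ^ n * A)\<bar> + \<bar>d n * (t ^ n * A)\<bar>)"
    unfolding eq using assms(3) by (intro mult_left_mono abs_triangle_ineq) auto
  also have "\<dots> = \<bar>d n + t * a n\<bar> * (t * \<bar>P - t ^ n * A\<bar>) + t ^ Suc n * (\<bar>d n\<bar> * \<bar>A\<bar>)"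
  proof -
    have "\<bar>d n * (t ^ n * A)\<bar> = \<bar>d n\<bar> * (t ^ n * \<bar>A\<bar>)" using assms(3) by (simp add: abs_mult)
    then show ?thesis unfolding abs_mult[of "d n + t * a n"] by (simp add: algebra_simps)
  qed
  also have "\<dots> \<le> (t * (B + 1)) * (int n * (t * (B + 1)) ^ n) + t ^ Suc n * (1 * (B + 1) ^ n)"
  proof (intro add_mono mult_left_mono)
    show "\<bar>d n + t * a n\<bar> * (t * \<bar>P - t ^ n * A\<bar>) \<le> t * (B + 1) * (int n * (t * (B + 1)) ^ n)"
      using assms(3,4) by (intro mult_mono[OF dn IH]) auto
    show "\<bar>d n\<bar> * \<bar>A\<bar> \<le> 1 * (B + 1) ^ n"
      using Suc.prems(2)[of n] A by (intro mult_mono) auto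
  qed (use assms(3) in auto)
  also have "\<dots> \<le> (t * (B + 1)) * (int n * (t * (B + 1)) ^ n) + t ^ Suc n * (B + 1) ^ Suc n"
    using assms(3,4) by (intro add_mono mult_left_mono) auto
  also have "\<dots> = int (Suc n) * (t * (B + 1)) ^ Suc n"
  proof -
    have "t * C * (int n * (t * C) ^ n) + t ^ Suc n * C ^ Suc n = int (Suc n) * (t * C) ^ Suc n" for C
      by (simp add: power_mult_distrib algebra_simps)
    then show ?thesis .
  qed
  finally show ?case by (simp add: P_def A_def ac_simps)
qed simp

lemma det_fun_perturb:
  assumes "\<And>i j. i < n \<Longrightarrow> j < n \<Longrightarrow> \<bar>a i j\<bar> \<le> B" "1 \<le> t" "0 \<le> B"
  shows "t * \<bar>det_fun n (\<lambda>i j. of_bool (i = j) + t * a i j) - t ^ n * det_fun n a\<bar> \<le>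
    fact n * (int n * (t * (B + 1)) ^ n)"
proof -
  let ?D = "\<lambda>p. (\<Prod>i = 0..<n. of_bool (i = p i) + t * a i (p i)) - t ^ n * (\<Prod>i = 0..<n. a i (p i))"
  have "det_fun n (\<lambda>i j. of_bool (i = j) + t * a i j) - t ^ n * det_fun n a =
     (\<Sum>p | p permutes {0..<n}. signof p * ?D p)"
    unfolding det_fun_Leibniz by (simp add: sum_distrib_left sum_subtractf[symmetric] algebra_simps)
  then have "t * \<bar>det_fun n (\<lambda>i j. of_bool (i = j) + t * a i j) - t ^ n * det_fun n a\<bar> \<le>
     t * (\<Sum>p | p permutes {0..<n}. \<bar>signof p * ?D p\<bar>)"
    using assms(2) by (intro mult_left_mono) (auto intro: sum_abs)
  also have "\<dots> = (\<Sum>p | p permutes {0..<n}. t * \<bar>?D p\<bar>)"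
    by (simp add: abs_mult abs_signof sum_distrib_left)
  also have "\<dots> \<le> (\<Sum>p | p permutes {0..<n}. int n * (t * (B + 1)) ^ n)"
  proof (intro sum_mono, clarify)
    fix p assume p: "p permutes {0..<n}"
    show "t * \<bar>?D p\<bar> \<le> int n * (t * (B + 1)) ^ n"
      using permutes_in_image[OF p] assms by (intro prod_perturb) auto
  qed
  also have "\<dots> = fact n * (int n * (t * (B + 1)) ^ n)" by (simp add: card_permutations[of _ n])
  finally show ?thesis .
qed

subsection \<open>Gaussian elimination with unit pivots\<close>

text \<open>The inverse \<open>y\<close> of the pivot exists only modulo \<open>N\<close>, yet
  subtracting multiples of the first row is an exact integer operation of determinant 1. Only the
  clearing of the first column needs the congruence.\<close>

lemma det_fun_Schur:
  assumes "[y * f 0 0 = 1] (mod N)"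
  shows "[det_fun (Suc n) f = f 0 0 * det_fun n (\<lambda>i j. f (Suc i) (Suc j) - f (Suc i) 0 * y * f 0 (Suc j))] (mod N)"
proof -
  define B where "B = (\<lambda>i j. if i = 0 then f i j else f i j - f i 0 * y * f 0 j)"
  define Lf where "Lf = (\<lambda>i j. if i = j then 1 else if j = 0 then f i 0 * y else 0 :: int)"
  define S where "S = (\<lambda>i j. f (Suc i) (Suc j) - f (Suc i) 0 * y * f 0 (Suc j))"
  let ?m = "\<lambda>g. mat (Suc n) (Suc n) (\<lambda>(i, j). g i j)"
  have "?m f = ?m Lf * ?m B"
  proof (rule eq_matI)
    fix i j assume ij: "i < dim_row (?m Lf * ?m B)" "j < dim_col (?m Lf * ?m B)"
    have "(?m Lf * ?m B) $$ (i, j) = (\<Sum>k = 0..<Suc n. Lf i k * B k j)"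
      using ij by (simp add: scalar_prod_def)
    also have "\<dots> = (\<Sum>k = 0..<Suc n. (if k = i then B i j else 0) + (if k = 0 then (if i = 0 then 0 else f i 0 * y * f 0 j) else 0))"
      by (intro sum.cong refl) (auto simp: Lf_def B_def)
    also have "\<dots> = f i j" using ij by (simp add: sum.distrib B_def)
    finally show "?m f $$ (i, j) = (?m Lf * ?m B) $$ (i, j)" using ij by simp
  qed simp_all
  then have "det (?m f) = det (?m Lf) * det (?m B)"
    by (simp add: det_mult[of _ "Suc n"])
  moreover have "det (?m Lf) = 1"
  proof -
    have "det (?m Lf) = prod_list (diag_mat (?m Lf))"
      by (rule det_lower_triangular[of "Suc n"]) (auto simp: Lf_def)
    also have "\<dots> = 1"
    proof -
      have "(\<forall>x\<in>set xs. x = 1) \<Longrightarrow> prod_list xs = (1::int)" for xs by (induction xs) auto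
      then show ?thesis by (auto simp: diag_mat_def Lf_def)
    qed
    finally show ?thesis .
  qed
  ultimately have 1: "det_fun (Suc n) f = det_fun (Suc n) B" by (simp add: det_fun_def)
  \<comment> \<open>Below the pivot, \<open>B\<close> retains
    \<open>f i 0 * (1 - y * f 0 0)\<close>, which is 0 modulo \<open>N\<close>.\<close>
  define B' where "B' = (\<lambda>i j. if i \<noteq> 0 \<and> j = 0 then 0 else B i j)"
  have 2: "[det_fun (Suc n) B = det_fun (Suc n) B'] (mod N)"
  proof (rule det_fun_cong_mod)
    fix i j
    have "[f i 0 * (1 - y * f 0 0) = f i 0 * (1 - 1)] (mod N)"
      using assms by (intro cong_mult cong_diff cong_refl)
    then show "[B i j = B' i j] (mod N)" by (auto simp: B_def B'_def algebra_simps)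
  qed
  have "?m B' = four_block_mat (mat 1 1 (\<lambda>_. f 0 0)) (mat 1 n (\<lambda>(i, j). f 0 (Suc j))) (0\<^sub>m n 1) (mat n n (\<lambda>(i, j). S i j))"
    by (rule eq_matI) (auto simp: B'_def B_def S_def four_block_mat_def Let_def)
  then have "det (?m B') = f 0 0 * det_fun n S"
    unfolding det_fun_def by (simp add: det_four_block_mat_lower_left_zero_col[of _ _ n] det_single)
  then have 3: "det_fun (Suc n) B' = f 0 0 * det_fun n S" by (simp add: det_fun_def)
  show ?thesis using 2 unfolding 1 3 S_def .
qed

text \<open>A Newton step squares the error \<open>1 - x * y\<close>. Of this quadratic gain only
  one more power of \<open>t\<close> is recorded.\<close>

lemma Newton_inverse_step:
  fixes x y t :: int
  assumes "t ^ Suc j dvd 1 - x * y" "1 \<le> t"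
  shows "t ^ Suc (Suc j) dvd 1 - x * (y * (2 - x * y))"
proof -
  have "1 - x * (y * (2 - x * y)) = (1 - x * y) * (1 - x * y)" by (simp add: algebra_simps)
  moreover have "t ^ Suc j * t ^ Suc j dvd (1 - x * y) * (1 - x * y)" using assms by (intro mult_dvd_mono)
  moreover have "t ^ Suc (Suc j) dvd t ^ Suc j * t ^ Suc j"
    unfolding power_add[symmetric] by (rule le_imp_power_dvd) simp
  ultimately show ?thesis by (metis dvd_trans)
qed

subsection \<open>Incidence matrices\<close>

text \<open>
  Row \<open>r > 0\<close> is the arc from \<open>s r\<close> to \<open>d r\<close>; row 0 grounds the vertex 0. By the matrix-tree
  theorem the determinant detects whether the arcs of the rows \<open>r > 0\<close> form a spanning tree.
\<close>

definition incidence :: "nat \<Rightarrow> nat \<Rightarrow> nat \<Rightarrow> nat \<Rightarrow> int" where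
  "incidence r u v c = (if r = 0 then of_bool (c = 0) else of_bool (c = u) - of_bool (c = v))"

text \<open>Only the vanishing of incidence determinants matters, not their values. A kernel vector
  will be read as a potential on the vertices, which replaces counting spanning trees.\<close>

lemma det_fun_eq_0_iff:
  "det_fun n f = 0 \<longleftrightarrow> (\<exists>x. (\<exists>c<n. x c \<noteq> 0) \<and> (\<forall>i<n. (\<Sum>c = 0..<n. f i c * x c) = 0))"
proof -
  have "det_fun n f = 0 \<longleftrightarrow> (\<exists>v. v \<in> carrier_vec n \<and> v \<noteq> 0\<^sub>v n \<and> mat n n (\<lambda>(i, j). f i j) *\<^sub>v v = 0\<^sub>v n)"
    unfolding det_fun_def by (rule det_0_iff_vec_prod_zero) simp
  also have "\<dots> \<longleftrightarrow> (\<exists>x. (\<exists>c<n. x c \<noteq> 0) \<and> (\<forall>i<n. (\<Sum>c = 0..<n. f i c * x c) = 0))"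
  proof
    assume "\<exists>v. v \<in> carrier_vec n \<and> v \<noteq> 0\<^sub>v n \<and> mat n n (\<lambda>(i, j). f i j) *\<^sub>v v = 0\<^sub>v n"
    then obtain v where v: "v \<in> carrier_vec n" "v \<noteq> 0\<^sub>v n" "mat n n (\<lambda>(i, j). f i j) *\<^sub>v v = 0\<^sub>v n" by blast
    have "\<exists>c<n. v $ c \<noteq> 0" using v(1,2) by auto
    moreover have "(\<Sum>c = 0..<n. f i c * v $ c) = 0" if "i < n" for i
      using arg_cong[OF v(3), of "\<lambda>w. w $ i"] that v(1) by (simp add: scalar_prod_def)
    ultimately show "\<exists>x. (\<exists>c<n. x c \<noteq> 0) \<and> (\<forall>i<n. (\<Sum>c = 0..<n. f i c * x c) = 0)" by blast
  next
    assume "\<exists>x. (\<exists>c<n. x c \<noteq> 0) \<and> (\<forall>i<n. (\<Sum>c = 0..<n. f i c * x c) = 0)"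
    then obtain x where x: "\<exists>c<n. x c \<noteq> 0" "\<forall>i<n. (\<Sum>c = 0..<n. f i c * x c) = 0" by blast
    have "vec n x \<noteq> 0\<^sub>v n" using x(1) by (metis index_vec index_zero_vec(1))
    moreover have "mat n n (\<lambda>(i, j). f i j) *\<^sub>v vec n x = 0\<^sub>v n"
      using x(2) by (auto simp: scalar_prod_def)
    ultimately show "\<exists>v. v \<in> carrier_vec n \<and> v \<noteq> 0\<^sub>v n \<and> mat n n (\<lambda>(i, j). f i j) *\<^sub>v v = 0\<^sub>v n"
      by (intro exI[of _ "vec n x"]) auto
  qed
  finally show ?thesis .
qed

lemma sum_incidence:
  assumes "u < n" "v < n" "0 < n"
  shows "(\<Sum>c = 0..<n. incidence r u v c * x c) = (if r = 0 then x 0 else x u - x v)"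
proof -
  have "(\<Sum>c = 0..<n. of_bool (c = a) * x c) = x a" if "a < n" for a
    using that by (simp add: of_bool_def if_distrib[of "\<lambda>y. y * _"] cong: if_cong)
  then show ?thesis using assms
    by (simp add: incidence_def left_diff_distrib sum_subtractf)
qed

text \<open>The indicator of a union \<open>U\<close> of components that misses the root is a
  potential in the kernel.\<close>

lemma det_incidence_disconnected:
  assumes "\<And>r. r < n \<Longrightarrow> s r < n \<and> d r < n" "U \<subseteq> {..<n}" "U \<noteq> {}" "0 \<notin> U"
    "\<And>r. 0 < r \<Longrightarrow> r < n \<Longrightarrow> s r \<in> U \<longleftrightarrow> d r \<in> U"
  shows "det_fun n (\<lambda>r. incidence r (s r) (d r)) = 0"
  unfolding det_fun_eq_0_iff
proof (intro exI[of _ "\<lambda>c. of_bool (c \<in> U)"] conjI allI impI)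
  show "\<exists>c<n. of_bool (c \<in> U) \<noteq> (0::int)" using assms(2,3) by auto
  fix i assume i: "i < n"
  then show "(\<Sum>c = 0..<n. incidence i (s i) (d i) c * of_bool (c \<in> U)) = 0"
    using assms(1)[OF i] assms(4) assms(5)[of i] by (subst sum_incidence) auto
qed

text \<open>Row 0 makes a kernel vector vanish at the root, and the other rows make it constant
  along their arcs.\<close>

lemma det_incidence_connected:
  assumes "\<And>r. r < n \<Longrightarrow> s r < n \<and> d r < n"
    "\<And>x :: nat \<Rightarrow> int. x 0 = 0 \<Longrightarrow> (\<And>r. 0 < r \<Longrightarrow> r < n \<Longrightarrow> x (s r) = x (d r)) \<Longrightarrow> (\<And>c. c < n \<Longrightarrow> x c = 0)"
  shows "det_fun n (\<lambda>r. incidence r (s r) (d r)) \<noteq> 0"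
proof
  assume "det_fun n (\<lambda>r. incidence r (s r) (d r)) = 0"
  then obtain x c where x: "c < n" "x c \<noteq> 0"
    "\<And>i. i < n \<Longrightarrow> (\<Sum>c = 0..<n. incidence i (s i) (d i) c * x c) = 0"
    unfolding det_fun_eq_0_iff by blast
  have *: "(if i = 0 then x 0 else x (s i) - x (d i)) = 0" if "i < n" for i
    using x(3)[OF that] assms(1)[OF that] that by (simp add: sum_incidence)
  have "x 0 = 0" using *[of 0] x(1) by simp
  moreover have "x (s r) = x (d r)" if "0 < r" "r < n" for r using *[OF that(2)] that(1) by simp
  ultimately show False using assms(2)[of x c] x(1,2) by blast
qed

section \<open>Hamiltonian cycles\<close>

text \<open>A permutation with a single cycle: no proper nonempty set is closed under it. For
  \<open>n = 0\<close> this holds vacuously, which is why \<open>0 < n\<close> is added in the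
  comparison with \<open>hamiltonian\<close>.\<close>

definition cyclic_successor :: "nat \<Rightarrow> (nat \<Rightarrow> nat \<Rightarrow> bool) \<Rightarrow> (nat \<Rightarrow> nat) \<Rightarrow> bool" where
  "cyclic_successor n E \<pi> \<longleftrightarrow> \<pi> permutes {..<n} \<and> (\<forall>v<n. E v (\<pi> v)) \<and>
     (\<forall>U\<subseteq>{..<n}. U \<noteq> {} \<longrightarrow> \<pi> ` U \<subseteq> U \<longrightarrow> U = {..<n})"

lemma (in pre_digraph) cas_nthD:
  assumes "cas u p v" "Suc i < length p"
  shows "head G (p ! i) = tail G (p ! Suc i)"
  using assms
proof (induction p arbitrary: u i)
  case (Cons e es)
  show ?case
  proof (cases i)
    case 0
    then show ?thesis using Cons.prems by (cases es) auto
  next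
    case (Suc i')
    then show ?thesis using Cons by auto
  qed
qed simp

lemma (in pre_digraph) cas_mapI:
  assumes "\<And>i. i < m \<Longrightarrow> tail G (g i) = vs i \<and> head G (g i) = vs (Suc i)"
  shows "cas (vs 0) (map g [0..<m]) (vs m)"
  using assms
proof (induction m)
  case (Suc m)
  have "cas (vs 0) (map g [0..<m]) (vs m)" using Suc by auto
  moreover have "awlast (vs 0) (map g [0..<m]) = vs m"
    using Suc.prems by (cases m) (auto simp: awalk_verts_conv)
  ultimately show ?case using Suc.prems by simp
qed simp

text \<open>From a cycle, \<open>\<pi>\<close> sends the tail of each arc to its head. Conversely,
  iterating \<open>\<pi>\<close> from vertex 0 until the first return visits a closed set, hence
  everything.\<close>

lemma hamiltonian_iff_cyclic_successor:
  assumes "digraph G" "verts G = {..<n}"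
  shows "hamiltonian G \<longleftrightarrow> 0 < n \<and> (\<exists>\<pi>. cyclic_successor n (\<lambda>u v. u \<rightarrow>\<^bsub>G\<^esub> v) \<pi>)"
proof -
  interpret digraph G by fact
  show ?thesis
  proof
    assume "hamiltonian G"
    then obtain p u where p: "awalk u p u" "distinct (tl (awalk_verts u p))" "p \<noteq> []" "tail G ` set p = {..<n}"
      by (auto simp: hamiltonian_def hamiltonian_cycle_def cycle_def assms(2))
    have cas: "cas u p u" and arcs: "set p \<subseteq> arcs G" using p(1) by auto
    define m where "m = length p"
    have m: "0 < m" using p(3) by (simp add: m_def)
    have hd: "tail G (hd p) = u" using cas p(3) by (cases p) auto
    have av: "awalk_verts u p = map (tail G) p @ [u]"
    proof -
      have "last (awalk_verts u p) = u" using p(1) by auto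
      then show ?thesis using p(3) by (simp add: awalk_verts_conv)
    qed
    have dist: "distinct (map (tail G) p)"
    proof -
      obtain e es where e: "p = e # es" using p(3) by (cases p) auto
      with p(2) av hd show ?thesis by auto
    qed
    have next': "head G (p ! i) = tail G (p ! (Suc i mod m))" if "i < m" for i
    proof (cases "Suc i < m")
      case True
      then show ?thesis using cas_nthD[OF cas] by (simp add: m_def)
    next
      case False
      with that have i: "Suc i = m" by simp
      then have "p ! i = last p" using p(3) by (metis diff_Suc_1 last_conv_nth m_def)
      moreover have "head G (last p) = u"
        using p(1,3) by (metis awalk_verts_conv awends_of_awalk(2) awlast_of_awalk last_snoc NOMATCH_def)
      ultimately show ?thesis using i hd p(3) by (simp add: hd_conv_nth)
    qed
    define \<pi> where "\<pi> v = (if v < n then head G (p ! (THE i. i < m \<and> tail G (p ! i) = v)) else v)" for v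
    have inj: "i = j" if "i < m" "j < m" "tail G (p ! i) = tail G (p ! j)" for i j
      using nth_eq_iff_index_eq[OF dist, of i j] that by (simp add: m_def)
    have lt: "tail G (p ! i) < n" if "i < m" for i using p(4) that by (auto simp: m_def)
    have \<pi>: "\<pi> (tail G (p ! i)) = tail G (p ! (Suc i mod m))" if "i < m" for i
    proof -
      have "(THE j. j < m \<and> tail G (p ! j) = tail G (p ! i)) = i" using that inj by (intro the_equality) auto
      then show ?thesis using lt[OF that] next'[OF that] by (simp add: \<pi>_def)
    qed
    have ex: "\<exists>i<m. tail G (p ! i) = v" if "v < n" for v
    proof -
      have "v \<in> tail G ` set p" using that p(4) by auto
      then show ?thesis by (auto simp: in_set_conv_nth m_def)
    qed
    have surj: "\<pi> ` {..<n} = {..<n}"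
    proof (intro equalityI subsetI)
      fix v assume "v \<in> \<pi> ` {..<n}"
      then obtain w where "w < n" "v = \<pi> w" by auto
      with ex obtain i where "i < m" "tail G (p ! i) = w" by blast
      with \<pi>[of i] \<open>v = \<pi> w\<close> lt[of "Suc i mod m"] m show "v \<in> {..<n}" by auto
    next
      fix v assume "v \<in> {..<n}"
      then obtain i where i: "i < m" "tail G (p ! i) = v" using ex by auto
      define j where "j = (if i = 0 then m - 1 else i - 1)"
      have j: "j < m" "Suc j mod m = i" using i m by (auto simp: j_def)
      with \<pi>[OF j(1)] i lt[OF j(1)] show "v \<in> \<pi> ` {..<n}" by (auto intro!: image_eqI[of _ _ "tail G (p ! j)"])
    qed
    have perm: "\<pi> permutes {..<n}"
    proof (rule bij_imp_permutes)
      show "bij_betw \<pi> {..<n} {..<n}"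
        using surj by (simp add: bij_betw_def eq_card_imp_inj_on)
    qed (simp add: \<pi>_def)
    have E: "v \<rightarrow>\<^bsub>G\<^esub> \<pi> v" if v: "v < n" for v
    proof -
      obtain i where i: "i < m" "tail G (p ! i) = v" using ex v by auto
      have "p ! i \<in> arcs G" using arcs i(1) by (auto simp: m_def)
      from in_arcs_imp_in_arcs_ends[OF this] show ?thesis using \<pi>[OF i(1)] next'[OF i(1)] i(2) by simp
    qed
    have conn: "U = {..<n}" if U: "U \<subseteq> {..<n}" "U \<noteq> {}" "\<pi> ` U \<subseteq> U" for U
    proof -
      obtain i where i: "i < m" "tail G (p ! i) \<in> U" using U(1,2) ex by (metis ex_in_conv lessThan_iff subsetD)
      have *: "tail G (p ! ((i + j) mod m)) \<in> U" for j
      proof (induction j)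
        case 0
        then show ?case using i by simp
      next
        case (Suc j)
        then have "\<pi> (tail G (p ! ((i + j) mod m))) \<in> U" using U(3) by auto
        then show ?case using \<pi>[of "(i + j) mod m"] m by (simp add: mod_Suc_eq)
      qed
      have "v \<in> U" if v: "v < n" for v
      proof -
        obtain l where l: "l < m" "tail G (p ! l) = v" using ex v by auto
        \<comment> \<open>To reach position \<open>l\<close> from \<open>i\<close>, go on to the end
          of the cycle, wrap around, and take \<open>l\<close> more steps; this never counts
          backwards.\<close>
        have "(i + (m - i + l)) mod m = l" using i(1) l(1) by simp
        then show ?thesis using *[of "m - i + l"] l(2) by simp
      qed
      then show ?thesis using U(1) by auto
    qed
    have "0 < n" using lt[OF m] by simp
    with perm E conn show "0 < n \<and> (\<exists>\<pi>. cyclic_successor n (\<lambda>u v. u \<rightarrow>\<^bsub>G\<^esub> v) \<pi>)"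
      unfolding cyclic_successor_def by blast
  next
    assume "0 < n \<and> (\<exists>\<pi>. cyclic_successor n (\<lambda>u v. u \<rightarrow>\<^bsub>G\<^esub> v) \<pi>)"
    then obtain \<pi> where n: "0 < n" and \<pi>: "\<pi> permutes {..<n}" "\<And>v. v < n \<Longrightarrow> v \<rightarrow>\<^bsub>G\<^esub> \<pi> v"
      "\<And>U. U \<subseteq> {..<n} \<Longrightarrow> U \<noteq> {} \<Longrightarrow> \<pi> ` U \<subseteq> U \<Longrightarrow> U = {..<n}"
      unfolding cyclic_successor_def by blast
    define vs where "vs i = (\<pi> ^^ i) 0" for i
    have vs_Suc: "vs (Suc i) = \<pi> (vs i)" for i by (simp add: vs_def)
    have vs_lt: "vs i < n" for i
    proof (induction i)
      case (Suc i)
      then show ?case using permutes_in_image[OF \<pi>(1), of "vs i"] by (simp add: vs_Suc)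
    qed (use n in \<open>simp add: vs_def\<close>)
    have inj\<pi>: "inj \<pi>" by (rule permutes_inj[OF \<pi>(1)])
    \<comment> \<open>Injectivity cancels the first \<open>i\<close> applications, so any repetition
      yields a return to the start.\<close>
    have shift: "vs j = vs 0" if "vs (i + j) = vs i" for i j
      using that by (induction i) (use inj\<pi> in \<open>auto simp: vs_Suc inj_eq\<close>)
    have "\<not> inj vs"
    proof
      assume "inj vs"
      moreover have "finite (range vs)" using vs_lt by (auto intro!: finite_subset[of "range vs" "{..<n}"])
      ultimately show False using finite_imageD infinite_UNIV_nat by blast
    qed
    then obtain i j where "i < j" "vs i = vs j" by (metis linorder_injI)
    then have ex: "\<exists>m. 0 < m \<and> vs m = vs 0" using shift[of i "j - i"] by (intro exI[of _ "j - i"]) auto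
    define m where "m = (LEAST m. 0 < m \<and> vs m = vs 0)"
    have m: "0 < m" "vs m = vs 0" using LeastI_ex[OF ex] by (auto simp: m_def)
    have minimal: "\<not> (0 < l \<and> vs l = vs 0)" if "l < m" for l using not_less_Least that unfolding m_def by blast
    have inj: "inj_on vs {0..<m}"
    proof (rule linorder_inj_onI)
      fix i j assume ij: "i < j" "i \<in> {0..<m}" "j \<in> {0..<m}"
      show "vs i \<noteq> vs j"
      proof
        assume "vs i = vs j"
        then have "vs (j - i) = vs 0" using shift[of i "j - i"] ij by simp
        moreover have "j - i < m" "0 < j - i" using ij by auto
        ultimately show False using minimal by blast
      qed
    qed auto
    have range: "vs ` {0..<m} = {..<n}"
    proof (rule \<pi>(3))
      show "\<pi> ` vs ` {0..<m} \<subseteq> vs ` {0..<m}"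
      proof clarify
        fix i assume "i \<in> {0..<m}"
        then consider "Suc i < m" | "Suc i = m" by fastforce
        then have "vs (Suc i) \<in> vs ` {0..<m}"
        proof cases
          case 2
          then show ?thesis using m by (intro image_eqI[of _ _ 0]) auto
        qed auto
        then show "\<pi> (vs i) \<in> vs ` {0..<m}" by (simp only: vs_Suc)
      qed
    qed (use vs_lt m in auto)
    have "\<exists>e. e \<in> arcs G \<and> tail G e = vs i \<and> head G e = vs (Suc i)" for i
      using \<pi>(2)[OF vs_lt[of i]] by (auto simp: vs_Suc elim: reachableE)
    then obtain ar where ar: "\<And>i. ar i \<in> arcs G \<and> tail G (ar i) = vs i \<and> head G (ar i) = vs (Suc i)" by metis
    define p where "p = map ar [0..<m]"
    have p: "p \<noteq> []" using m by (simp add: p_def)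
    have cas: "cas (vs 0) p (vs 0)" using cas_mapI[of m ar vs] ar m by (simp add: p_def)
    have aw: "awalk (vs 0) p (vs 0)"
      unfolding awalk_def using cas ar vs_lt assms(2) by (auto simp: p_def)
    have "awalk_verts (vs 0) p = map vs [0..<m] @ [vs 0]"
    proof -
      have "last (awalk_verts (vs 0) p) = vs 0" using aw by auto
      then show ?thesis using p ar by (simp add: awalk_verts_conv p_def)
    qed
    then have "mset (tl (awalk_verts (vs 0) p)) = mset (map vs [0..<m])"
      using m(1) by (simp add: upt_conv_Cons)
    moreover have "distinct (map vs [0..<m])" using inj by (simp add: distinct_map)
    ultimately have "distinct (tl (awalk_verts (vs 0) p))" by (metis mset_eq_imp_distinct_iff)
    moreover have "tail G ` set p = {..<n}" using ar range by (simp add: p_def image_image)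
    ultimately have "hamiltonian_cycle G p" unfolding hamiltonian_cycle_def cycle_def
      using aw p assms(2) by auto
    then show "hamiltonian G" unfolding hamiltonian_def by blast
  qed
qed

subsection \<open>The sieve\<close>

lemma prod_of_bool: "finite A \<Longrightarrow> (\<Prod>p\<in>A. of_bool (P p) :: int) = of_bool (\<forall>p\<in>A. P p)"
  by (induction A rule: finite_induct) auto

text \<open>The inclusion-exclusion sign: each position that is restricted, in either way,
  contributes -1.\<close>

definition sieve_sign :: "nat \<Rightarrow> nat \<Rightarrow> int" where
  "sieve_sign k x = (\<Prod>p<k. if digit 3 x p = 2 then 1 else - 1)"

text \<open>
  In the state \<open>x\<close>, a position with digit 0 must not be a tail, one with digit 1 must not be a
  head, and digit 2 allows both. Summed with signs, a position that is a head but not a tail (or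
  conversely) cancels; one that is isolated does not, but is excluded by connectivity. This is why
  3 instead of 4 states per position suffice.
\<close>

lemma sieve_sum:
  assumes "\<And>r. r < k \<Longrightarrow> s r < k \<and> d r < k"
  shows "(\<Sum>x<3 ^ k. sieve_sign k x * of_bool (\<forall>r<k. digit 3 x (s r) \<noteq> 0 \<and> digit 3 x (d r) \<noteq> 1)) \<noteq> 0 \<longleftrightarrow>
    s ` {..<k} = d ` {..<k}"
proof -
  define h :: "nat \<Rightarrow> nat \<Rightarrow> int" where
    "h p e = (if e = 2 then 1 else - 1) * of_bool ((p \<in> s ` {..<k} \<longrightarrow> e \<noteq> 0) \<and> (p \<in> d ` {..<k} \<longrightarrow> e \<noteq> 1))" for p e
  have of_bool_prod: "(\<Prod>p<k. of_bool (P p) :: int) = of_bool (\<forall>p<k. P p)" for P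
    by (simp add: prod_of_bool Ball_def)
  have "sieve_sign k x * of_bool (\<forall>r<k. digit 3 x (s r) \<noteq> 0 \<and> digit 3 x (d r) \<noteq> 1) = (\<Prod>p<k. h p (digit 3 x p))" for x
  proof -
    have "(\<forall>r<k. digit 3 x (s r) \<noteq> 0 \<and> digit 3 x (d r) \<noteq> 1) \<longleftrightarrow>
      (\<forall>p<k. (p \<in> s ` {..<k} \<longrightarrow> digit 3 x p \<noteq> 0) \<and> (p \<in> d ` {..<k} \<longrightarrow> digit 3 x p \<noteq> 1))"
      using assms by auto
    then show ?thesis by (simp add: h_def prod.distrib of_bool_prod sieve_sign_def)
  qed
  then have "(\<Sum>x<3 ^ k. sieve_sign k x * of_bool (\<forall>r<k. digit 3 x (s r) \<noteq> 0 \<and> digit 3 x (d r) \<noteq> 1)) =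
     (\<Prod>p<k. \<Sum>e<3. h p e)"
    by (simp add: sum_prod_digit)
  \<comment> \<open>If \<open>p\<close> is both tail and head, only digit 2 survives. If it is
    exactly one of them, digit 2 and one restricting digit survive and cancel. If it is neither, all
    three survive with sum -1.\<close>
  moreover have "(\<Sum>e<3. h p e) = (if p \<in> s ` {..<k} \<longleftrightarrow> p \<in> d ` {..<k} then (if p \<in> s ` {..<k} then 1 else - 1) else 0)" for p
    by (simp add: h_def eval_nat_numeral)
  ultimately have "(\<Sum>x<3 ^ k. sieve_sign k x * of_bool (\<forall>r<k. digit 3 x (s r) \<noteq> 0 \<and> digit 3 x (d r) \<noteq> 1)) \<noteq> 0 \<longleftrightarrow>
     (\<forall>p<k. p \<in> s ` {..<k} \<longleftrightarrow> p \<in> d ` {..<k})"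
    by (auto simp: prod_zero_iff)
  also have "\<dots> \<longleftrightarrow> s ` {..<k} = d ` {..<k}" using assms by blast
  finally show ?thesis .
qed

section \<open>Assignments of steps to rows versus cyclic successors\<close>

lemma card_vimage_eq:
  assumes "bij_betw f {..<k::nat} {..<k}" "Z \<subseteq> {..<k}"
  shows "card {r. r < k \<and> f r \<in> Z} = card Z"
proof -
  have "bij_betw f {r. r < k \<and> f r \<in> Z} Z"
    using assms unfolding bij_betw_def inj_on_def by (auto simp: image_def set_eq_iff) (metis lessThan_iff subsetD)
  then show ?thesis by (rule bij_betw_same_card)
qed

text \<open>Serves row 0, whose step is invisible to the determinant: if two sets of rows have equal
  size and agree on the other rows, they agree on row 0.\<close>

lemma mem_iff_if_card_eq:
  assumes "finite A" "finite B" "card A = card B" "A - {z} = B - {z}"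
  shows "z \<in> A \<longleftrightarrow> z \<in> B"
proof -
  have "card X = card (X - {z}) + (if z \<in> X then 1 else 0)" if "finite X" for X
    using card.remove[OF that, of z] by (cases "z \<in> X") simp_all
  from this[OF assms(1), unfolded assms(4)] this[OF assms(2)] assms(3)
  have "(if z \<in> A then 1 else 0 :: nat) = (if z \<in> B then 1 else 0)" by linarith
  then show ?thesis by (simp split: if_splits)
qed

text \<open>A Hamiltonian cycle maps the independent vertices injectively into the cover, so
  \<open>a \<le> k\<close> is a necessary condition, which the program tests before it starts the
  sieve.\<close>

locale independent_split =
  fixes n k a :: nat and E :: "nat \<Rightarrow> nat \<Rightarrow> bool" and cv iv :: "nat \<Rightarrow> nat"
  assumes cv: "inj_on cv {..<k}" and iv: "inj_on iv {..<a}"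
    and disj: "cv ` {..<k} \<inter> iv ` {..<a} = {}" and cover: "cv ` {..<k} \<union> iv ` {..<a} = {..<n}"
    and indep: "\<And>r r'. r < a \<Longrightarrow> r' < a \<Longrightarrow> \<not> E (iv r) (iv r')"
    and a_le_k: "a \<le> k" and k_pos: "0 < k"
begin

text \<open>
  The rows below \<open>a\<close> are the steps through the independent vertices, the others are arcs within
  the cover, whose vertices are called positions.
\<close>

definition allowed :: "nat \<Rightarrow> nat \<Rightarrow> nat \<Rightarrow> bool" where
  "allowed r u v = (if r < a then E (cv u) (iv r) \<and> E (iv r) (cv v) else E (cv u) (cv v))"

text \<open>An arc assignment maps every row to a pair of positions, encoded below \<open>k * k\<close>.\<close>

definition coefficient :: "(nat \<Rightarrow> nat) \<Rightarrow> int" where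
  "coefficient f = of_bool (\<forall>r<k. allowed r (f r div k) (f r mod k)) *
     det_fun k (\<lambda>r. incidence r (f r div k) (f r mod k)) *
     (\<Sum>x<3 ^ k. sieve_sign k x * of_bool (\<forall>r<k. digit 3 x (f r div k) \<noteq> 0 \<and> digit 3 x (f r mod k) \<noteq> 1))"

lemma cv_lt: "p < k \<Longrightarrow> cv p < n" and iv_lt: "r < a \<Longrightarrow> iv r < n"
  using cover by auto

lemma cv_neq_iv: "p < k \<Longrightarrow> r < a \<Longrightarrow> cv p \<noteq> iv r"
  using disj by auto

lemma vertex_cases:
  assumes "v < n"
  obtains p where "p < k" "v = cv p" | r where "r < a" "v = iv r"
  using assms cover by blast

text \<open>Each factor contributes one property: the steps exist, they connect the positions, and
  tails and heads are the same positions. Connectivity then leaves no position untouched, so tails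
  and heads are bijections and the steps form one cycle.\<close>

lemma cyclic_successor_if_coefficient:
  assumes f: "f \<in> {0..<k} \<rightarrow>\<^sub>E {..<k * k}" and nz: "coefficient f \<noteq> 0"
  shows "\<exists>\<pi>. cyclic_successor n E \<pi>"
proof -
  define s d where "s r = f r div k" and "d r = f r mod k" for r
  have sd: "s r < k \<and> d r < k" if "r < k" for r
  proof -
    have "f r < k * k" using f that by (auto simp: PiE_def Pi_def)
    then show ?thesis using k_pos by (auto simp: s_def d_def less_mult_imp_div_less)
  qed
  have al: "allowed r (s r) (d r)" if "r < k" for r
    using nz that by (auto simp: coefficient_def s_def d_def split: if_splits)
  have det: "det_fun k (\<lambda>r. incidence r (s r) (d r)) \<noteq> 0"
    using nz by (auto simp: coefficient_def s_def d_def)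
  have img: "s ` {..<k} = d ` {..<k}"
    using nz sieve_sum[of k s d, OF sd] by (auto simp: coefficient_def s_def d_def)
  have surj: "s ` {..<k} = {..<k}"
  proof (rule ccontr)
    assume "s ` {..<k} \<noteq> {..<k}"
    with sd obtain p where p: "p < k" "p \<notin> s ` {..<k}" by auto
    then have pd: "p \<notin> d ` {..<k}" using img by simp
    \<comment> \<open>An isolated position \<open>p\<close> separates \<open>{p}\<close> from the
      rest. The side without the root 0 witnesses disconnection; for \<open>p = 0\<close> it is the
      rest, which is nonempty as \<open>s 0\<close> belongs to it.\<close>
    have "det_fun k (\<lambda>r. incidence r (s r) (d r)) = 0"
    proof (cases "p = 0")
      case False
      show ?thesis using p pd False sd by (intro det_incidence_disconnected[of k s d "{p}"]) auto
    next
      case True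
      have "s 0 \<noteq> 0" using p True k_pos by auto
      then have "1 < k" using sd[OF k_pos] by simp
      have pos: "0 < s r \<and> 0 < d r" if "r < k" for r using p(2) pd that True by (metis gr0I image_eqI lessThan_iff)
      show ?thesis using \<open>1 < k\<close> pos sd by (intro det_incidence_disconnected[of k s d "{0<..<k}"]) auto
    qed
    with det show False by simp
  qed
  have dsurj: "d ` {..<k} = {..<k}" using surj img by simp
  have bij: "bij_betw s {..<k} {..<k}" "bij_betw d {..<k} {..<k}"
    using surj dsurj by (auto simp: bij_betw_def eq_card_imp_inj_on)
  have sinj: "r = r'" if "s r = s r'" "r < k" "r' < k" for r r'
    using bij(1) that by (auto simp: bij_betw_def inj_on_def)
  \<comment> \<open>Tails and heads hit \<open>U\<close> equally often, so a set closed under steps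
    is closed backwards as well. Either \<open>U\<close> or its complement avoids the root.\<close>
  have full: "U = {..<k}" if U: "U \<subseteq> {..<k}" "U \<noteq> {}" and cl: "\<And>r. r < k \<Longrightarrow> s r \<in> U \<Longrightarrow> d r \<in> U" for U
  proof (rule ccontr)
    assume ne: "U \<noteq> {..<k}"
    have "{r. r < k \<and> s r \<in> U} = {r. r < k \<and> d r \<in> U}"
      using cl card_vimage_eq[OF bij(1) U(1)] card_vimage_eq[OF bij(2) U(1)] by (intro card_subset_eq) auto
    then have iff: "s r \<in> U \<longleftrightarrow> d r \<in> U" if "r < k" for r using that by blast
    show False
    proof (cases "0 \<in> U")
      case False
      with det det_incidence_disconnected[of k s d U] sd U iff show False by blast
    next
      case True
      have "det_fun k (\<lambda>r. incidence r (s r) (d r)) = 0"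
        using True U ne iff sd by (intro det_incidence_disconnected[of k s d "{..<k} - U"]) auto
      with det show False by simp
    qed
  qed
  \<comment> \<open>The cycle on the cover is expanded to the graph: row \<open>r < a\<close>
    detours through \<open>iv r\<close>, the other rows are followed directly.\<close>
  define \<pi> where "\<pi> v = (if \<exists>r<k. v = cv (s r) then
       (let r = (THE r. r < k \<and> v = cv (s r)) in if r < a then iv r else cv (d r))
     else if \<exists>r<a. v = iv r then cv (d (THE r. r < a \<and> v = iv r)) else v)" for v
  have cvD: "r = r'" if "cv (s r) = cv (s r')" "r < k" "r' < k" for r r'
    using cv that sd sinj unfolding inj_on_def by (metis lessThan_iff)
  have \<pi>c: "\<pi> (cv (s r)) = (if r < a then iv r else cv (d r))" if "r < k" for r
  proof -
    have "(THE r'. r' < k \<and> cv (s r) = cv (s r')) = r" using that cvD by (intro the_equality) auto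
    with that show ?thesis unfolding \<pi>_def Let_def by auto
  qed
  have \<pi>i: "\<pi> (iv r) = cv (d r)" if "r < a" for r
  proof -
    have "(THE r'. r' < a \<and> iv r = iv r') = r" using that iv by (intro the_equality) (auto dest: inj_onD)
    moreover have "\<not> (\<exists>r'<k. iv r = cv (s r'))" using cv_neq_iv[OF _ that] sd by metis
    ultimately show ?thesis using that unfolding \<pi>_def Let_def by auto
  qed
  have sur: "\<exists>w<n. \<pi> w = v" if "v < n" for v
    using that
  proof (cases rule: vertex_cases)
    case (1 q)
    then obtain r where r: "r < k" "q = d r" using dsurj by (metis imageE lessThan_iff)
    show ?thesis
    proof (cases "r < a")
      case True
      then show ?thesis using \<pi>i[OF True] r 1 iv_lt by auto
    next
      case False
      then have "\<pi> (cv (s r)) = v" using \<pi>c[OF r(1)] r(2) 1(2) by simp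
      then show ?thesis using cv_lt sd[OF r(1)] by blast
    qed
  next
    case (2 r)
    then have "r < k" using a_le_k by simp
    then have "\<pi> (cv (s r)) = v" using \<pi>c[of r] 2 by simp
    then show ?thesis using cv_lt sd[OF \<open>r < k\<close>] by blast
  qed
  have cv_s: "\<exists>r<k. p = s r" if "p < k" for p using surj that by (metis imageE lessThan_iff)
  have \<pi>lt: "\<pi> v < n \<and> E v (\<pi> v)" if "v < n" for v
    using that
  proof (cases rule: vertex_cases)
    case (1 p)
    with cv_s obtain r where "r < k" "p = s r" by blast
    with 1 show ?thesis using \<pi>c[of r] al[of r] iv_lt cv_lt sd[of r] by (auto simp: allowed_def)
  next
    case (2 r)
    then show ?thesis using \<pi>i[of r] al[of r] cv_lt sd[of r] a_le_k by (auto simp: allowed_def)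
  qed
  have "\<pi> ` {..<n} = {..<n}" using sur \<pi>lt by (auto simp: image_def)
  then have "\<pi> permutes {..<n}"
  proof (intro bij_imp_permutes)
    assume "\<pi> ` {..<n} = {..<n}"
    then show "bij_betw \<pi> {..<n} {..<n}" by (simp add: bij_betw_def eq_card_imp_inj_on)
    fix v assume "v \<notin> {..<n}"
    then show "\<pi> v = v" using cv_lt iv_lt sd unfolding \<pi>_def by auto
  qed
  moreover have "U = {..<n}" if U: "U \<subseteq> {..<n}" "U \<noteq> {}" "\<pi> ` U \<subseteq> U" for U
  proof -
    have "{p. p < k \<and> cv p \<in> U} = {..<k}"
    proof (rule full)
      show "{p. p < k \<and> cv p \<in> U} \<noteq> {}"
      proof -
        obtain v where v: "v \<in> U" using U(2) by blast
        then have "v < n" using U(1) by auto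
        then show ?thesis
        proof (cases rule: vertex_cases)
          case (2 r)
          then have "cv (d r) \<in> U" using v U(3) \<pi>i[of r] by (metis image_subset_iff)
          then show ?thesis using sd[of r] 2 a_le_k by auto
        qed (use v in auto)
      qed
      fix r assume r: "r < k" "s r \<in> {p. p < k \<and> cv p \<in> U}"
      then have 1: "\<pi> (cv (s r)) \<in> U" using U(3) by auto
      show "d r \<in> {p. p < k \<and> cv p \<in> U}"
      proof (cases "r < a")
        case True
        then have "iv r \<in> U" using 1 \<pi>c[OF r(1)] by simp
        then have "\<pi> (iv r) \<in> U" using U(3) by auto
        then show ?thesis using \<pi>i[OF True] sd[OF r(1)] by simp
      next
        case False
        then show ?thesis using 1 \<pi>c[OF r(1)] sd[OF r(1)] by simp
      qed
    qed auto
    then have C: "cv p \<in> U" if "p < k" for p using that by blast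
    have "v \<in> U" if "v < n" for v
      using that
    proof (cases rule: vertex_cases)
      case (2 r)
      then have "\<pi> (cv (s r)) \<in> U" using C sd[of r] U(3) a_le_k by auto
      then show ?thesis using 2 \<pi>c[of r] a_le_k by simp
    qed (use C in auto)
    then show ?thesis using U(1) by auto
  qed
  ultimately show ?thesis unfolding cyclic_successor_def using \<pi>lt by blast
qed

text \<open>Row \<open>r < a\<close> takes the two arcs of the cycle at \<open>iv r\<close> as one
  step; the other rows share out the arcs within the cover. Suppressing the independent vertices
  leaves a single cycle on the positions.\<close>

lemma coefficient_if_cyclic_successor:
  assumes "cyclic_successor n E \<pi>"
  shows "\<exists>f \<in> {0..<k} \<rightarrow>\<^sub>E {..<k * k}. coefficient f \<noteq> 0"
proof -
  have \<pi>: "\<pi> permutes {..<n}" "\<And>v. v < n \<Longrightarrow> E v (\<pi> v)"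
      "\<And>U. U \<subseteq> {..<n} \<Longrightarrow> U \<noteq> {} \<Longrightarrow> \<pi> ` U \<subseteq> U \<Longrightarrow> U = {..<n}"
    using assms unfolding cyclic_successor_def by blast+
  have lt: "\<pi> v < n \<longleftrightarrow> v < n" for v using permutes_in_image[OF \<pi>(1), of v] by simp
  have inj: "u = v" if "\<pi> u = \<pi> v" for u v using permutes_inj[OF \<pi>(1)] that by (simp add: inj_eq)
  define \<rho> where "\<rho> = inv_into UNIV \<pi>"
  have \<rho>: "\<pi> (\<rho> v) = v" "\<rho> (\<pi> v) = v" for v
    using permutes_inverses[OF \<pi>(1)] by (auto simp: \<rho>_def)
  have \<rho>lt: "\<rho> v < n \<longleftrightarrow> v < n" for v using lt[of "\<rho> v"] \<rho> by simp
  define C where "C = cv ` {..<k}"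
  define I where "I = iv ` {..<a}"
  have CI: "C \<inter> I = {}" "C \<union> I = {..<n}" "finite C" "finite I" "card C = k" "card I = a"
    using disj cover card_image[OF cv] card_image[OF iv] by (auto simp: C_def I_def)
  have noII: "\<not> E u v" if "u \<in> I" "v \<in> I" for u v using that indep by (auto simp: I_def)
  have IC: "\<pi> v \<in> C" "\<rho> v \<in> C" if "v \<in> I" for v
  proof -
    have v: "v < n" using that CI(2) by auto
    show "\<pi> v \<in> C" using noII[OF that, of "\<pi> v"] \<pi>(2)[OF v] lt[of v] v CI(2) by auto
    show "\<rho> v \<in> C" using noII[of "\<rho> v" v] that \<pi>(2)[of "\<rho> v"] \<rho> \<rho>lt[of v] v CI(2) by auto
  qed
  define CC where "CC = {c \<in> C. \<pi> c \<in> C}"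
  \<comment> \<open>The cover vertices left out are the predecessors of the \<open>a\<close>
    independent vertices, which lie in the cover. So the direct arcs are exactly as many as the
    remaining rows.\<close>
  have card_CC: "card CC = k - a"
  proof -
    have "C - CC = \<rho> ` I"
    proof (intro equalityI subsetI)
      fix c assume "c \<in> C - CC"
      then have "c < n" "\<pi> c \<notin> C" using CI(2) by (auto simp: CC_def)
      then have "\<pi> c \<in> I" using lt[of c] CI(2) by auto
      then show "c \<in> \<rho> ` I" using \<rho>(2)[of c] by (metis imageI)
    next
      fix c assume "c \<in> \<rho> ` I"
      then show "c \<in> C - CC" using IC(2) \<rho>(1) CI(1) by (auto simp: CC_def)
    qed
    moreover have "card (\<rho> ` I) = a"
      using CI(6) \<rho>(1) by (subst card_image) (auto intro: inj_on_inverseI)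
    moreover have "CC = C - (C - CC)" by (auto simp: CC_def)
    ultimately show ?thesis using CI(3,5)
      by (metis CI(4) card_Diff_subset finite_imageI Diff_subset)
  qed
  have "card CC = card {a..<k}" using card_CC by simp
  then obtain g where g: "bij_betw g {a..<k} CC"
    using CI(3) by (metis CC_def finite_atLeastLessThan finite_same_card_bij mem_Collect_eq finite_subset subsetI)
  define pos where "pos = inv_into {..<k} cv"
  have pos: "pos c < k" "cv (pos c) = c" if "c \<in> C" for c
    using that inv_into_into[of c cv "{..<k}"] f_inv_into_f[of c cv "{..<k}"] by (auto simp: pos_def C_def)
  have pos_cv: "pos (cv p) = p" if "p < k" for p using cv that by (simp add: pos_def)
  define S where "S r = (if r < a then \<rho> (iv r) else g r)" for r
  define T where "T r = (if r < a then \<pi> (iv r) else \<pi> (g r))" for r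
  have gC: "g r \<in> C \<and> \<pi> (g r) \<in> C" if "a \<le> r" "r < k" for r
    using g that by (auto simp: bij_betw_def CC_def)
  have ST: "S r \<in> C" "T r \<in> C" if "r < k" for r
    using that gC[of r] IC[of "iv r"] by (auto simp: S_def T_def I_def)
  define s d where "s r = pos (S r)" and "d r = pos (T r)" for r
  have sd: "s r < k \<and> d r < k" if "r < k" for r using ST[OF that] pos by (auto simp: s_def d_def)
  define f where "f = (\<lambda>r\<in>{0..<k}. s r * k + d r)"
  have fdm: "f r div k = s r" "f r mod k = d r" if "r < k" for r
    using sd[OF that] that k_pos by (auto simp: f_def)
  have fE: "f \<in> {0..<k} \<rightarrow>\<^sub>E {..<k * k}"
  proof -
    have "s r * k + d r < k * k" if "r < k" for r
    proof -
      have "s r * k + d r < Suc (s r) * k" using sd[OF that] by simp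
      also have "\<dots> \<le> k * k" using sd[OF that] by (intro mult_right_mono) auto
      finally show ?thesis .
    qed
    then show ?thesis by (auto simp: f_def)
  qed
  have al: "\<forall>r<k. allowed r (s r) (d r)"
  proof (intro allI impI)
    fix r assume r: "r < k"
    show "allowed r (s r) (d r)"
    proof (cases "r < a")
      case True
      then show ?thesis using \<pi>(2)[of "\<rho> (iv r)"] \<pi>(2)[of "iv r"] \<rho>lt iv_lt \<rho>(1) ST[OF r] pos(2)
        by (auto simp: allowed_def s_def d_def S_def T_def)
    next
      case False
      then have "g r < n" using gC[of r] r CI(2) by auto
      then show ?thesis using \<pi>(2)[of "g r"] ST[OF r] pos(2) False
        by (auto simp: allowed_def s_def d_def S_def T_def)
    qed
  qed
  have s_surj: "s ` {..<k} = {..<k}"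
  proof (intro equalityI subsetI)
    fix p assume "p \<in> {..<k}"
    then have p: "p < k" "cv p \<in> C" by (auto simp: C_def)
    show "p \<in> s ` {..<k}"
    proof (cases "\<pi> (cv p) \<in> C")
      case True
      then have "cv p \<in> CC" using p by (simp add: CC_def)
      then obtain r where "r \<in> {a..<k}" "g r = cv p" using g by (metis bij_betw_def imageE)
      then show ?thesis using pos_cv p by (intro image_eqI[of _ _ r]) (auto simp: s_def S_def)
    next
      case False
      then have "\<pi> (cv p) \<in> I" using lt[of "cv p"] cv_lt[OF p(1)] CI(2) by auto
      then obtain r where "r < a" "\<pi> (cv p) = iv r" by (auto simp: I_def)
      then show ?thesis using pos_cv p \<rho>(2)[of "cv p"] a_le_k by (intro image_eqI[of _ _ r]) (auto simp: s_def S_def)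
    qed
  qed (use sd in auto)
  have d_surj: "d ` {..<k} = {..<k}"
  proof (intro equalityI subsetI)
    fix p assume "p \<in> {..<k}"
    then have p: "p < k" "cv p \<in> C" by (auto simp: C_def)
    have "\<rho> (cv p) < n" using \<rho>lt cv_lt[OF p(1)] by simp
    then consider "\<rho> (cv p) \<in> C" | "\<rho> (cv p) \<in> I" using CI(2) by auto
    then show "p \<in> d ` {..<k}"
    proof cases
      case 1
      then have "\<rho> (cv p) \<in> CC" using p \<rho>(1) by (simp add: CC_def)
      then obtain r where "r \<in> {a..<k}" "g r = \<rho> (cv p)" using g by (metis bij_betw_def imageE)
      then show ?thesis using pos_cv p \<rho>(1) by (intro image_eqI[of _ _ r]) (auto simp: d_def T_def)
    next
      case 2
      then obtain r where "r < a" "\<rho> (cv p) = iv r" by (auto simp: I_def)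
      then show ?thesis using pos_cv p \<rho>(1)[of "cv p"] a_le_k by (intro image_eqI[of _ _ r]) (auto simp: d_def T_def)
    qed
  qed (use sd in auto)
  have bij: "bij_betw s {..<k} {..<k}" "bij_betw d {..<k} {..<k}"
    using s_surj d_surj by (auto simp: bij_betw_def eq_card_imp_inj_on)
  have det: "det_fun k (\<lambda>r. incidence r (s r) (d r)) \<noteq> 0"
  proof (rule det_incidence_connected[OF sd])
    fix x :: "nat \<Rightarrow> int" and c0
    assume x: "x 0 = 0" "\<And>r. 0 < r \<Longrightarrow> r < k \<Longrightarrow> x (s r) = x (d r)" and c0: "c0 < k"
    define Z where "Z = {c. c < k \<and> x c \<noteq> 0}"
    have Z: "Z \<subseteq> {..<k}" "0 \<notin> Z" using x(1) by (auto simp: Z_def)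
    \<comment> \<open>The kernel condition leaves out row 0. As tails and heads are bijections, each
      meets \<open>Z\<close> in as many rows as \<open>Z\<close> has elements, which settles row 0
      too.\<close>
    have iff: "s r \<in> Z \<longleftrightarrow> d r \<in> Z" if r: "r < k" for r
    proof -
      let ?A = "{r. r < k \<and> s r \<in> Z}" and ?B = "{r. r < k \<and> d r \<in> Z}"
      have pos_iff: "s r \<in> Z \<longleftrightarrow> d r \<in> Z" if "0 < r" "r < k" for r
        using x(2)[OF that] sd[OF that(2)] by (auto simp: Z_def)
      have cards: "card ?A = card ?B"
        using card_vimage_eq[OF bij(1) Z(1)] card_vimage_eq[OF bij(2) Z(1)] by simp
      have "?A - {0} = ?B - {0}" using pos_iff by auto
      with cards have "0 \<in> ?A \<longleftrightarrow> 0 \<in> ?B" by (intro mem_iff_if_card_eq) auto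
      then show ?thesis using pos_iff[of r] r k_pos by (cases "r = 0") auto
    qed
    \<comment> \<open>The support \<open>Z\<close> is lifted to the graph, including the independent
      vertices passed on steps that start in \<open>Z\<close>. The lift is closed under
      \<open>\<pi>\<close>, so it is empty or everything; the root excludes the latter.\<close>
    define U where "U = cv ` Z \<union> {iv r |r. r < a \<and> s r \<in> Z}"
    have "U = {}"
    proof (rule ccontr)
      assume ne: "U \<noteq> {}"
      have "U = {..<n}"
      proof (rule \<pi>(3))
        show "U \<subseteq> {..<n}" using Z cv_lt iv_lt by (auto simp: U_def)
        show "\<pi> ` U \<subseteq> U"
        proof clarify
          fix v assume "v \<in> U"
          then consider p where "p \<in> Z" "v = cv p" | r where "r < a" "s r \<in> Z" "v = iv r" by (auto simp: U_def)
          then show "\<pi> v \<in> U"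
          proof cases
            case 1
            then have p: "p < k" using Z by auto
            then obtain r where r: "r < k" "p = s r" using s_surj by (metis imageE lessThan_iff)
            have v: "v = S r" using 1 r ST[OF r(1)] pos(2) by (simp add: s_def)
            show ?thesis
            proof (cases "r < a")
              case True
              then have "\<pi> v = iv r" using v \<rho>(1) by (simp add: S_def)
              then show ?thesis using True 1 r by (auto simp: U_def)
            next
              case False
              then have "\<pi> v = T r" using v by (simp add: S_def T_def)
              also have "\<dots> = cv (d r)" using ST[OF r(1)] pos(2) by (simp add: d_def)
              finally show ?thesis using iff[OF r(1)] 1 r by (auto simp: U_def)
            qed
          next
            case 2
            then have r: "r < k" using a_le_k by simp
            have "\<pi> v = cv (d r)" using 2 ST[OF r] pos(2) by (simp add: d_def T_def)
            then show ?thesis using iff[OF r] 2 by (auto simp: U_def)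
          qed
        qed
      qed fact
      then have "cv 0 \<in> U" using cv_lt k_pos by auto
      then consider p where "p \<in> Z" "cv 0 = cv p" | r where "r < a" "cv 0 = iv r" by (auto simp: U_def)
      then show False
      proof cases
        case 1
        then have "p = 0" using inj_onD[OF cv, of 0 p] Z k_pos by auto
        with 1 Z(2) show False by simp
      next
        case 2
        with cv_neq_iv[OF k_pos] show False by blast
      qed
    qed
    then show "x c0 = 0" using c0 by (auto simp: U_def Z_def)
  qed
  have "coefficient f = 1 * det_fun k (\<lambda>r. incidence r (s r) (d r)) *
      (\<Sum>x<3 ^ k. sieve_sign k x * of_bool (\<forall>r<k. digit 3 x (s r) \<noteq> 0 \<and> digit 3 x (d r) \<noteq> 1))"
  proof -
    have "det_fun k (\<lambda>r. incidence r (f r div k) (f r mod k)) = det_fun k (\<lambda>r. incidence r (s r) (d r))"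
      by (intro det_fun_cong) (simp add: fdm)
    then show ?thesis using al by (simp add: coefficient_def fdm cong: conj_cong)
  qed
  then have "coefficient f \<noteq> 0" using det sieve_sum[of k s d, OF sd] s_surj d_surj by simp
  with fE show ?thesis by blast
qed

end

section \<open>The sieve polynomial and its recovery from perturbed determinants\<close>

context independent_split
begin

text \<open>The weights of row \<open>r\<close> occupy the block of \<open>k * k\<close> indices
  from \<open>r * (k * k)\<close> on, so no two rows share a weight.\<close>

definition sieve_entry :: "(nat \<Rightarrow> nat) \<Rightarrow> nat \<Rightarrow> nat \<Rightarrow> nat \<Rightarrow> int" where
  "sieve_entry w x r c = (\<Sum>e<k * k. int (w (r * (k * k) + e)) *
     of_bool (allowed r (e div k) (e mod k) \<and> digit 3 x (e div k) \<noteq> 0 \<and> digit 3 x (e mod k) \<noteq> 1) *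
     incidence r (e div k) (e mod k) c)"

definition sieve_poly :: "(nat \<Rightarrow> nat) \<Rightarrow> int" where
  "sieve_poly w = (\<Sum>x<3 ^ k. sieve_sign k x * det_fun k (sieve_entry w x))"

text \<open>Once the determinants are expanded, the sum over states can be moved inside. There it
  meets only the restrictions on tails and heads and turns into the sieve sum of a single
  assignment.\<close>

lemma sieve_poly_expand:
  "sieve_poly w = (\<Sum>f\<in>{0..<k} \<rightarrow>\<^sub>E {..<k * k}. (\<Prod>r = 0..<k. int (w (r * (k * k) + f r))) * coefficient f)"
proof -
  define ok where "ok x r e \<longleftrightarrow> allowed r (e div k) (e mod k) \<and> digit 3 x (e div k) \<noteq> 0 \<and> digit 3 x (e mod k) \<noteq> 1" for x r e
  define D where "D f = det_fun k (\<lambda>r. incidence r (f r div k) (f r mod k))" for f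
  let ?F = "{0..<k} \<rightarrow>\<^sub>E {..<k * k}"
  define W where "W f = (\<Prod>r = 0..<k. int (w (r * (k * k) + f r)))" for f
  have of_bool_prod: "(\<Prod>r = 0..<k. of_bool (P r) :: int) = of_bool (\<forall>r<k. P r)" for P
    by (simp add: prod_of_bool Ball_def)
  have "det_fun k (sieve_entry w x) = (\<Sum>f\<in>?F. W f * of_bool (\<forall>r<k. ok x r (f r)) * D f)" for x
  proof -
    have "det_fun k (sieve_entry w x) = det_fun k (\<lambda>r c. \<Sum>e<k * k.
        (int (w (r * (k * k) + e)) * of_bool (ok x r e)) * incidence r (e div k) (e mod k) c)"
      by (intro det_fun_cong) (simp add: sieve_entry_def ok_def)
    also have "\<dots> = (\<Sum>f\<in>?F. W f * of_bool (\<forall>r<k. ok x r (f r)) * D f)"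
      by (subst det_fun_expand) (simp_all add: prod.distrib of_bool_prod W_def D_def)
    finally show ?thesis .
  qed
  then have "sieve_poly w = (\<Sum>x<3 ^ k. \<Sum>f\<in>?F. sieve_sign k x * (W f * of_bool (\<forall>r<k. ok x r (f r)) * D f))"
    by (simp add: sieve_poly_def sum_distrib_left)
  also have "\<dots> = (\<Sum>f\<in>?F. \<Sum>x<3 ^ k. sieve_sign k x * (W f * of_bool (\<forall>r<k. ok x r (f r)) * D f))"
    by (rule sum.swap)
  also have "\<dots> = (\<Sum>f\<in>?F. W f * coefficient f)"
  proof (intro sum.cong refl)
    fix f
    have "W f * coefficient f = (\<Sum>x<3 ^ k. W f * (of_bool (\<forall>r<k. allowed r (f r div k) (f r mod k)) * D f *
        (sieve_sign k x * of_bool (\<forall>r<k. digit 3 x (f r div k) \<noteq> 0 \<and> digit 3 x (f r mod k) \<noteq> 1))))"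
      by (simp only: coefficient_def D_def sum_distrib_left mult.assoc)
    also have "\<dots> = (\<Sum>x<3 ^ k. sieve_sign k x * (W f * of_bool (\<forall>r<k. ok x r (f r)) * D f))"
      by (intro sum.cong refl) (auto simp: ok_def)
    finally show "(\<Sum>x<3 ^ k. sieve_sign k x * (W f * of_bool (\<forall>r<k. ok x r (f r)) * D f)) = W f * coefficient f" ..
  qed
  finally show ?thesis by (simp add: W_def)
qed

lemma row_index_inj:
  assumes "r * (k * k) + e = r' * (k * k) + e'" "e < k * k" "e' < k * k"
  shows "r = r' \<and> e = e'"
proof -
  have "r = (r * (k * k) + e) div (k * k)" "r' = (r' * (k * k) + e') div (k * k)" using assms(2,3) k_pos by simp_all
  with assms(1) have "r = r'" by metis
  with assms(1) show ?thesis by simp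
qed

lemma multiaffine_sieve_poly: "multiaffine sieve_poly"
proof -
  have "multiaffine (\<lambda>w. \<Sum>f\<in>{0..<k} \<rightarrow>\<^sub>E {..<k * k}. coefficient f * (\<Prod>r = 0..<k. int (w (r * (k * k) + f r))))"
  proof (intro multiaffine_sum multiaffine_const_mult multiaffine_monomial)
    fix f assume f: "f \<in> {0..<k} \<rightarrow>\<^sub>E {..<k * k}"
    show "inj_on (\<lambda>r. r * (k * k) + f r) {0..<k}"
    proof (rule inj_onI)
      fix r r' assume "r \<in> {0..<k}" "r' \<in> {0..<k}" "r * (k * k) + f r = r' * (k * k) + f r'"
      then show "r = r'" using f row_index_inj[of r "f r" r' "f r'"] by (auto simp: PiE_def Pi_def)
    qed
  qed simp
  moreover have "sieve_poly = (\<lambda>w. \<Sum>f\<in>{0..<k} \<rightarrow>\<^sub>E {..<k * k}. coefficient f * (\<Prod>r = 0..<k. int (w (r * (k * k) + f r))))"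
    by (rule ext) (simp add: sieve_poly_expand mult.commute)
  ultimately show ?thesis by simp
qed

text \<open>Weights 1 on the choices of \<open>f\<close> and 0 elsewhere annihilate every monomial
  but that of \<open>f\<close>, so coefficients cannot cancel each other.\<close>

lemma sieve_poly_nonzero:
  assumes "f \<in> {0..<k} \<rightarrow>\<^sub>E {..<k * k}" "coefficient f \<noteq> 0"
  shows "\<exists>w. sieve_poly w \<noteq> 0 \<and> (\<forall>j\<ge>k ^ 3. w j = 0)"
proof -
  define w :: "nat \<Rightarrow> nat" where "w j = of_bool (\<exists>r<k. j = r * (k * k) + f r)" for j
  have fr: "f r < k * k" if "r < k" for r using assms(1) that by (auto simp: PiE_def Pi_def)
  have "sieve_poly w = (\<Sum>g\<in>{0..<k} \<rightarrow>\<^sub>E {..<k * k}. if g = f then coefficient f else 0)"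
    unfolding sieve_poly_expand
  proof (intro sum.cong refl)
    fix g assume g: "g \<in> {0..<k} \<rightarrow>\<^sub>E {..<k * k}"
    show "(\<Prod>r = 0..<k. int (w (r * (k * k) + g r))) * coefficient g = (if g = f then coefficient f else 0)"
    proof (cases "g = f")
      case True
      have "w (r * (k * k) + f r) = 1" if "r < k" for r using that by (auto simp: w_def)
      then show ?thesis using True by simp
    next
      case False
      then obtain r where r: "r < k" "g r \<noteq> f r" using PiE_ext[OF g assms(1)] by fastforce
      have gr: "g r < k * k" using g r by (auto simp: PiE_def Pi_def)
      have "w (r * (k * k) + g r) = 0"
        using row_index_inj[OF _ gr fr] r(2) by (auto simp: w_def)
      then have "(\<Prod>r = 0..<k. int (w (r * (k * k) + g r))) = 0" using r by (intro prod_zero) auto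
      then show ?thesis using False by simp
    qed
  qed
  also have "\<dots> = coefficient f" using assms(1) by (simp add: finite_PiE)
  finally have "sieve_poly w \<noteq> 0" using assms(2) by simp
  moreover have "w j = 0" if "k ^ 3 \<le> j" for j
  proof -
    have "r * (k * k) + f r < k ^ 3" if "r < k" for r
    proof -
      have "r * (k * k) + f r < Suc r * (k * k)" using fr[OF that] by simp
      also have "\<dots> \<le> k * (k * k)" using that by (intro mult_right_mono) auto
      finally show ?thesis by (simp add: power3_eq_cube)
    qed
    then have "\<not> (\<exists>r<k. j = r * (k * k) + f r)" using that by (metis linorder_not_less)
    then show ?thesis by (simp add: w_def)
  qed
  ultimately show ?thesis by blast
qed

text \<open>The number \<open>K\<close> of digits may exceed the number of weights: the program
  draws n^3 digits, whatever the size of the cover.\<close>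

lemma sieve_poly_zeros:
  assumes "cyclic_successor n E \<pi>" "0 < q" "k ^ 3 \<le> K"
  shows "q * card {Z. Z < q ^ K \<and> sieve_poly (digit q Z) = 0} \<le> K * q ^ K"
proof -
  obtain f where "f \<in> {0..<k} \<rightarrow>\<^sub>E {..<k * k}" "coefficient f \<noteq> 0"
    using coefficient_if_cyclic_successor[OF assms(1)] by blast
  from sieve_poly_nonzero[OF this] obtain w where "sieve_poly w \<noteq> 0" "\<forall>j\<ge>k ^ 3. w j = 0" by blast
  then show ?thesis using multiaffine_zeros[OF multiaffine_sieve_poly, of w K q] assms(2,3) by simp
qed

lemma cyclic_successor_if_sieve_poly:
  assumes "sieve_poly w \<noteq> 0"
  shows "\<exists>\<pi>. cyclic_successor n E \<pi>"
proof -
  obtain f where "f \<in> {0..<k} \<rightarrow>\<^sub>E {..<k * k}" "coefficient f \<noteq> 0"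
    using assms unfolding sieve_poly_expand by (metis (no_types, lifting) mult_zero_right sum.neutral)
  then show ?thesis by (rule cyclic_successor_if_coefficient)
qed

definition perturbed_poly :: "int \<Rightarrow> (nat \<Rightarrow> nat) \<Rightarrow> int" where
  "perturbed_poly t w = (\<Sum>x<3 ^ k. sieve_sign k x * det_fun k (\<lambda>i j. of_bool (i = j) + t * sieve_entry w x i j))"

lemma abs_sieve_entry_le:
  assumes "\<And>j. w j < q"
  shows "\<bar>sieve_entry w x r c\<bar> \<le> int (k * k * q)"
proof -
  have "\<bar>sieve_entry w x r c\<bar> \<le> (\<Sum>e<k * k. int q)"
    unfolding sieve_entry_def
  proof (intro order_trans[OF sum_abs] sum_mono)
    fix e
    have "\<bar>incidence r (e div k) (e mod k) c\<bar> \<le> 1" by (simp add: incidence_def)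
    moreover have "int (w (r * (k * k) + e)) \<le> int q" using assms[of "r * (k * k) + e"] by simp
    ultimately show "\<bar>int (w (r * (k * k) + e)) *
       of_bool (allowed r (e div k) (e mod k) \<and> digit 3 x (e div k) \<noteq> 0 \<and> digit 3 x (e mod k) \<noteq> 1) *
       incidence r (e div k) (e mod k) c\<bar> \<le> int q"
      using mult_mono[of "int (w (r * (k * k) + e))" "int q" "\<bar>incidence r (e div k) (e mod k) c\<bar>" 1]
      by (auto simp: abs_mult)
  qed
  then show ?thesis by simp
qed

lemma abs_sieve_sign: "\<bar>sieve_sign k x\<bar> = 1"
  unfolding sieve_sign_def abs_prod by (rule prod.neutral) simp

text \<open>
  For large \<open>t\<close> the polynomial \<open>perturbed_poly\<close> is dominated by its leading term, which is
  \<open>t ^ k * sieve_poly w\<close>.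
\<close>

lemma perturbed_poly_threshold:
  assumes w: "\<And>j. w j < q" and t: "2 * (3 ^ k * (fact k * (k * (k * k * q + 1) ^ k))) < t"
  shows "sieve_poly w \<noteq> 0 \<longleftrightarrow> int t ^ k \<le> 2 * \<bar>perturbed_poly (int t) w\<bar>"
    and "2 * \<bar>perturbed_poly (int t) w\<bar> + int t ^ k \<le> int t ^ (k + 2)"
proof -
  define B where "B = int (k * k * q)"
  \<comment> \<open>The number of states, times the number of permutations, times the bound of
    \<open>prod_perturb\<close> with its power of \<open>t\<close> taken out.\<close>
  define M where "M = 3 ^ k * (fact k * (int k * (B + 1) ^ k))"
  define T where "T = int t"
  have "int (2 * (3 ^ k * (fact k * (k * (k * k * q + 1) ^ k)))) < int t" using t by linarith
  then have tM: "2 * M < T" by (simp add: M_def B_def T_def algebra_simps)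
  have B: "0 \<le> B" by (simp add: B_def)
  have "1 * (1 * (1 * 1)) \<le> M" unfolding M_def using k_pos B by (intro mult_mono) auto
  then have M1: "1 \<le> M" by simp
  then have T2: "2 < T" using tM by simp
  have entry: "\<bar>sieve_entry w x i j\<bar> \<le> B" for x i j using abs_sieve_entry_le[OF w] by (simp add: B_def)
  define Q where "Q = perturbed_poly T w"
  define P where "P = sieve_poly w"
  let ?D = "\<lambda>x. det_fun k (\<lambda>i j. of_bool (i = j) + T * sieve_entry w x i j)"
  have "Q - T ^ k * P = (\<Sum>x<3 ^ k. sieve_sign k x * (?D x - T ^ k * det_fun k (sieve_entry w x)))"
    by (simp add: Q_def P_def perturbed_poly_def sieve_poly_def sum_distrib_left sum_subtractf[symmetric] algebra_simps)
  then have "T * \<bar>Q - T ^ k * P\<bar> \<le> T * (\<Sum>x<3 ^ k. \<bar>sieve_sign k x * (?D x - T ^ k * det_fun k (sieve_entry w x))\<bar>)"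
    using T2 by (intro mult_left_mono) (auto intro: sum_abs)
  also have "\<dots> = (\<Sum>x<3 ^ k. T * \<bar>?D x - T ^ k * det_fun k (sieve_entry w x)\<bar>)"
    by (simp add: abs_mult abs_sieve_sign sum_distrib_left)
  also have "\<dots> \<le> (\<Sum>x<(3::nat) ^ k. fact k * (int k * (T * (B + 1)) ^ k))"
    using entry B T2 by (intro sum_mono det_fun_perturb) auto
  also have "\<dots> = M * T ^ k" by (simp add: M_def power_mult_distrib)
  finally have "T * (2 * \<bar>Q - T ^ k * P\<bar>) \<le> 2 * M * T ^ k" by simp
  also have "\<dots> < T * T ^ k" using tM T2 by (intro mult_strict_right_mono) auto
  \<comment> \<open>The deviation is less than half of \<open>T ^ k\<close>, so
    \<open>\<bar>Q\<bar>\<close> lies below \<open>T ^ k / 2\<close> if \<open>P = 0\<close> and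
    above it if \<open>P\<close> is a nonzero integer.\<close>
  finally have diff: "2 * \<bar>Q - T ^ k * P\<bar> < T ^ k" using T2 by simp
  have "\<bar>Q\<bar> \<le> (\<Sum>x<(3::nat) ^ k. fact k * (T * (B + 1)) ^ k)"
    unfolding Q_def perturbed_poly_def
  proof (intro order_trans[OF sum_abs] sum_mono)
    fix x
    have "\<bar>?D x\<bar> \<le> fact k * (T * (B + 1)) ^ k"
    proof (rule abs_det_fun_le)
      fix i j
      have "\<bar>of_bool (i = j) + T * sieve_entry w x i j\<bar> \<le> \<bar>of_bool (i = j)\<bar> + \<bar>T * sieve_entry w x i j\<bar>"
        by (rule abs_triangle_ineq)
      also have "\<dots> \<le> T + T * B" using T2 entry by (intro add_mono) (auto simp: abs_mult)
      finally show "\<bar>of_bool (i = j) + T * sieve_entry w x i j\<bar> \<le> T * (B + 1)" by (simp add: algebra_simps)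
    qed
    then show "\<bar>sieve_sign k x * ?D x\<bar> \<le> fact k * (T * (B + 1)) ^ k" by (simp add: abs_mult abs_sieve_sign)
  qed
  also have "\<dots> = 3 ^ k * (fact k * (1 * (B + 1) ^ k)) * T ^ k" by (simp add: power_mult_distrib)
  also have "\<dots> \<le> M * T ^ k"
    unfolding M_def using k_pos B T2 by (intro mult_mono) auto
  finally have "2 * \<bar>Q\<bar> \<le> 2 * M * T ^ k" by simp
  also have "\<dots> \<le> T * T ^ k" using tM T2 by (intro mult_right_mono) auto
  finally have Qle: "2 * \<bar>Q\<bar> \<le> T * T ^ k" .
  have "1 * T ^ k \<le> T * T ^ k" using T2 by (intro mult_right_mono) auto
  moreover have "2 * (T * T ^ k) \<le> T * (T * T ^ k)" using T2 by (intro mult_right_mono) auto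
  ultimately have 2: "2 * \<bar>Q\<bar> + T ^ k \<le> T ^ (k + 2)" using Qle by (simp add: algebra_simps power2_eq_square)
  have 1: "P \<noteq> 0 \<longleftrightarrow> T ^ k \<le> 2 * \<bar>Q\<bar>"
  proof (cases "P = 0")
    case True
    then show ?thesis using diff by simp
  next
    case False
    then have "T ^ k * 1 \<le> T ^ k * \<bar>P\<bar>" using T2 by (intro mult_left_mono) auto
    then have "T ^ k \<le> \<bar>T ^ k * P\<bar>" using T2 by (simp add: abs_mult)
    moreover have "\<bar>T ^ k * P\<bar> - \<bar>Q\<bar> \<le> \<bar>Q - T ^ k * P\<bar>"
      using abs_triangle_ineq2[of "T ^ k * P" Q] by (simp only: abs_minus_commute)
    moreover have "C \<le> 2 * q" if "C \<le> A" "A - q \<le> d" "2 * d < C" for A C d q :: int using that by linarith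
    ultimately have "T ^ k \<le> 2 * \<bar>Q\<bar>" using diff by blast
    with False show ?thesis by simp
  qed
  show "sieve_poly w \<noteq> 0 \<longleftrightarrow> int t ^ k \<le> 2 * \<bar>perturbed_poly (int t) w\<bar>"
    using 1 by (simp add: P_def Q_def T_def)
  show "2 * \<bar>perturbed_poly (int t) w\<bar> + int t ^ k \<le> int t ^ (k + 2)"
    using 2 by (simp add: Q_def T_def)
qed

text \<open>The residue \<open>acc\<close> is the value itself or, if that is negative, the value
  plus \<open>N\<close>. Its absolute value is thus \<open>acc\<close> or \<open>N - acc\<close>,
  and since \<open>N\<close> leaves a margin of \<open>t ^ k\<close>, the other one passes the test
  anyway.\<close>

lemma perturbed_poly_mod_threshold:
  assumes w: "\<And>j. w j < q" and t: "2 * (3 ^ k * (fact k * (k * (k * k * q + 1) ^ k))) < t"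
    and acc: "[int acc = perturbed_poly (int t) w] (mod int N)" "acc < N" "t ^ (k + 2) \<le> N"
  shows "sieve_poly w \<noteq> 0 \<longleftrightarrow> t ^ k \<le> 2 * acc \<and> t ^ k \<le> 2 * (N - acc)"
proof -
  define Q where "Q = perturbed_poly (int t) w"
  define T where "T = int t ^ k"
  have 1: "sieve_poly w \<noteq> 0 \<longleftrightarrow> T \<le> 2 * \<bar>Q\<bar>"
    using perturbed_poly_threshold(1)[of w q t, OF w t] by (simp add: Q_def T_def)
  have "int (t ^ (k + 2)) \<le> int N" using acc(3) by linarith
  then have 2: "2 * \<bar>Q\<bar> + T \<le> int N" using perturbed_poly_threshold(2)[of w q t, OF w t] by (simp add: Q_def T_def)
  have "0 < t" using t by simp
  then have T: "0 < T" by (simp add: T_def)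
  have eq: "int acc = (if 0 \<le> Q then Q else Q + int N)"
  proof -
    have "int acc mod int N = Q mod int N" using acc(1) by (simp add: cong_def Q_def)
    then have "int acc = Q mod int N" using acc(2) by simp
    also have "\<dots> = (if 0 \<le> Q then Q else Q + int N)"
    proof (cases "0 \<le> Q")
      case False
      then have "Q mod int N = (Q + int N) mod int N" by simp
      also have "\<dots> = Q + int N" using False 2 T by (intro mod_pos_pos_trivial) auto
      finally show ?thesis using False by simp
    qed (use 2 T in simp)
    finally show ?thesis .
  qed
  have "t ^ k \<le> 2 * acc \<and> t ^ k \<le> 2 * (N - acc) \<longleftrightarrow> T \<le> 2 * int acc \<and> T \<le> 2 * (int N - int acc)"
    using acc(2) by (simp add: T_def of_nat_diff flip: of_nat_power) linarith
  also have "\<dots> \<longleftrightarrow> T \<le> 2 * \<bar>Q\<bar>" using eq 2 T by (auto split: if_splits)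
  finally show ?thesis using 1 by simp
qed

end

text \<open>The in-place form of a Schur step: it speaks of trailing blocks only, so row and column
  \<open>p\<close> may keep their stale entries.\<close>

lemma det_fun_eliminate:
  assumes "p < k" "[y * M p p = 1] (mod N)"
    "\<And>i j. p < i \<Longrightarrow> i < k \<Longrightarrow> p < j \<Longrightarrow> j < k \<Longrightarrow> [M' i j = M i j - M i p * y * M p j] (mod N)"
  shows "[det_fun (k - p) (\<lambda>i j. M (p + i) (p + j)) =
      M p p * det_fun (k - Suc p) (\<lambda>i j. M' (Suc p + i) (Suc p + j))] (mod N)"
proof -
  have "[det_fun (Suc (k - Suc p)) (\<lambda>i j. M (p + i) (p + j)) =
      M p p * det_fun (k - Suc p) (\<lambda>i j. M (p + Suc i) (p + Suc j) - M (p + Suc i) p * y * M p (p + Suc j))] (mod N)"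
    using det_fun_Schur[of y "\<lambda>i j. M (p + i) (p + j)" N "k - Suc p"] assms(2) by simp
  also have "[M p p * det_fun (k - Suc p) (\<lambda>i j. M (p + Suc i) (p + Suc j) - M (p + Suc i) p * y * M p (p + Suc j)) =
     M p p * det_fun (k - Suc p) (\<lambda>i j. M' (Suc p + i) (Suc p + j))] (mod N)"
  proof (intro cong_mult cong_refl det_fun_cong_mod)
    fix i j assume "i < k - Suc p" "j < k - Suc p"
    then show "[M (p + Suc i) (p + Suc j) - M (p + Suc i) p * y * M p (p + Suc j) = M' (Suc p + i) (Suc p + j)] (mod N)"
      using cong_sym[OF assms(3)[of "Suc p + i" "Suc p + j"]] by simp
  qed
  finally show ?thesis using assms(1) by (simp add: Suc_diff_Suc)
qed

section \<open>The program\<close>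

abbreviation Plus (infixl \<open>\<^bold>+\<close> 65) where "a \<^bold>+ b \<equiv> Op Add a b"
abbreviation Minus (infixl \<open>\<^bold>-\<close> 65) where "a \<^bold>- b \<equiv> Op Sub a b"
abbreviation Times (infixl \<open>\<^bold>*\<close> 70) where "a \<^bold>* b \<equiv> Op Mul a b"
abbreviation Quot (infixl \<open>\<^bold>div\<close> 70) where "a \<^bold>div b \<equiv> Op Div a b"
abbreviation Rem (infixl \<open>\<^bold>mod\<close> 70) where "a \<^bold>mod b \<equiv> Op Mod a b"
abbreviation Leq (infix \<open>\<^bold>\<le>\<close> 50) where "a \<^bold>\<le> b \<equiv> Op Less a (Op Add b (Const 1))"
abbreviation Eq (infix \<open>\<^bold>=\<close> 50) where "a \<^bold>= b \<equiv> Op Equal a b"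
abbreviation seq (infixr \<open>;;\<close> 45) where "c1 ;; c2 \<equiv> Seq c1 c2"

lemma store_same [simp]: "store m x i v x = (m x)(i := v)"
  by (simp add: store_def)

lemma store_other [simp]: "y \<noteq> x \<Longrightarrow> store m x i v y = m y"
  by (simp add: store_def)

definition power_com :: "string \<Rightarrow> expr \<Rightarrow> expr \<Rightarrow> com" where
  "power_com x y e = (Set x (Const 1) ;; For ''i'' e (Set x (Var x \<^bold>* y)))"

lemma writes_power_com [simp]: "writes (power_com x y e) = {x, ''i''}"
  by (auto simp: power_com_def)

lemma tot_power_com:
  assumes "x \<noteq> ''i''" "1 \<le> v" "v ^ b < V" "b < V" "0 < I" "5 * b + 5 \<le> K"
    and "\<And>s. (\<And>z. z \<noteq> x \<Longrightarrow> z \<noteq> ''i'' \<Longrightarrow> s z = m z) \<Longrightarrow> expr_val y s = v \<and> expr_val e s = b"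
  shows "tot V I (power_com x y e) m K (\<lambda>s. s x 0 = v ^ b)"
proof -
  have "1 \<le> v ^ b" using assms(2) by simp
  then have V: "1 < V" using assms(3) by linarith
  show ?thesis
    unfolding power_com_def
  proof (rule tot_Seq)
    show "tot V I (Set x (Const 1)) m 1 (\<lambda>s. s x 0 = 1)"
      using V assms(5) by (intro tot_wp) auto
  next
    fix s assume s: "s x 0 = 1" "\<And>z. z \<notin> writes (Set x (Const 1)) \<Longrightarrow> s z = m z"
    show "tot V I (For ''i'' e (Set x (Var x \<^bold>* y))) s (b * (1 + 4) + 3) (\<lambda>s. s x 0 = v ^ b)"
    proof (rule tot_For[where P = "\<lambda>j s. s x 0 = v ^ j"])
      show "store s ''i'' 0 0 x 0 = v ^ 0" using s(1) assms(1) by simp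
    next
      fix j s' assume j: "j < b" "s' x 0 = v ^ j"
        and fr: "\<And>z. z \<noteq> ''i'' \<Longrightarrow> z \<notin> writes (Set x (Var x \<^bold>* y)) \<Longrightarrow> s' z = s z"
      have "v ^ Suc j \<le> v ^ b" using j(1) assms(2) by (intro power_increasing) auto
      moreover have "expr_val y s' = v" using assms(7)[of s'] fr s(2) by auto
      ultimately show "tot V I (Set x (Var x \<^bold>* y)) s' 1 (\<lambda>s'. store s' ''i'' 0 (Suc j) x 0 = v ^ Suc j)"
        using j(2) assms(1,3,5) by (intro tot_wp) (auto simp: mult.commute)
    next
      fix j s' assume fr: "\<And>z. z \<noteq> ''i'' \<Longrightarrow> z \<notin> writes (Set x (Var x \<^bold>* y)) \<Longrightarrow> s' z = s z"
      show "expr_val e s' = b" using assms(7)[of s'] fr s(2) by auto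
    qed (use assms in auto)
  qed (use assms(6) in auto)
qed

subsection \<open>Searching a vertex cover\<close>

text \<open>
  The base 3 digits of \<open>y\<close> decide how to cover the next uncovered arc: 1 takes its tail, 2 its
  head, and 0 gives up. So a cover with \<open>c\<close> vertices is found for some \<open>y < 3 ^ c\<close>.
\<close>

fun cover_step :: "(nat \<Rightarrow> nat \<Rightarrow> bool) \<Rightarrow> nat \<Rightarrow> nat \<Rightarrow> nat list \<times> nat \<times> bool \<Rightarrow> nat list \<times> nat \<times> bool" where
  "cover_step E n i (cs, y, fl) =
    (if E (i div n) (i mod n) \<and> i div n \<notin> set cs \<and> i mod n \<notin> set cs
     then if y mod 3 = 0 then (cs, y div 3, True)
       else (cs @ [if y mod 3 = 1 then i div n else i mod n], y div 3, fl)
     else (cs, y, fl))"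

definition cover_run :: "(nat \<Rightarrow> nat \<Rightarrow> bool) \<Rightarrow> nat \<Rightarrow> nat \<Rightarrow> nat \<Rightarrow> nat list \<times> nat \<times> bool" where
  "cover_run E n j b = fold (cover_step E n) [0..<j] ([], b, False)"

lemma cover_run_0 [simp]: "cover_run E n 0 b = ([], b, False)"
  by (simp add: cover_run_def)

lemma cover_run_Suc [simp]: "cover_run E n (Suc j) b = cover_step E n j (cover_run E n j b)"
  by (simp add: cover_run_def)

lemma index_div_mod_less: "i < n * n \<Longrightarrow> i div n < n \<and> i mod n < (n::nat)"
  by (cases "n = 0") (auto simp: less_mult_imp_div_less)

text \<open>Each vertex taken consumes a nonzero digit of \<open>b\<close>. The last one consumed
  sits at position \<open>length cs - 1\<close>, which gives the lower bound on \<open>b\<close>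
  that later limits the size of the cover.\<close>

lemma cover_run_sound:
  assumes "cover_run E n j b = (cs, y, fl)" "j \<le> n * n"
  shows "distinct cs \<and> set cs \<subseteq> {..<n} \<and>
    (\<not> fl \<longrightarrow> 3 ^ length cs * y \<le> b \<and> (cs \<noteq> [] \<longrightarrow> 3 ^ (length cs - 1) \<le> b) \<and>
      (\<forall>i<j. E (i div n) (i mod n) \<longrightarrow> i div n \<in> set cs \<or> i mod n \<in> set cs))"
  using assms
proof (induction j arbitrary: cs y fl)
  case (Suc j)
  obtain cs' y' fl' where r: "cover_run E n j b = (cs', y', fl')" by (metis surj_pair)
  from Suc.IH[OF r] Suc.prems(2) have IH: "distinct cs'" "set cs' \<subseteq> {..<n}"
    "\<not> fl' \<Longrightarrow> 3 ^ length cs' * y' \<le> b \<and> (cs' \<noteq> [] \<longrightarrow> 3 ^ (length cs' - 1) \<le> b) \<and>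
      (\<forall>i<j. E (i div n) (i mod n) \<longrightarrow> i div n \<in> set cs' \<or> i mod n \<in> set cs')" by auto
  have lt: "j div n < n" "j mod n < n" using index_div_mod_less[of j n] Suc.prems(2) by auto
  show ?case
  proof (cases "E (j div n) (j mod n) \<and> j div n \<notin> set cs' \<and> j mod n \<notin> set cs'")
    case True
    show ?thesis
    proof (cases "y' mod 3 = 0")
      case True': True
      then show ?thesis using IH True Suc.prems(1) by (auto simp: r)
    next
      case False
      define w where "w = (if y' mod 3 = 1 then j div n else j mod n)"
      have new: "cs = cs' @ [w]" "y = y' div 3" "fl = fl'" using True False Suc.prems(1) by (auto simp: r w_def)
      have w: "w < n" "w \<notin> set cs'" using True lt by (auto simp: w_def)
      have "3 ^ length cs * y \<le> b \<and> 3 ^ length cs' \<le> b" if "\<not> fl"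
      proof -
        have *: "3 ^ length cs' * y' \<le> b" using IH(3) that new by auto
        have "3 ^ length cs' * (3 * (y' div 3)) \<le> 3 ^ length cs' * y'" by (intro mult_left_mono) auto
        \<comment> \<open>The digit just consumed is nonzero, hence so is \<open>y'\<close>.\<close>
        moreover have "3 ^ length cs' * 1 \<le> 3 ^ length cs' * y'" using False by (intro mult_left_mono) (cases y', auto)
        ultimately have "3 ^ length cs' * (3 * (y' div 3)) \<le> b" "3 ^ length cs' \<le> b"
          using * by linarith+
        then show ?thesis using new by (simp add: ac_simps)
      qed
      moreover have "i div n \<in> set cs \<or> i mod n \<in> set cs" if "\<not> fl" "i < Suc j" "E (i div n) (i mod n)" for i
        using IH(3) that new by (cases "i = j") (auto simp: w_def less_Suc_eq)
      ultimately show ?thesis using IH(1,2) new w by auto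
    qed
  next
    case False
    then have "cs = cs'" "y = y'" "fl = fl'" using Suc.prems(1) by (auto simp: r)
    then show ?thesis using IH False by (auto simp: less_Suc_eq)
  qed
qed simp

text \<open>The digits are chosen with a cover \<open>S\<close> at hand: each uncovered arc has an
  end in \<open>S\<close>, and taking it shrinks what is left of \<open>S\<close>. So
  \<open>card (S - set cs)\<close> digits suffice.\<close>

lemma cover_fold_complete:
  assumes "finite S" "\<And>i. i \<in> set is \<Longrightarrow> E (i div n) (i mod n) \<Longrightarrow> i div n \<in> S \<or> i mod n \<in> S"
  shows "\<exists>y < 3 ^ card (S - set cs). \<not> snd (snd (fold (cover_step E n) is (cs, y, False)))"
  using assms(2)
proof (induction "is" arbitrary: cs)
  case (Cons i "is")
  show ?case
  proof (cases "E (i div n) (i mod n) \<and> i div n \<notin> set cs \<and> i mod n \<notin> set cs")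
    case True
    define e where "e = (if i div n \<in> S then 1 else 2 :: nat)"
    define w where "w = (if i div n \<in> S then i div n else i mod n)"
    have w: "w \<in> S" "w \<notin> set cs" using True Cons.prems[of i] by (auto simp: w_def)
    obtain y where y: "y < 3 ^ card (S - set (cs @ [w]))"
      "\<not> snd (snd (fold (cover_step E n) is (cs @ [w], y, False)))"
      using Cons.IH[of "cs @ [w]"] Cons.prems by auto
    have "S - set (cs @ [w]) = (S - set cs) - {w}" by auto
    then have "card (S - set cs) = Suc (card (S - set (cs @ [w])))"
      using w assms(1) card_Suc_Diff1[of "S - set cs" w] by simp
    then have "e + 3 * y < 3 ^ card (S - set cs)" using y(1) by (auto simp: e_def)
    moreover have "cover_step E n i (cs, e + 3 * y, False) = (cs @ [w], y, False)"
      using True by (auto simp: e_def w_def)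
    ultimately show ?thesis using y(2) by (intro exI[of _ "e + 3 * y"]) simp
  next
    case False
    then have "cover_step E n i (cs, y, False) = (cs, y, False)" for y by auto
    then show ?thesis using Cons.IH[of cs] Cons.prems by simp
  qed
qed (auto intro: exI[of _ 0])

lemma cover_run_complete:
  assumes "finite S" "\<And>u v. E u v \<Longrightarrow> u \<in> S \<or> v \<in> S"
  shows "\<exists>b < 3 ^ card S. \<not> snd (snd (cover_run E n j b))"
  using cover_fold_complete[of S "[0..<j]" E n "[]"] assms unfolding cover_run_def by simp

text \<open>Minimality of the guess, not of the list, is what the program guarantees by counting
  upwards; the bound on the length follows from it.\<close>

definition found_cover :: "(nat \<Rightarrow> nat \<Rightarrow> bool) \<Rightarrow> nat \<Rightarrow> nat list" where
  "found_cover E n = fst (cover_run E n (n * n) (LEAST b. \<not> snd (snd (cover_run E n (n * n) b))))"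

text \<open>The least successful guess is below \<open>3 ^ card S\<close>, whereas a cover of
  \<open>l > 0\<close> vertices requires a guess of at least \<open>3 ^ (l - 1)\<close>.\<close>

lemma found_cover:
  assumes "finite S" "\<And>u v. E u v \<Longrightarrow> u \<in> S \<or> v \<in> S" "\<And>u v. E u v \<Longrightarrow> u < n \<and> v < n"
  shows "distinct (found_cover E n)" "set (found_cover E n) \<subseteq> {..<n}" "length (found_cover E n) \<le> card S"
    "\<And>u v. E u v \<Longrightarrow> u \<in> set (found_cover E n) \<or> v \<in> set (found_cover E n)"
proof -
  let ?fail = "\<lambda>b. snd (snd (cover_run E n (n * n) b))"
  obtain b0 where b0: "b0 < 3 ^ card S" "\<not> ?fail b0"
    using cover_run_complete[of S E n "n * n"] assms(1,2) by blast
  define b where "b = (LEAST b. \<not> ?fail b)"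
  have b: "\<not> ?fail b" "b \<le> b0" using LeastI[of "\<lambda>b. \<not> ?fail b", OF b0(2)] Least_le[of "\<lambda>b. \<not> ?fail b", OF b0(2)]
    by (simp_all add: b_def)
  obtain cs y fl where r: "cover_run E n (n * n) b = (cs, y, fl)" by (metis surj_pair)
  have cs: "found_cover E n = cs" "\<not> fl" using r b(1) by (auto simp: found_cover_def b_def)
  note snd = cover_run_sound[OF r order_refl]
  show "distinct (found_cover E n)" "set (found_cover E n) \<subseteq> {..<n}" using snd cs by auto
  show "length (found_cover E n) \<le> card S"
  proof (cases "cs = []")
    case False
    then have "3 ^ (length cs - 1) \<le> b" using snd cs(2) by blast
    then have "(3::nat) ^ (length cs - 1) < 3 ^ card S" using b(2) b0(1) by linarith
    then have "length cs - 1 < card S" by (rule power_less_imp_less_exp[rotated]) simp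
    then show ?thesis using cs(1) by simp
  qed (simp add: cs)
  show "u \<in> set (found_cover E n) \<or> v \<in> set (found_cover E n)" if uv: "E u v" for u v
  proof -
    have lt: "u < n" "v < n" using assms(3)[OF uv] by auto
    have "u * n + v < Suc u * n" using lt by simp
    also have "\<dots> \<le> n * n" using lt by (intro mult_right_mono) auto
    finally have "u * n + v < n * n" .
    moreover have "(u * n + v) div n = u" "(u * n + v) mod n = v" using lt by auto
    ultimately show ?thesis using snd cs uv by metis
  qed
qed

text \<open>Products serve as conjunctions and comparisons with 0 as negations. The assignment to
  \<open>''w''\<close> selects an end without branching: for digit 1 the factors are 1 and 0, for
  digit 2 they are 0 and 1.\<close>

definition cover_step_com :: com where
  "cover_step_com =
    Cond (Read ''arc'' (Var ''i'') \<^bold>* (Read ''C'' (Var ''i'' \<^bold>div Var ''n'') \<^bold>= Const 0) \<^bold>*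
        (Read ''C'' (Var ''i'' \<^bold>mod Var ''n'') \<^bold>= Const 0))
      (Set ''d'' (Var ''y'' \<^bold>mod Const 3) ;;
       Set ''y'' (Var ''y'' \<^bold>div Const 3) ;;
       Cond (Var ''d'')
        (Set ''w'' ((Const 2 \<^bold>- Var ''d'') \<^bold>* (Var ''i'' \<^bold>div Var ''n'') \<^bold>+
           (Var ''d'' \<^bold>- Const 1) \<^bold>* (Var ''i'' \<^bold>mod Var ''n'')) ;;
         Assign ''C'' (Var ''w'') (Const 1) ;;
         Assign ''cv'' (Var ''k'') (Var ''w'') ;;
         Set ''k'' (Var ''k'' \<^bold>+ Const 1))
        (Set ''go'' (Const 1)))
      Skip"

definition cover_attempt_com :: com where
  "cover_attempt_com =
    (Set ''y'' (Var ''b'') ;; Set ''k'' (Const 0) ;; Set ''go'' (Const 0) ;;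
     For ''i'' (Var ''n'') (Assign ''C'' (Var ''i'') (Const 0)) ;;
     For ''i'' (Var ''n'' \<^bold>* Var ''n'') cover_step_com ;;
     Set ''b'' (Var ''b'' \<^bold>+ Const 1))"

definition cover_com :: com where
  "cover_com = (Set ''b'' (Const 0) ;; Set ''go'' (Const 1) ;; While (Var ''go'') cover_attempt_com)"

definition collect_com :: com where
  "collect_com = (Set ''a'' (Const 0) ;;
    For ''i'' (Var ''n'') (Cond (Read ''C'' (Var ''i'')) Skip
      (Assign ''iv'' (Var ''a'') (Var ''i'') ;; Set ''a'' (Var ''a'' \<^bold>+ Const 1))))"

lemma writes_cover_step_com: "writes cover_step_com = {''d'', ''y'', ''w'', ''C'', ''cv'', ''k'', ''go''}"
  by (auto simp: cover_step_com_def)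

lemma writes_cover_attempt_com:
  "writes cover_attempt_com = {''d'', ''y'', ''w'', ''C'', ''cv'', ''k'', ''go'', ''b'', ''i''}"
  by (auto simp: cover_attempt_com_def writes_cover_step_com)

lemma writes_cover_com: "writes cover_com = {''d'', ''y'', ''w'', ''C'', ''cv'', ''k'', ''go'', ''b'', ''i''}"
  by (auto simp: cover_com_def writes_cover_attempt_com)

lemma writes_collect_com: "writes collect_com = {''a'', ''iv'', ''i''}"
  by (auto simp: collect_com_def)

text \<open>The cover is stored twice, as a table \<open>''C''\<close> for membership tests and as
  an enumeration \<open>''cv''\<close> for the sieve.\<close>

definition holds_cover :: "(nat \<Rightarrow> nat \<Rightarrow> bool) \<Rightarrow> nat \<Rightarrow> nat list \<Rightarrow> memory \<Rightarrow> bool" where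
  "holds_cover E n cs s \<longleftrightarrow> s ''k'' 0 = length cs \<and> (\<forall>v<n. s ''C'' v = of_bool (v \<in> set cs)) \<and>
     (\<forall>j<length cs. s ''cv'' j = cs ! j)"

locale machine =
  fixes n V I :: nat and E :: "nat \<Rightarrow> nat \<Rightarrow> bool"
  assumes V: "n * n < V" "3 ^ n < V" "3 < V" and I: "n * n < I" "n < I"
begin

lemma n_lt_V: "n < V"
  using V(2) power_gt_expt[of 3 n] by simp

definition holds_graph :: "memory \<Rightarrow> bool" where
  "holds_graph s \<longleftrightarrow> s ''n'' 0 = n \<and> (\<forall>i<n * n. s ''arc'' i = of_bool (E (i div n) (i mod n)))"

lemma tot_cover_step:
  assumes "holds_graph s" "i < n * n" "s ''i'' 0 = i" "cover_run E n i b = (cs, y, fl)" "b < V"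
    "holds_cover E n cs s" "s ''y'' 0 = y" "y \<le> b" "s ''go'' 0 = of_bool fl"
  shows "tot V I cover_step_com s 20 (\<lambda>s'. case cover_run E n (Suc i) b of (cs, y, fl) \<Rightarrow>
     holds_cover E n cs s' \<and> s' ''y'' 0 = y \<and> y \<le> b \<and> s' ''go'' 0 = of_bool fl)"
proof (rule tot_wp)
  have arc: "s ''arc'' i = of_bool (E (i div n) (i mod n))" "s ''n'' 0 = n"
    using assms(1,2) by (auto simp: holds_graph_def)
  have lt: "i div n < n" "i mod n < n" using index_div_mod_less[OF assms(2)] by auto
  have cs: "distinct cs" "set cs \<subseteq> {..<n}" using cover_run_sound[OF assms(4)] assms(2) by auto
  have C: "s ''C'' (i div n) = of_bool (i div n \<in> set cs)" "s ''C'' (i mod n) = of_bool (i mod n \<in> set cs)"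
    "s ''k'' 0 = length cs"
    using assms(6) lt by (auto simp: holds_cover_def)
  \<comment> \<open>A vertex is appended to \<open>''cv''\<close> at address
    \<open>length cs\<close>, which has to stay below \<open>I\<close>.\<close>
  have len: "length cs < n" if "w \<notin> set cs" "w < n" for w
  proof -
    have "card (insert w (set cs)) \<le> card {..<n}" using cs that by (intro card_mono) auto
    then show ?thesis using cs(1) that by (simp add: distinct_card)
  qed
  have m: "y mod 3 = 0 \<or> y mod 3 = 1 \<or> y mod 3 = 2" by linarith
  have yV: "y < V" "y div 3 < V" "y mod 3 < V" "y div 3 \<le> b" using assms(5,8) V(3)
    by (auto intro: le_less_trans[OF div_le_dividend] le_less_trans[OF mod_less_eq_dividend] order_trans[OF div_le_dividend])
  show "wp V I cover_step_com (\<lambda>s'. case cover_run E n (Suc i) b of (cs, y, fl) \<Rightarrow>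
     holds_cover E n cs s' \<and> s' ''y'' 0 = y \<and> y \<le> b \<and> s' ''go'' 0 = of_bool fl) s"
  proof (cases "E (i div n) (i mod n) \<and> i div n \<notin> set cs \<and> i mod n \<notin> set cs")
    case False
    then show ?thesis using assms by (auto simp: cover_step_com_def arc C)
  next
    case True
    have len': "length cs < n" using len lt True by blast
    show ?thesis
    proof (cases "y mod 3 = 0")
      case True': True
      then show ?thesis using True assms yV I V
        by (auto simp: cover_step_com_def arc C holds_cover_def)
    next
      case False
      define w where "w = (if y mod 3 = 1 then i div n else i mod n)"
      have w: "(2 - s ''y'' 0 mod 3) * (s ''i'' 0 div n) + (s ''y'' 0 mod 3 - Suc 0) * (s ''i'' 0 mod n) = w"
        using m False assms(3,7) by (auto simp: w_def)
      have w': "w < n" "w \<notin> set cs" using lt True by (auto simp: w_def)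
      have run: "cover_run E n (Suc i) b = (cs @ [w], y div 3, fl)" using True False assms(4) by (auto simp: w_def)
      show ?thesis unfolding run using True False assms(3,6,7,9) yV I V len' w' n_lt_V
        by (auto simp: cover_step_com_def arc C holds_cover_def w nth_append less_Suc_eq)
    qed
  qed
qed (simp add: cover_step_com_def)

lemma tot_cover_attempt:
  assumes "holds_graph m" "m ''b'' 0 = b" "Suc b < V"
  shows "tot V I cover_attempt_com m (24 * (n * n) + 5 * n + 20) (\<lambda>s. s ''b'' 0 = Suc b \<and>
    (case cover_run E n (n * n) b of (cs, y, fl) \<Rightarrow> holds_cover E n cs s \<and> s ''go'' 0 = of_bool fl))"
  unfolding cover_attempt_com_def
proof (rule tot_Seq)
  show "tot V I (Set ''y'' (Var ''b'')) m 1 (\<lambda>s. s ''y'' 0 = b)"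
    using assms(2,3) I by (intro tot_wp) auto
next
  fix s1 assume s1: "s1 ''y'' 0 = b" "\<And>x. x \<notin> writes (Set ''y'' (Var ''b'')) \<Longrightarrow> s1 x = m x"
  let ?rest = "For ''i'' (Var ''n'') (Assign ''C'' (Var ''i'') (Const 0)) ;;
     For ''i'' (Var ''n'' \<^bold>* Var ''n'') cover_step_com ;; Set ''b'' (Var ''b'' \<^bold>+ Const 1)"
  let ?Q = "\<lambda>s. s ''b'' 0 = Suc b \<and>
    (case cover_run E n (n * n) b of (cs, y, fl) \<Rightarrow> holds_cover E n cs s \<and> s ''go'' 0 = of_bool fl)"
  show "tot V I (Set ''k'' (Const 0) ;; Set ''go'' (Const 0) ;; ?rest) s1 (24 * (n * n) + 5 * n + 18) ?Q"
  proof (rule tot_Seq)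
    show "tot V I (Set ''k'' (Const 0)) s1 1 (\<lambda>s. s ''k'' 0 = 0)" using I V by (intro tot_wp) auto
  next
    fix s2 assume s2: "s2 ''k'' 0 = 0" "\<And>x. x \<notin> writes (Set ''k'' (Const 0)) \<Longrightarrow> s2 x = s1 x"
    show "tot V I (Set ''go'' (Const 0) ;; ?rest) s2 (24 * (n * n) + 5 * n + 16) ?Q"
    proof (rule tot_Seq)
      show "tot V I (Set ''go'' (Const 0)) s2 1 (\<lambda>s. s ''go'' 0 = 0)" using I V by (intro tot_wp) auto
    next
      fix s3 assume s3: "s3 ''go'' 0 = 0" "\<And>x. x \<notin> writes (Set ''go'' (Const 0)) \<Longrightarrow> s3 x = s2 x"
      have fr3: "s3 ''n'' = m ''n''" "s3 ''arc'' = m ''arc''" "s3 ''b'' = m ''b''" "s3 ''y'' 0 = b" "s3 ''k'' 0 = 0"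
        using s1 s2 s3 by auto
      show "tot V I ?rest s3 (24 * (n * n) + 5 * n + 14) ?Q"
      proof (rule tot_Seq)
        show "tot V I (For ''i'' (Var ''n'') (Assign ''C'' (Var ''i'') (Const 0))) s3 (n * (1 + 4) + 3)
          (\<lambda>s. \<forall>v<n. s ''C'' v = 0)"
        proof (rule tot_For[where P = "\<lambda>j s. \<forall>v<j. s ''C'' v = 0"])
          fix j s assume "j < n" "\<forall>v<j. s ''C'' v = 0" "s ''i'' 0 = j"
          then show "tot V I (Assign ''C'' (Var ''i'') (Const 0)) s 1 (\<lambda>s'. \<forall>v<Suc j. store s' ''i'' 0 (Suc j) ''C'' v = 0)"
            using I V by (intro tot_wp) (auto simp: less_Suc_eq)
        qed (use fr3 assms(1) n_lt_V I in \<open>auto simp: holds_graph_def\<close>)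
      next
        fix s4 assume s4: "\<forall>v<n. s4 ''C'' v = 0"
          "\<And>x. x \<notin> writes (For ''i'' (Var ''n'') (Assign ''C'' (Var ''i'') (Const 0))) \<Longrightarrow> s4 x = s3 x"
        have fr4: "s4 ''n'' = m ''n''" "s4 ''arc'' = m ''arc''" "s4 ''b'' = m ''b''" "s4 ''y'' 0 = b" "s4 ''k'' 0 = 0" "s4 ''go'' 0 = 0"
          using s4 s3(1) fr3 by auto
        show "tot V I (For ''i'' (Var ''n'' \<^bold>* Var ''n'') cover_step_com ;; Set ''b'' (Var ''b'' \<^bold>+ Const 1)) s4
          (24 * (n * n) + 8) ?Q"
        proof (rule tot_Seq)
          show "tot V I (For ''i'' (Var ''n'' \<^bold>* Var ''n'') cover_step_com) s4 ((n * n) * (20 + 4) + 3)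
            (\<lambda>s. case cover_run E n (n * n) b of (cs, y, fl) \<Rightarrow>
               holds_cover E n cs s \<and> s ''y'' 0 = y \<and> y \<le> b \<and> s ''go'' 0 = of_bool fl)"
          proof (rule tot_For[where P = "\<lambda>j s. case cover_run E n j b of (cs, y, fl) \<Rightarrow>
               holds_cover E n cs s \<and> s ''y'' 0 = y \<and> y \<le> b \<and> s ''go'' 0 = of_bool fl"])
            fix j s assume j: "j < n * n" "case cover_run E n j b of (cs, y, fl) \<Rightarrow>
               holds_cover E n cs s \<and> s ''y'' 0 = y \<and> y \<le> b \<and> s ''go'' 0 = of_bool fl" "s ''i'' 0 = j"
              and fr: "\<And>x. x \<noteq> ''i'' \<Longrightarrow> x \<notin> writes cover_step_com \<Longrightarrow> s x = s4 x"
            obtain cs y fl where r: "cover_run E n j b = (cs, y, fl)" by (metis surj_pair)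
            have "s ''n'' = m ''n''" "s ''arc'' = m ''arc''" using fr fr4 by (auto simp: writes_cover_step_com)
            then have "holds_graph s" using assms(1) by (simp add: holds_graph_def)
            from tot_cover_step[OF this j(1,3) r, of] j(2) assms(3)
            have "tot V I cover_step_com s 20 (\<lambda>s'. case cover_run E n (Suc j) b of (cs, y, fl) \<Rightarrow>
              holds_cover E n cs s' \<and> s' ''y'' 0 = y \<and> y \<le> b \<and> s' ''go'' 0 = of_bool fl)"
              by (auto simp: r)
            then show "tot V I cover_step_com s 20 (\<lambda>s'. case cover_run E n (Suc j) b of (cs, y, fl) \<Rightarrow>
              holds_cover E n cs (store s' ''i'' 0 (Suc j)) \<and> store s' ''i'' 0 (Suc j) ''y'' 0 = y \<and> y \<le> b \<and>
                store s' ''i'' 0 (Suc j) ''go'' 0 = of_bool fl)"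
              by (rule tot_mono) (auto simp: holds_cover_def split: prod.splits)
          next
            fix j s assume fr: "\<And>x. x \<noteq> ''i'' \<Longrightarrow> x \<notin> writes cover_step_com \<Longrightarrow> s x = s4 x"
            have "s ''n'' = m ''n''" using fr fr4 by (auto simp: writes_cover_step_com)
            then show "expr_val (Var ''n'' \<^bold>* Var ''n'') s = n * n" using assms(1) by (simp add: holds_graph_def)
          qed (use fr4 s4(1) V I in \<open>auto simp: holds_cover_def writes_cover_step_com\<close>)
        next
          fix s5 assume s5: "case cover_run E n (n * n) b of (cs, y, fl) \<Rightarrow>
               holds_cover E n cs s5 \<and> s5 ''y'' 0 = y \<and> y \<le> b \<and> s5 ''go'' 0 = of_bool fl"
            "\<And>x. x \<notin> writes (For ''i'' (Var ''n'' \<^bold>* Var ''n'') cover_step_com) \<Longrightarrow> s5 x = s4 x"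
          have "s5 ''b'' 0 = b" using s5(2) fr4 assms(2) by (auto simp: writes_cover_step_com)
          then show "tot V I (Set ''b'' (Var ''b'' \<^bold>+ Const 1)) s5 1 ?Q"
            using s5(1) assms(3) I by (intro tot_wp) (auto simp: holds_cover_def split: prod.splits)
        qed auto
      qed auto
    qed auto
  qed auto
qed auto

text \<open>A cover with \<open>c\<close> vertices guarantees a successful guess below
  \<open>3 ^ c\<close>, and each attempt is a single scan of the adjacency matrix.\<close>

lemma tot_cover:
  assumes "holds_graph m" "finite S" "\<And>u v. E u v \<Longrightarrow> u \<in> S \<or> v \<in> S" "card S = c" "c \<le> n"
  shows "tot V I cover_com m (3 ^ c * (24 * (n * n) + 5 * n + 22) + (24 * (n * n) + 5 * n + 40))
    (holds_cover E n (found_cover E n))"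
proof -
  let ?fail = "\<lambda>b. snd (snd (cover_run E n (n * n) b))"
  let ?K = "24 * (n * n) + 5 * n + 20"
  obtain b0 where b0: "b0 < 3 ^ c" "\<not> ?fail b0"
    using cover_run_complete[of S E n "n * n"] assms(2-4) by blast
  have "(3::nat) ^ c \<le> 3 ^ n" using assms(5) by (intro power_increasing) auto
  then have c3: "3 ^ c < V" using V by linarith
  \<comment> \<open>\<open>''b''\<close> advances after every attempt, even a successful one, so on
    exit the good guess is one less than \<open>''b''\<close>. The \<open>of_bool\<close> term
    shifts the range of known failures accordingly.\<close>
  define Inv where "Inv s \<longleftrightarrow> (\<forall>b < s ''b'' 0 - of_bool (s ''go'' 0 = 0). ?fail b) \<and>
    (s ''go'' 0 = 0 \<longrightarrow> s ''b'' 0 \<noteq> 0 \<and> \<not> ?fail (s ''b'' 0 - 1) \<and>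
        holds_cover E n (fst (cover_run E n (n * n) (s ''b'' 0 - 1))) s)" for s
  have le: "s ''b'' 0 - of_bool (s ''go'' 0 = 0) \<le> b0" if "Inv s" for s :: memory
    using that b0(2) unfolding Inv_def by (meson not_le)
  show ?thesis
    unfolding cover_com_def
  proof (rule tot_Seq)
    show "tot V I (Set ''b'' (Const 0)) m 1 (\<lambda>s. s ''b'' 0 = 0)" using I V by (intro tot_wp) auto
  next
    fix s1 assume s1: "s1 ''b'' 0 = 0" "\<And>x. x \<notin> writes (Set ''b'' (Const 0)) \<Longrightarrow> s1 x = m x"
    show "tot V I (Set ''go'' (Const 1) ;; While (Var ''go'') cover_attempt_com) s1
       ((3 ^ c + 1) * (?K + 2) + 3) (holds_cover E n (found_cover E n))"
    proof (rule tot_Seq)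
      show "tot V I (Set ''go'' (Const 1)) s1 1 (\<lambda>s. s ''go'' 0 = 1)" using I V by (intro tot_wp) auto
    next
      fix s2 assume s2: "s2 ''go'' 0 = 1" "\<And>x. x \<notin> writes (Set ''go'' (Const 1)) \<Longrightarrow> s2 x = s1 x"
      have b2: "s2 ''b'' 0 = 0" "s2 ''n'' = m ''n''" "s2 ''arc'' = m ''arc''" using s1 s2 by auto
      show "tot V I (While (Var ''go'') cover_attempt_com) s2 ((3 ^ c + 1) * (?K + 2) + 1)
       (holds_cover E n (found_cover E n))"
      proof (rule tot_While[where P = Inv and f = "\<lambda>s. 3 ^ c - s ''b'' 0"])
        show "Inv s2" using b2 s2 by (simp add: Inv_def)
      next
        fix s assume s: "Inv s" "expr_val (Var ''go'') s \<noteq> 0"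
          and fr: "\<And>x. x \<notin> writes cover_attempt_com \<Longrightarrow> s x = s2 x"
        have "s ''n'' = m ''n''" "s ''arc'' = m ''arc''" using fr b2 by (auto simp: writes_cover_attempt_com)
        then have g: "holds_graph s" using assms(1) by (simp add: holds_graph_def)
        define b where "b = s ''b'' 0"
        have b: "b \<le> b0" "\<forall>b'<b. ?fail b'" using s le[OF s(1)] by (auto simp: Inv_def b_def)
        have "Suc b < V" using b(1) b0(1) c3 by linarith
        from tot_cover_attempt[OF g b_def[symmetric] this]
        show "tot V I cover_attempt_com s ?K
           (\<lambda>s'. Inv s' \<and> (expr_val (Var ''go'') s' \<noteq> 0 \<longrightarrow> 3 ^ c - s' ''b'' 0 < 3 ^ c - s ''b'' 0))"
        proof (rule tot_mono)
          fix s' assume s': "s' ''b'' 0 = Suc b \<and> (case cover_run E n (n * n) b of (cs, y, fl) \<Rightarrow>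
            holds_cover E n cs s' \<and> s' ''go'' 0 = of_bool fl)"
          obtain cs y fl where r: "cover_run E n (n * n) b = (cs, y, fl)" by (metis surj_pair)
          have "Inv s'" using s' b(2) by (cases fl) (auto simp: Inv_def r less_Suc_eq)
          then show "Inv s' \<and> (expr_val (Var ''go'') s' \<noteq> 0 \<longrightarrow> 3 ^ c - s' ''b'' 0 < 3 ^ c - s ''b'' 0)"
            using s' b(1) b0(1) by (auto simp: b_def[symmetric])
        qed simp
      next
        fix s assume s: "Inv s" "expr_val (Var ''go'') s = 0"
        define b where "b = s ''b'' 0 - 1"
        have b: "\<not> ?fail b" "holds_cover E n (fst (cover_run E n (n * n) b)) s" "\<And>b'. b' < b \<Longrightarrow> ?fail b'"
          using s by (auto simp: Inv_def b_def)
        then have "(LEAST b. \<not> ?fail b) = b" by (intro Least_equality) (auto simp: not_less[symmetric])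
        with b(2) show "holds_cover E n (found_cover E n) s" by (simp add: found_cover_def)
      next
        show "(3 ^ c - s2 ''b'' 0 + 1) * (?K + 2) + 1 \<le> (3 ^ c + 1) * (?K + 2) + 1" by simp
      qed
    qed simp
  qed (simp add: algebra_simps)
qed

lemma tot_collect:
  assumes "m ''n'' 0 = n" "holds_cover E n cs m"
  shows "tot V I collect_com m (20 * n + 20)
    (\<lambda>s. let is = filter (\<lambda>v. v \<notin> set cs) [0..<n] in s ''a'' 0 = length is \<and> (\<forall>r<length is. s ''iv'' r = is ! r))"
  unfolding collect_com_def
proof (rule tot_Seq)
  show "tot V I (Set ''a'' (Const 0)) m 1 (\<lambda>s. s ''a'' 0 = 0)" using I V by (intro tot_wp) auto
next
  let ?is = "\<lambda>j. filter (\<lambda>v. v \<notin> set cs) [0..<j]"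
  let ?body = "Cond (Read ''C'' (Var ''i'')) Skip
      (Assign ''iv'' (Var ''a'') (Var ''i'') ;; Set ''a'' (Var ''a'' \<^bold>+ Const 1))"
  fix s1 assume s1: "s1 ''a'' 0 = 0" "\<And>x. x \<notin> writes (Set ''a'' (Const 0)) \<Longrightarrow> s1 x = m x"
  show "tot V I (For ''i'' (Var ''n'') ?body) s1 (n * (10 + 4) + 3)
    (\<lambda>s. let is = ?is n in s ''a'' 0 = length is \<and> (\<forall>r<length is. s ''iv'' r = is ! r))"
  proof (rule tot_For[where P = "\<lambda>j s. s ''a'' 0 = length (?is j) \<and> (\<forall>r<length (?is j). s ''iv'' r = ?is j ! r)"])
    fix j s assume j: "j < n" "s ''a'' 0 = length (?is j) \<and> (\<forall>r<length (?is j). s ''iv'' r = ?is j ! r)" "s ''i'' 0 = j"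
      and fr: "\<And>x. x \<noteq> ''i'' \<Longrightarrow> x \<notin> writes ?body \<Longrightarrow> s x = s1 x"
    have "length (?is j) \<le> j" using length_filter_le[of "\<lambda>v. v \<notin> set cs" "[0..<j]"] by simp
    then have l: "length (?is j) < n" using j(1) by simp
    have C: "s ''C'' j = of_bool (j \<in> set cs)" using fr s1(2) assms(2) j(1) by (simp add: holds_cover_def)
    show "tot V I ?body s 10 (\<lambda>s'. store s' ''i'' 0 (Suc j) ''a'' 0 = length (?is (Suc j)) \<and>
      (\<forall>r<length (?is (Suc j)). store s' ''i'' 0 (Suc j) ''iv'' r = ?is (Suc j) ! r))"
      using j l C I n_lt_V by (intro tot_wp) (auto simp: nth_append less_Suc_eq)
  qed (use s1 assms(1) n_lt_V I in \<open>auto simp: Let_def\<close>)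
qed simp

end

subsection \<open>Evaluating the sieve\<close>

text \<open>The sign is kept in \<open>''g''\<close> as a residue, with \<open>N - g\<close> as
  negation. Elimination then multiplies its pivots into the same cell.\<close>

definition state_com :: com where
  "state_com = (Set ''y'' (Var ''x'') ;; Set ''g'' (Const 1) ;;
    For ''p'' (Var ''k'')
      (Assign ''st'' (Var ''p'') (Var ''y'' \<^bold>mod Const 3) ;;
       Set ''y'' (Var ''y'' \<^bold>div Const 3) ;;
       Cond (Read ''st'' (Var ''p'') \<^bold>= Const 2) Skip (Set ''g'' (Var ''N'' \<^bold>- Var ''g''))))"

definition identity_com :: com where
  "identity_com = For ''i'' (Var ''k'' \<^bold>* Var ''k'')
     (Assign ''A'' (Var ''i'') ((Var ''i'' \<^bold>div Var ''k'') \<^bold>= (Var ''i'' \<^bold>mod Var ''k'')))"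

definition row_expr :: expr where "row_expr = Var ''i'' \<^bold>div (Var ''k'' \<^bold>* Var ''k'')"
definition tail_expr :: expr where "tail_expr = Var ''i'' \<^bold>div Var ''k'' \<^bold>mod Var ''k''"
definition head_expr :: expr where "head_expr = Var ''i'' \<^bold>mod Var ''k''"
text \<open>Row 0 collects total weight in column 0, so the column is the tail multiplied by the
  truth value of \<open>0 < row\<close>.\<close>

definition plus_cell :: expr where
  "plus_cell = row_expr \<^bold>* Var ''k'' \<^bold>+ Op Less (Const 0) row_expr \<^bold>* tail_expr"
definition minus_cell :: expr where "minus_cell = row_expr \<^bold>* Var ''k'' \<^bold>+ head_expr"

text \<open>A digit is removed from \<open>''z''\<close> in every round, used or not, which keeps
  the weights aligned with the loop index. The weights themselves are never stored: every state
  extracts them from \<open>''Z''\<close> again.\<close>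

definition fill_step_com :: com where
  "fill_step_com =
    (Set ''w'' ((Var ''z'' \<^bold>mod Var ''q'') \<^bold>* Var ''t'') ;;
     Set ''z'' (Var ''z'' \<^bold>div Var ''q'') ;;
     Cond (Op Less row_expr (Var ''a''))
       (Set ''d'' (Read ''arc'' (Read ''cv'' tail_expr \<^bold>* Var ''n'' \<^bold>+ Read ''iv'' row_expr) \<^bold>*
          Read ''arc'' (Read ''iv'' row_expr \<^bold>* Var ''n'' \<^bold>+ Read ''cv'' head_expr)))
       (Set ''d'' (Read ''arc'' (Read ''cv'' tail_expr \<^bold>* Var ''n'' \<^bold>+ Read ''cv'' head_expr))) ;;
     Cond (Var ''d'' \<^bold>* Read ''st'' tail_expr \<^bold>* ((Read ''st'' head_expr \<^bold>= Const 1) \<^bold>= Const 0))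
       (Assign ''A'' plus_cell ((Read ''A'' plus_cell \<^bold>+ Var ''w'') \<^bold>mod Var ''N'') ;;
        Cond row_expr
          (Assign ''A'' minus_cell ((Read ''A'' minus_cell \<^bold>+ (Var ''N'' \<^bold>- Var ''w'')) \<^bold>mod Var ''N''))
          Skip)
       Skip)"

definition fill_com :: com where
  "fill_com = (Set ''z'' (Var ''Z'') ;; For ''i'' (Var ''k'' \<^bold>* Var ''k'' \<^bold>* Var ''k'') fill_step_com)"

definition pivot_expr :: expr where "pivot_expr = Read ''A'' (Var ''p'' \<^bold>* Var ''k'' \<^bold>+ Var ''p'')"

text \<open>Newton iteration from 1, which inverts the pivot modulo \<open>t\<close> already. Adding
  \<open>N\<close> before the subtraction keeps the truncated difference exact.\<close>

definition inverse_com :: com where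
  "inverse_com = (Set ''y'' (Const 1) ;; For ''i'' (Var ''n'' \<^bold>+ Const 1)
    (Set ''y'' (Var ''y'' \<^bold>* ((Const 2 \<^bold>+ Var ''N'') \<^bold>- (pivot_expr \<^bold>* Var ''y'' \<^bold>mod Var ''N'')) \<^bold>mod Var ''N'')))"

definition schur_step_com :: com where
  "schur_step_com =
    Cond (Op Less (Var ''p'') (Var ''i'' \<^bold>div Var ''k'') \<^bold>* Op Less (Var ''p'') (Var ''i'' \<^bold>mod Var ''k''))
      (Assign ''A'' (Var ''i'') ((Read ''A'' (Var ''i'') \<^bold>+ (Var ''N'' \<^bold>-
         (Read ''A'' ((Var ''i'' \<^bold>div Var ''k'') \<^bold>* Var ''k'' \<^bold>+ Var ''p'') \<^bold>* Var ''y'' \<^bold>*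
          Read ''A'' (Var ''p'' \<^bold>* Var ''k'' \<^bold>+ (Var ''i'' \<^bold>mod Var ''k'')) \<^bold>mod Var ''N''))) \<^bold>mod Var ''N''))
      Skip"

definition schur_com :: com where
  "schur_com = For ''i'' (Var ''k'' \<^bold>* Var ''k'') schur_step_com"

definition elimination_com :: com where
  "elimination_com = For ''p'' (Var ''k'')
    (inverse_com ;; Set ''g'' (Var ''g'' \<^bold>* pivot_expr \<^bold>mod Var ''N'') ;; schur_com)"

definition summand_com :: com where
  "summand_com = (state_com ;; identity_com ;; fill_com ;; elimination_com ;;
    Set ''acc'' ((Var ''acc'' \<^bold>+ Var ''g'') \<^bold>mod Var ''N''))"

definition sieve_com :: com where
  "sieve_com = (power_com ''K'' (Const 3) (Var ''k'') ;; power_com ''T'' (Var ''t'') (Var ''k'') ;;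
    Set ''acc'' (Const 0) ;; For ''x'' (Var ''K'') summand_com ;;
    Set ''out'' ((Var ''T'' \<^bold>\<le> Const 2 \<^bold>* Var ''acc'') \<^bold>* (Var ''T'' \<^bold>\<le> Const 2 \<^bold>* (Var ''N'' \<^bold>- Var ''acc''))))"

lemma writes_sieve_parts:
  "writes state_com = {''y'', ''g'', ''st'', ''p''}"
  "writes identity_com = {''A'', ''i''}"
  "writes fill_step_com = {''w'', ''z'', ''d'', ''A''}"
  "writes fill_com = {''w'', ''z'', ''d'', ''A'', ''i''}"
  "writes inverse_com = {''y'', ''i''}"
  "writes schur_step_com = {''A''}"
  "writes schur_com = {''A'', ''i''}"
  "writes elimination_com = {''p'', ''y'', ''i'', ''g'', ''A''}"
  "writes summand_com = {''y'', ''g'', ''st'', ''p'', ''A'', ''w'', ''z'', ''d'', ''i'', ''acc''}"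
  by (auto simp: state_com_def identity_com_def fill_step_com_def fill_com_def inverse_com_def
      schur_step_com_def schur_com_def elimination_com_def summand_com_def)

lemma writes_sieve_com:
  "writes sieve_com = {''K'', ''T'', ''x'', ''out'', ''y'', ''g'', ''st'', ''p'', ''A'', ''w'', ''z'', ''d'', ''i'', ''acc''}"
  by (auto simp: sieve_com_def writes_sieve_parts)

lemma wp_Seq: "wp V I (Seq c1 c2) Q = wp V I c1 (wp V I c2 Q)"
  by (rule ext) simp

text \<open>\<open>N\<close> has exponent \<open>n + 2\<close> rather than \<open>k + 2\<close>
  because it is computed before the cover is known. By \<open>q * t \<le> N\<close> a scaled weight
  is less than \<open>N\<close>, so it can be subtracted as \<open>N - w\<close>.\<close>

locale sieve_machine = machine n V I E + independent_split n k a E cv iv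
  for n V I k a :: nat and E :: "nat \<Rightarrow> nat \<Rightarrow> bool" and cv iv :: "nat \<Rightarrow> nat" +
  fixes t q Z N :: nat
  assumes t: "2 \<le> t" and q: "1 \<le> q" and qt: "q * t \<le> N" and N_def: "N = t ^ (n + 2)" and N_lt: "N < V"
    and Z: "Z < V" and n3: "n * n * n < V"
begin

lemma k_le_n: "k \<le> n"
proof -
  have "card (cv ` {..<k}) \<le> card {..<n}" using cover by (intro card_mono) auto
  then show ?thesis using card_image[OF cv] by simp
qed

lemma kk_le: "k * k \<le> n * n" "k * k * k \<le> n * n * n"
  using k_le_n by (auto intro!: mult_mono)

lemma bounds: "k * k < V" "k * k * k < V" "k < V" "k < I" "k * k < I" "n < V" "1 < N" "0 < N" "3 ^ k < V" "n + 1 < V"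
proof -
  show "1 < N" unfolding N_def using t by (intro one_less_power) auto
  then show "0 < N" by simp
  have "(3::nat) ^ k \<le> 3 ^ n" using k_le_n by (intro power_increasing) auto
  then show "3 ^ k < V" using V(2) by linarith
  have "n + 1 < 2 ^ (n + 1)" by (rule less_exp)
  also have "(2::nat) ^ (n + 1) \<le> t ^ (n + 1)" using t by (intro power_mono) auto
  also have "\<dots> \<le> N" using t by (simp add: N_def)
  finally show "n + 1 < V" using N_lt by simp
  show "k * k < V" "k * k * k < V" "k < V" "k < I" "k * k < I" "n < V"
    using kk_le k_le_n V I n3 n_lt_V by auto
qed

lemma t_dvd_N: "int t dvd int N"
  unfolding N_def by simp

text \<open>All that the sieve reads without ever writing it, so it passes through every subprogram
  by framing.\<close>

definition holds_input :: "memory \<Rightarrow> bool" where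
  "holds_input s \<longleftrightarrow> holds_graph s \<and> s ''k'' 0 = k \<and> s ''a'' 0 = a \<and> (\<forall>p<k. s ''cv'' p = cv p) \<and>
     (\<forall>r<a. s ''iv'' r = iv r) \<and> s ''t'' 0 = t \<and> s ''q'' 0 = q \<and> s ''Z'' 0 = Z \<and> s ''N'' 0 = N"

lemma holds_input_frame:
  assumes "holds_input s"
    "\<And>x. x \<in> {''n'', ''arc'', ''k'', ''a'', ''cv'', ''iv'', ''t'', ''q'', ''Z'', ''N''} \<Longrightarrow> s' x = s x"
  shows "holds_input s'"
  using assms by (simp add: holds_input_def holds_graph_def)

lemma holds_inputD:
  assumes "holds_input s"
  shows "s ''n'' 0 = n" "s ''k'' 0 = k" "s ''a'' 0 = a" "s ''t'' 0 = t" "s ''q'' 0 = q" "s ''Z'' 0 = Z" "s ''N'' 0 = N"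
    "p < k \<Longrightarrow> s ''cv'' p = cv p" "r < a \<Longrightarrow> s ''iv'' r = iv r"
  using assms by (auto simp: holds_input_def holds_graph_def)

lemma holds_input_arc:
  assumes "holds_input s" "u < n" "v < n"
  shows "s ''arc'' (u * n + v) = of_bool (E u v)"
proof -
  have "u * n + v < Suc u * n" using assms(3) by simp
  also have "\<dots> \<le> n * n" using assms(2) by (intro mult_right_mono) auto
  finally have "u * n + v < n * n" .
  moreover have "(u * n + v) div n = u" "(u * n + v) mod n = v" using assms(2,3) by auto
  ultimately show ?thesis using assms(1) by (simp add: holds_input_def holds_graph_def)
qed

lemma cell_less: "r < k \<Longrightarrow> c < k \<Longrightarrow> r * k + c < k * k"
proof -
  assume "r < k" "c < k"
  then have "r * k + c < Suc r * k" by simp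
  also have "\<dots> \<le> k * k" using \<open>r < k\<close> by (intro mult_right_mono) auto
  finally show ?thesis .
qed

lemma cell_eq_iff: "c < k \<Longrightarrow> c' < k \<Longrightarrow> r * k + c = r' * k + c' \<longleftrightarrow> r = r' \<and> c = c'"
proof
  assume c: "c < k" "c' < k" and eq: "r * k + c = r' * k + c'"
  have "r = (r * k + c) div k" "r' = (r' * k + c') div k" using c k_pos by simp_all
  then have "r = r'" using eq by metis
  with eq show "r = r' \<and> c = c'" by simp
qed simp

lemma tot_state:
  assumes "holds_input m" "m ''x'' 0 = x" "x < 3 ^ k"
  shows "tot V I state_com m (14 * k + 7) (\<lambda>s. s ''g'' 0 \<le> N \<and> [int (s ''g'' 0) = sieve_sign k x] (mod int N) \<and>
     (\<forall>p<k. s ''st'' p = digit 3 x p))"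
  unfolding state_com_def
proof (rule tot_Seq)
  have xV: "x < V" using assms(3) bounds by simp
  show "tot V I (Set ''y'' (Var ''x'')) m 1 (\<lambda>s. s ''y'' 0 = x)"
    using assms xV I by (intro tot_wp) auto
next
  let ?body = "Assign ''st'' (Var ''p'') (Var ''y'' \<^bold>mod Const 3) ;;
       Set ''y'' (Var ''y'' \<^bold>div Const 3) ;;
       Cond (Read ''st'' (Var ''p'') \<^bold>= Const 2) Skip (Set ''g'' (Var ''N'' \<^bold>- Var ''g''))"
  let ?Q = "\<lambda>s. s ''g'' 0 \<le> N \<and> [int (s ''g'' 0) = sieve_sign k x] (mod int N) \<and> (\<forall>p<k. s ''st'' p = digit 3 x p)"
  fix s1 assume s1: "s1 ''y'' 0 = x" "\<And>z. z \<notin> writes (Set ''y'' (Var ''x'')) \<Longrightarrow> s1 z = m z"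
  show "tot V I (Set ''g'' (Const 1) ;; For ''p'' (Var ''k'') ?body) s1 (14 * k + 5) ?Q"
  proof (rule tot_Seq)
    show "tot V I (Set ''g'' (Const 1)) s1 1 (\<lambda>s. s ''g'' 0 = 1)" using I V by (intro tot_wp) auto
  next
    fix s2 assume s2: "s2 ''g'' 0 = 1" "\<And>z. z \<notin> writes (Set ''g'' (Const 1)) \<Longrightarrow> s2 z = s1 z"
    have fr2: "s2 ''k'' = m ''k''" "s2 ''N'' = m ''N''" "s2 ''y'' 0 = x" using s1 s2 by auto
    have N: "m ''N'' 0 = N" "m ''k'' 0 = k" using holds_inputD[OF assms(1)] by auto
    define sg :: "nat \<Rightarrow> int" where "sg j = (\<Prod>p<j. if digit 3 x p = 2 then 1 else - 1)" for j
    show "tot V I (For ''p'' (Var ''k'') ?body) s2 (k * (10 + 4) + 3) ?Q"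
    proof (rule tot_For[where P = "\<lambda>j s. s ''y'' 0 = x div 3 ^ j \<and> s ''g'' 0 \<le> N \<and>
        [int (s ''g'' 0) = sg j] (mod int N) \<and> (\<forall>p<j. s ''st'' p = digit 3 x p)"])
      show "store s2 ''p'' 0 0 ''y'' 0 = x div 3 ^ 0 \<and> store s2 ''p'' 0 0 ''g'' 0 \<le> N \<and>
        [int (store s2 ''p'' 0 0 ''g'' 0) = sg 0] (mod int N) \<and> (\<forall>p<0. store s2 ''p'' 0 0 ''st'' p = digit 3 x p)"
        using fr2 s2(1) bounds by (simp add: sg_def)
    next
      fix j s assume j: "j < k" "s ''y'' 0 = x div 3 ^ j \<and> s ''g'' 0 \<le> N \<and>
        [int (s ''g'' 0) = sg j] (mod int N) \<and> (\<forall>p<j. s ''st'' p = digit 3 x p)" "s ''p'' 0 = j"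
        and fr: "\<And>z. z \<noteq> ''p'' \<Longrightarrow> z \<notin> writes ?body \<Longrightarrow> s z = s2 z"
      have sN: "s ''N'' 0 = N" using fr fr2 N by simp
      have d: "x div 3 ^ j mod 3 = digit 3 x j" "x div 3 ^ j div 3 = x div 3 ^ Suc j"
        by (simp_all only: digit_def power_Suc2 div_mult2_eq)
      have lt: "digit 3 x j < V" "x div 3 ^ Suc j < V"
        using V assms(3) bounds(9) by (auto simp: digit_def intro: less_trans le_less_trans[OF div_le_dividend])
      \<comment> \<open>Negation modulo \<open>N\<close>; it needs \<open>g \<le> N\<close>, since
        subtraction is truncated.\<close>
      have flip: "[int (N - s ''g'' 0) = - sg j] (mod int N)"
      proof -
        have "[int N - int (s ''g'' 0) = 0 - sg j] (mod int N)"
          using j(2) by (intro cong_diff) (auto simp: cong_def)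
        then show ?thesis using j(2) by (simp add: of_nat_diff)
      qed
      have NV: "N - s ''g'' 0 < V" using N_lt by simp
      show "tot V I ?body s 10 (\<lambda>s'. store s' ''p'' 0 (Suc j) ''y'' 0 = x div 3 ^ Suc j \<and>
        store s' ''p'' 0 (Suc j) ''g'' 0 \<le> N \<and> [int (store s' ''p'' 0 (Suc j) ''g'' 0) = sg (Suc j)] (mod int N) \<and>
        (\<forall>p<Suc j. store s' ''p'' 0 (Suc j) ''st'' p = digit 3 x p))"
      proof (rule tot_wp)
        show "wp V I ?body (\<lambda>s'. store s' ''p'' 0 (Suc j) ''y'' 0 = x div 3 ^ Suc j \<and>
          store s' ''p'' 0 (Suc j) ''g'' 0 \<le> N \<and> [int (store s' ''p'' 0 (Suc j) ''g'' 0) = sg (Suc j)] (mod int N) \<and>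
          (\<forall>p<Suc j. store s' ''p'' 0 (Suc j) ''st'' p = digit 3 x p)) s"
          using j bounds(4) I lt flip NV by (auto simp: sN d less_Suc_eq sg_def)
      qed simp
    qed (use fr2 N bounds I in \<open>auto simp: sg_def sieve_sign_def\<close>)
  qed simp
qed simp

lemma tot_identity:
  assumes "holds_input m"
  shows "tot V I identity_com m (5 * (k * k) + 3) (\<lambda>s. \<forall>i<k * k. s ''A'' i = of_bool (i div k = i mod k))"
  unfolding identity_com_def
proof (rule tot_For[where P = "\<lambda>j s. \<forall>i<j. s ''A'' i = of_bool (i div k = i mod k)" and k = 1 and b = "k * k"])
  fix j s assume j: "j < k * k" "\<forall>i<j. s ''A'' i = of_bool (i div k = i mod k)" "s ''i'' 0 = j"
    and fr: "\<And>z. z \<noteq> ''i'' \<Longrightarrow> z \<notin> writes (Assign ''A'' (Var ''i'') ((Var ''i'' \<^bold>div Var ''k'') \<^bold>= (Var ''i'' \<^bold>mod Var ''k''))) \<Longrightarrow> s z = m z"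
  have "s ''k'' 0 = k" using fr holds_inputD[OF assms] by simp
  then show "tot V I (Assign ''A'' (Var ''i'') ((Var ''i'' \<^bold>div Var ''k'') \<^bold>= (Var ''i'' \<^bold>mod Var ''k''))) s 1
     (\<lambda>s'. \<forall>i<Suc j. store s' ''i'' 0 (Suc j) ''A'' i = of_bool (i div k = i mod k))"
    using j bounds V by (intro tot_wp) (auto simp: less_Suc_eq)
qed (use holds_inputD[OF assms] bounds I in auto)

definition arc_ok :: "nat \<Rightarrow> nat \<Rightarrow> nat \<Rightarrow> nat \<Rightarrow> bool" where
  "arc_ok x r u v \<longleftrightarrow> allowed r u v \<and> digit 3 x u \<noteq> 0 \<and> digit 3 x v \<noteq> 1"

definition contribution :: "nat \<Rightarrow> nat \<Rightarrow> nat \<Rightarrow> nat \<Rightarrow> int" where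
  "contribution x i r c = of_bool (i div (k * k) = r) * (int (digit q Z i) * of_bool (arc_ok x r (i div k mod k) (i mod k)) *
     incidence r (i div k mod k) (i mod k) c)"

text \<open>The loop over \<open>k * k * k\<close> indices traverses the rows in blocks of
  \<open>k * k\<close> steps, and only the block of row \<open>r\<close> touches that row.\<close>

lemma sum_contribution:
  assumes "r < k"
  shows "(\<Sum>i<k * k * k. contribution x i r c) = sieve_entry (digit q Z) x r c"
proof -
  have "(\<Sum>i<k * (k * k). contribution x i r c) = (\<Sum>r'<k. \<Sum>e<k * k. contribution x (r' * (k * k) + e) r c)"
    by (rule sum_lessThan_append)
  also have "\<dots> = (\<Sum>r'<k. if r' = r then sieve_entry (digit q Z) x r c else 0)"
  proof (intro sum.cong refl)
    fix r'
    have dm: "(r' * (k * k) + e) div (k * k) = r'" "(r' * (k * k) + e) div k mod k = e div k" "(r' * (k * k) + e) mod k = e mod k"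
      if "e < k * k" for e
    proof -
      show "(r' * (k * k) + e) div (k * k) = r'" using that k_pos by simp
      have "(r' * (k * k) + e) div k = (e + k * (r' * k)) div k" by (simp add: ac_simps)
      also have "\<dots> = r' * k + e div k" using k_pos by simp
      finally show "(r' * (k * k) + e) div k mod k = e div k" using that by (simp add: less_mult_imp_div_less)
      have "(r' * (k * k) + e) mod k = (e + k * (r' * k)) mod k" by (simp add: ac_simps)
      then show "(r' * (k * k) + e) mod k = e mod k" by simp
    qed
    show "(\<Sum>e<k * k. contribution x (r' * (k * k) + e) r c) = (if r' = r then sieve_entry (digit q Z) x r c else 0)"
      unfolding contribution_def sieve_entry_def arc_ok_def using dm by (auto intro!: sum.cong)
  qed
  also have "\<dots> = sieve_entry (digit q Z) x r c" using assms by simp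
  finally show ?thesis by (simp add: mult.assoc)
qed

definition holds_matrix :: "memory \<Rightarrow> (nat \<Rightarrow> nat \<Rightarrow> int) \<Rightarrow> bool" where
  "holds_matrix s M \<longleftrightarrow> (\<forall>r<k. \<forall>c<k. s ''A'' (r * k + c) < N \<and> [int (s ''A'' (r * k + c)) = M r c] (mod int N))"

lemma tot_fill_step:
  assumes "holds_input s" "i < k * k * k" "s ''i'' 0 = i" "s ''z'' 0 = Z div q ^ i" "\<forall>p<k. s ''st'' p = digit 3 x p"
    "holds_matrix s M"
  shows "tot V I fill_step_com s 30 (\<lambda>s'. s' ''z'' 0 = Z div q ^ Suc i \<and>
     holds_matrix s' (\<lambda>r c. M r c + int t * contribution x i r c))"
proof (rule tot_wp)
  define r u v where "r = i div (k * k)" and "u = i div k mod k" and "v = i mod k"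
  note inp = holds_inputD[OF assms(1)]
  have r: "r < k" using assms(2) unfolding r_def by (intro less_mult_imp_div_less) (simp add: ac_simps)
  have uv: "u < k" "v < k" using k_pos by (auto simp: u_def v_def)
  define w where "w = digit q Z i * t"
  have "digit q Z i < q" using q by (simp add: digit_def)
  then have "w < q * t" using t by (simp add: w_def)
  then have w: "w < N" "w < V" using qt N_lt by auto
  have z: "Z div q ^ i mod q * t = w" "Z div q ^ i div q = Z div q ^ Suc i" "Z div q ^ Suc i < V"
    using Z by (auto simp only: w_def digit_def power_Suc2 div_mult2_eq intro: le_less_trans[OF div_le_dividend])
  have exprs: "expr_val row_expr s' = r" "expr_val tail_expr s' = u" "expr_val head_expr s' = v"
    if "s' ''i'' 0 = i" "s' ''k'' 0 = k" for s'
    using that by (simp_all add: row_expr_def tail_expr_def head_expr_def r_def u_def v_def)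
  have al: "(r < a \<and> s ''arc'' (cv u * n + iv r) * s ''arc'' (iv r * n + cv v) = of_bool (allowed r u v)) \<or>
      (\<not> r < a \<and> s ''arc'' (cv u * n + cv v) = of_bool (allowed r u v))"
    using holds_input_arc[OF assms(1)] cv_lt[OF uv(1)] cv_lt[OF uv(2)] iv_lt by (auto simp: allowed_def)
  define l1 where "l1 = r * k + of_bool (0 < r) * u"
  define l2 where "l2 = r * k + v"
  have l: "l1 < k * k" "l2 < k * k" using cell_less[OF r] uv k_pos by (auto simp: l1_def l2_def)
  have cells: "expr_val plus_cell s' = l1" "expr_val minus_cell s' = l2"
    if "s' ''i'' 0 = i" "s' ''k'' 0 = k" for s'
    using exprs[of s', OF that] that by (simp_all add: plus_cell_def minus_cell_def l1_def l2_def)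
  \<comment> \<open>The two cells are updated one after the other. If tail and head agree in a row
    above 0, the cells coincide and the updates cancel, in accordance with
    \<open>incidence\<close>.\<close>
  define A1 where "A1 = (s ''A'')(l1 := (s ''A'' l1 + w) mod N)"
  define A2 where "A2 = (if r = 0 then A1 else A1(l2 := (A1 l2 + (N - w)) mod N))"
  have A1: "A1 j < N \<and> [int (A1 j) = int (s ''A'' j) + of_bool (j = l1) * int w] (mod int N)" if "s ''A'' j < N" for j
    using that bounds(8) by (auto simp: A1_def zmod_int)
  have A2: "A2 j < N \<and> [int (A2 j) = int (s ''A'' j) + of_bool (j = l1) * int w - of_bool (0 < r \<and> j = l2) * int w] (mod int N)"
    if "s ''A'' j < N" for j
  proof (cases "0 < r \<and> j = l2")
    case True
    have "[int (A1 j) + (int N - int w) = int (s ''A'' j) + of_bool (j = l1) * int w + (0 - int w)] (mod int N)"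
      using A1[OF that] by (intro cong_add cong_diff) (auto simp: cong_def)
    then have "[int ((A1 j + (N - w)) mod N) = int (s ''A'' j) + of_bool (j = l1) * int w - int w] (mod int N)"
    proof -
      assume *: "[int (A1 j) + (int N - int w) = int (s ''A'' j) + of_bool (j = l1) * int w + (0 - int w)] (mod int N)"
      have "int ((A1 j + (N - w)) mod N) = (int (A1 j) + (int N - int w)) mod int N"
        using w(1) by (simp only: zmod_int of_nat_add of_nat_diff less_imp_le)
      with * show ?thesis unfolding cong_def by simp
    qed
    then show ?thesis using True bounds(8) by (simp add: A2_def)
  next
    case False
    then have "A2 j = A1 j" by (auto simp: A2_def)
    then show ?thesis using A1[OF that] False by auto
  qed
  have upd: "holds_matrix s' (\<lambda>r c. M r c + int t * contribution x i r c)"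
    if ok: "arc_ok x r u v" and A: "s' ''A'' = A2" for s'
    unfolding holds_matrix_def
  proof (intro allI impI)
    fix r' c assume rc: "r' < k" "c < k"
    have old: "s ''A'' (r' * k + c) < N" "[int (s ''A'' (r' * k + c)) = M r' c] (mod int N)"
      using assms(6) rc by (auto simp: holds_matrix_def)
    have e1: "r' * k + c = l1 \<longleftrightarrow> r' = r \<and> c = of_bool (0 < r) * u"
      unfolding l1_def using cell_eq_iff rc uv k_pos by auto
    have e2: "r' * k + c = l2 \<longleftrightarrow> r' = r \<and> c = v" unfolding l2_def using cell_eq_iff rc uv by auto
    have "of_bool (r' * k + c = l1) * int w - of_bool (0 < r \<and> r' * k + c = l2) * int w = int t * contribution x i r' c"
      unfolding e1 e2 contribution_def r_def[symmetric] u_def[symmetric] v_def[symmetric]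
      using ok by (auto simp: incidence_def w_def)
    then have "int (s ''A'' (r' * k + c)) + of_bool (r' * k + c = l1) * int w - of_bool (0 < r \<and> r' * k + c = l2) * int w =
       int (s ''A'' (r' * k + c)) + int t * contribution x i r' c" by linarith
    then have "A2 (r' * k + c) < N \<and> [int (A2 (r' * k + c)) = int (s ''A'' (r' * k + c)) + int t * contribution x i r' c] (mod int N)"
      using A2[OF old(1)] by metis
    moreover have "[int (s ''A'' (r' * k + c)) + int t * contribution x i r' c = M r' c + int t * contribution x i r' c] (mod int N)"
      using old(2) by (intro cong_add cong_refl)
    ultimately show "s' ''A'' (r' * k + c) < N \<and> [int (s' ''A'' (r' * k + c)) = M r' c + int t * contribution x i r' c] (mod int N)"
      unfolding A by (blast intro: cong_trans)
  qed
  have same: "holds_matrix s' (\<lambda>r c. M r c + int t * contribution x i r c)"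
    if "\<not> arc_ok x r u v" "s' ''A'' = s ''A''" for s'
    using assms(6) that unfolding holds_matrix_def contribution_def r_def u_def v_def by auto
  have modV: "j mod N < V" for j using bounds(8) N_lt by (meson less_trans mod_less_divisor)
  have lI: "l1 < I" "l2 < I" using l bounds(5) by auto
  define d where "d = (of_bool (allowed r u v) :: nat)"
  have dV: "d < V" using V by (simp add: d_def)
  define s2 where "s2 = store (store s ''w'' 0 w) ''z'' 0 (Z div q ^ Suc i)"
  define s3 where "s3 = store s2 ''d'' 0 d"
  have s3: "s3 ''i'' 0 = i" "s3 ''k'' 0 = k" "s3 ''d'' 0 = d" "s3 ''w'' 0 = w" "s3 ''N'' 0 = N" "s3 ''A'' = s ''A''"
    "s3 ''z'' 0 = Z div q ^ Suc i" "s3 ''st'' u = digit 3 x u" "s3 ''st'' v = digit 3 x v"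
    using inp assms(3,5) uv by (simp_all add: s3_def s2_def)
  have s2: "s2 ''i'' 0 = i" "s2 ''k'' 0 = k" "s2 ''a'' 0 = a" "s2 ''arc'' = s ''arc''" "s2 ''n'' 0 = n"
     "s2 ''cv'' u = cv u" "s2 ''cv'' v = cv v" "r < a \<Longrightarrow> s2 ''iv'' r = iv r"
    using inp assms(3) uv by (simp_all add: s2_def)
  let ?Q = "\<lambda>s'. s' ''z'' 0 = Z div q ^ Suc i \<and> holds_matrix s' (\<lambda>r c. M r c + int t * contribution x i r c)"
  let ?c3 = "Cond (Var ''d'' \<^bold>* Read ''st'' tail_expr \<^bold>* ((Read ''st'' head_expr \<^bold>= Const 1) \<^bold>= Const 0))
       (Assign ''A'' plus_cell ((Read ''A'' plus_cell \<^bold>+ Var ''w'') \<^bold>mod Var ''N'') ;;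
        Cond row_expr
          (Assign ''A'' minus_cell ((Read ''A'' minus_cell \<^bold>+ (Var ''N'' \<^bold>- Var ''w'')) \<^bold>mod Var ''N''))
          Skip)
       Skip"
  have 3: "wp V I ?c3 ?Q s3"
  proof (cases "arc_ok x r u v")
    case False
    then have "\<not> (d \<noteq> 0 \<and> digit 3 x u \<noteq> 0 \<and> digit 3 x v \<noteq> 1)" by (auto simp: arc_ok_def d_def)
    then show ?thesis using same[OF False] s3 exprs[of s3, OF s3(1,2)] by auto
  next
    case True
    then have "d \<noteq> 0 \<and> digit 3 x u \<noteq> 0 \<and> digit 3 x v \<noteq> 1" by (auto simp: arc_ok_def d_def)
    moreover define s4 where "s4 = store s3 ''A'' l1 ((s ''A'' l1 + w) mod N)"
    have s4: "s4 ''i'' 0 = i" "s4 ''k'' 0 = k" "s4 ''A'' = A1" "s4 ''w'' 0 = w" "s4 ''N'' 0 = N" "s4 ''z'' 0 = Z div q ^ Suc i"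
      using s3 by (simp_all add: s4_def A1_def)
    have "wp V I (Cond row_expr
          (Assign ''A'' minus_cell ((Read ''A'' minus_cell \<^bold>+ (Var ''N'' \<^bold>- Var ''w'')) \<^bold>mod Var ''N'')) Skip) ?Q s4"
      using upd[OF True] exprs[of s4, OF s4(1,2)] cells[of s4, OF s4(1,2)] s4 modV lI by (auto simp: A2_def)
    ultimately show ?thesis using s3 exprs[of s3, OF s3(1,2)] cells[of s3, OF s3(1,2)] modV lI by (simp add: s4_def)
  qed
  let ?c2 = "Cond (Op Less row_expr (Var ''a''))
       (Set ''d'' (Read ''arc'' (Read ''cv'' tail_expr \<^bold>* Var ''n'' \<^bold>+ Read ''iv'' row_expr) \<^bold>*
          Read ''arc'' (Read ''iv'' row_expr \<^bold>* Var ''n'' \<^bold>+ Read ''cv'' head_expr)))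
       (Set ''d'' (Read ''arc'' (Read ''cv'' tail_expr \<^bold>* Var ''n'' \<^bold>+ Read ''cv'' head_expr)))"
  have 2: "wp V I ?c2 W s2"
    if W: "W s3" for W
  proof (cases "r < a")
    case True
    then have "s ''arc'' (cv u * n + iv r) * s ''arc'' (iv r * n + cv v) = d" using al by (simp add: d_def)
    then show ?thesis using W True exprs[of s2, OF s2(1,2)] s2 dV I by (simp add: s3_def)
  next
    case False
    then have "s ''arc'' (cv u * n + cv v) = d" using al by (simp add: d_def)
    then show ?thesis using W False exprs[of s2, OF s2(1,2)] s2 dV I by (simp add: s3_def)
  qed
  have 1: "wp V I (Set ''w'' ((Var ''z'' \<^bold>mod Var ''q'') \<^bold>* Var ''t'') ;;
     Set ''z'' (Var ''z'' \<^bold>div Var ''q'')) W s" if "W s2" for W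
    using that inp assms(4) z w I by (simp add: s2_def)
  show "wp V I fill_step_com ?Q s"
    using 1[of "wp V I ?c2 (wp V I ?c3 ?Q)", OF 2[of "wp V I ?c3 ?Q", OF 3]]
    by (simp only: fill_step_com_def wp_Seq)
qed (simp add: fill_step_com_def)

lemma tot_fill:
  assumes "holds_input m" "\<forall>p<k. m ''st'' p = digit 3 x p" "\<forall>i<k * k. m ''A'' i = of_bool (i div k = i mod k)"
  shows "tot V I fill_com m (34 * (k * k * k) + 5)
    (\<lambda>s. holds_matrix s (\<lambda>r c. of_bool (r = c) + int t * sieve_entry (digit q Z) x r c))"
  unfolding fill_com_def
proof (rule tot_Seq)
  show "tot V I (Set ''z'' (Var ''Z'')) m 1 (\<lambda>s. s ''z'' 0 = Z)"
    using holds_inputD[OF assms(1)] Z I by (intro tot_wp) auto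
next
  fix s1 assume s1: "s1 ''z'' 0 = Z" "\<And>y. y \<notin> writes (Set ''z'' (Var ''Z'')) \<Longrightarrow> s1 y = m y"
  define part where "part j r c = of_bool (r = c) + int t * (\<Sum>i<j. contribution x i r c)" for j r c
  have inp1: "holds_input s1" using assms(1) by (rule holds_input_frame) (auto simp: s1(2))
  show "tot V I (For ''i'' (Var ''k'' \<^bold>* Var ''k'' \<^bold>* Var ''k'') fill_step_com) s1 (k * k * k * (30 + 4) + 3)
    (\<lambda>s. holds_matrix s (\<lambda>r c. of_bool (r = c) + int t * sieve_entry (digit q Z) x r c))"
  proof (rule tot_For[where P = "\<lambda>j s. s ''z'' 0 = Z div q ^ j \<and> holds_matrix s (part j)"])
    have "s1 ''A'' (r * k + c) = of_bool (r = c)" if "r < k" "c < k" for r c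
      using assms(3) cell_less[OF that] that by (simp add: s1(2))
    then show "store s1 ''i'' 0 0 ''z'' 0 = Z div q ^ 0 \<and> holds_matrix (store s1 ''i'' 0 0) (part 0)"
      using s1(1) bounds(7) by (simp add: holds_matrix_def part_def)
  next
    fix j s assume j: "j < k * k * k" "s ''z'' 0 = Z div q ^ j \<and> holds_matrix s (part j)" "s ''i'' 0 = j"
      and fr: "\<And>y. y \<noteq> ''i'' \<Longrightarrow> y \<notin> writes fill_step_com \<Longrightarrow> s y = s1 y"
    have inp: "holds_input s" using inp1 by (rule holds_input_frame) (auto simp: fr writes_sieve_parts)
    have st: "\<forall>p<k. s ''st'' p = digit 3 x p" using assms(2) fr s1(2) by (simp add: writes_sieve_parts)
    have eq: "part (Suc j) = (\<lambda>r c. part j r c + int t * contribution x j r c)"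
      by (simp add: part_def fun_eq_iff algebra_simps)
    from tot_fill_step[OF inp j(1,3) _ st, of "part j"] j(2)
    have "tot V I fill_step_com s 30 (\<lambda>s'. s' ''z'' 0 = Z div q ^ Suc j \<and> holds_matrix s' (part (Suc j)))"
      by (simp add: eq)
    then show "tot V I fill_step_com s 30 (\<lambda>s'. store s' ''i'' 0 (Suc j) ''z'' 0 = Z div q ^ Suc j \<and>
        holds_matrix (store s' ''i'' 0 (Suc j)) (part (Suc j)))"
      by (simp add: holds_matrix_def)
  next
    fix j s assume "\<And>y. y \<noteq> ''i'' \<Longrightarrow> y \<notin> writes fill_step_com \<Longrightarrow> s y = s1 y"
    then have "s ''k'' = s1 ''k''" by (simp add: writes_sieve_parts)
    then show "expr_val (Var ''k'' \<^bold>* Var ''k'' \<^bold>* Var ''k'') s = k * k * k"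
      using holds_inputD[OF inp1] by simp
  next
    fix s assume "s ''z'' 0 = Z div q ^ (k * k * k) \<and> holds_matrix s (part (k * k * k))"
    then show "holds_matrix s (\<lambda>r c. of_bool (r = c) + int t * sieve_entry (digit q Z) x r c)"
      using sum_contribution by (simp add: holds_matrix_def part_def)
  qed (use bounds I in \<open>auto simp: writes_sieve_parts\<close>)
qed auto

end

section \<open>Gaussian elimination modulo N and the signed sum\<close>

context sieve_machine
begin

text \<open>The error is divisible by \<open>t\<close> at the start and gains at least one power per
  round; \<open>n + 1\<close> rounds reach \<open>t ^ (n + 2) = N\<close>.\<close>

lemma tot_inverse:
  assumes "holds_input m" "m ''p'' 0 = p" "p < k" "m ''A'' (p * k + p) = X" "int t dvd 1 - int X"
  shows "tot V I inverse_com m (5 * n + 10) (\<lambda>s. [int (s ''y'' 0) * int X = 1] (mod int N))"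
  unfolding inverse_com_def
proof (rule tot_Seq)
  show "tot V I (Set ''y'' (Const 1)) m 1 (\<lambda>s. s ''y'' 0 = 1)" using I V by (intro tot_wp) auto
next
  let ?body = "Set ''y'' (Var ''y'' \<^bold>* ((Const 2 \<^bold>+ Var ''N'') \<^bold>- (pivot_expr \<^bold>* Var ''y'' \<^bold>mod Var ''N'')) \<^bold>mod Var ''N'')"
  fix s1 assume s1: "s1 ''y'' 0 = 1" "\<And>z. z \<notin> writes (Set ''y'' (Const 1)) \<Longrightarrow> s1 z = m z"
  note inp = holds_inputD[OF assms(1)]
  show "tot V I (For ''i'' (Var ''n'' \<^bold>+ Const 1) ?body) s1 ((n + 1) * (1 + 4) + 3)
     (\<lambda>s. [int (s ''y'' 0) * int X = 1] (mod int N))"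
  proof (rule tot_For[where P = "\<lambda>j s. int t ^ Suc j dvd 1 - int X * int (s ''y'' 0)"])
    show "int t ^ Suc 0 dvd 1 - int X * int (store s1 ''i'' 0 0 ''y'' 0)" using s1(1) assms(5) by simp
  next
    fix j s assume j: "j < n + 1" "int t ^ Suc j dvd 1 - int X * int (s ''y'' 0)"
      and fr: "\<And>z. z \<noteq> ''i'' \<Longrightarrow> z \<notin> writes ?body \<Longrightarrow> s z = s1 z"
    have s: "s ''N'' 0 = N" "s ''A'' (p * k + p) = X" "s ''p'' 0 = p" "s ''k'' 0 = k"
      using fr s1(2) inp assms by auto
    define y where "y = s ''y'' 0"
    define y' where "y' = y * ((2 + N) - (X * y mod N)) mod N"
    have y': "y' < V" using bounds(8) N_lt by (simp add: y'_def less_trans[OF mod_less_divisor])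
    have "X * y mod N \<le> 2 + N" using bounds(8) by (meson mod_less_divisor less_imp_le trans_le_add2)
    then have "int y' = (int y * (2 + int N - (int X * int y mod int N))) mod int N"
      by (simp add: y'_def zmod_int of_nat_diff)
    then have "[int y' = int y * (2 + int N - (int X * int y mod int N))] (mod int N)"
      by (simp add: cong_def)
    also have "[int y * (2 + int N - (int X * int y mod int N)) = int y * (2 + 0 - int X * int y)] (mod int N)"
      by (intro cong_mult cong_diff cong_add cong_refl) (simp_all add: cong_def)
    finally have "int N dvd int y * (2 - int X * int y) - int y'"
      by (simp add: cong_iff_dvd_diff dvd_diff_commute)
    \<comment> \<open>The reduction modulo \<open>N\<close> is invisible at the precision attained
      so far.\<close>
    moreover have "int t ^ Suc (Suc j) dvd int N" unfolding N_def of_nat_power using j(1) by (intro le_imp_power_dvd) simp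
    ultimately have "int t ^ Suc (Suc j) dvd int X * (int y * (2 - int X * int y) - int y')"
      by (meson dvd_mult dvd_trans)
    moreover have "int t ^ Suc (Suc j) dvd 1 - int X * (int y * (2 - int X * int y))"
      using Newton_inverse_step[OF j(2)] t by (simp add: y_def)
    ultimately have "int t ^ Suc (Suc j) dvd (1 - int X * (int y * (2 - int X * int y))) + int X * (int y * (2 - int X * int y) - int y')"
      by (rule dvd_add[rotated])
    then have "int t ^ Suc (Suc j) dvd 1 - int X * int y'" by (simp add: algebra_simps)
    then show "tot V I ?body s 1 (\<lambda>s'. int t ^ Suc (Suc j) dvd 1 - int X * int (store s' ''i'' 0 (Suc j) ''y'' 0))"
      using y' I by (intro tot_wp) (auto simp: s pivot_expr_def y'_def y_def)
  next
    fix s assume "int t ^ Suc (n + 1) dvd 1 - int X * int (s ''y'' 0)"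
    then have "int N dvd 1 - int X * int (s ''y'' 0)" by (simp add: N_def)
    then have "[1 = int X * int (s ''y'' 0)] (mod int N)" by (simp add: cong_iff_dvd_diff)
    then show "[int (s ''y'' 0) * int X = 1] (mod int N)" by (simp add: cong_sym_eq mult.commute)
  qed (use s1 inp bounds I in auto)
qed simp

text \<open>Updating in place is safe because the new entries depend only on themselves and on row
  and column \<open>p\<close>, which this pass leaves unchanged.\<close>

lemma tot_schur:
  assumes "holds_input m" "m ''p'' 0 = p" "p < k" "m ''y'' 0 = y" "m ''A'' = A0" "\<And>r c. r < k \<Longrightarrow> c < k \<Longrightarrow> A0 (r * k + c) < N"
  shows "tot V I schur_com m (24 * (k * k) + 3) (\<lambda>s. \<forall>r<k. \<forall>c<k. s ''A'' (r * k + c) < N \<and>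
     (if p < r \<and> p < c then [int (s ''A'' (r * k + c)) = int (A0 (r * k + c)) - int (A0 (r * k + p)) * int y * int (A0 (p * k + c))] (mod int N)
      else s ''A'' (r * k + c) = A0 (r * k + c)))"
  unfolding schur_com_def
proof (rule tot_For)
  define nv where "nv i = (A0 i + (N - (A0 ((i div k) * k + p) * y * A0 (p * k + i mod k) mod N))) mod N" for i
  define P where "P j s \<longleftrightarrow> (\<forall>i<k * k. s ''A'' i = (if i < j \<and> p < i div k \<and> p < i mod k then nv i else A0 i))" for j and s :: memory
  note inp = holds_inputD[OF assms(1)]
  show "P 0 (store m ''i'' 0 0)" by (simp add: P_def assms(5))
  show "tot V I schur_step_com s 20 (\<lambda>s'. P (Suc j) (store s' ''i'' 0 (Suc j)))"
    if j: "j < k * k" and P: "P j s" and i: "s ''i'' 0 = j" and fr: "\<And>x. x \<noteq> ''i'' \<Longrightarrow> x \<notin> writes schur_step_com \<Longrightarrow> s x = m x"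
    for j s
  proof (rule tot_wp)
    have s: "s ''k'' 0 = k" "s ''p'' 0 = p" "s ''y'' 0 = y" "s ''N'' 0 = N"
      using fr inp assms(2,4) by (simp_all add: writes_sieve_parts)
    have dm: "j div k < k" "j mod k < k" using index_div_mod_less[OF j] by auto
    have A: "s ''A'' j = A0 j" "s ''A'' ((j div k) * k + p) = A0 ((j div k) * k + p)" "s ''A'' (p * k + j mod k) = A0 (p * k + j mod k)"
      using P j cell_less[OF dm(1) assms(3)] cell_less[OF assms(3) dm(2)] assms(3) dm k_pos unfolding P_def by auto
    have nv: "nv j < V" using bounds(8) N_lt by (simp add: nv_def less_trans[OF mod_less_divisor])
    have jI: "j < I" using j bounds(5) by simp
    show "wp V I schur_step_com (\<lambda>s'. P (Suc j) (store s' ''i'' 0 (Suc j))) s"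
    proof (cases "p < j div k \<and> p < j mod k")
      case False
      then have "P (Suc j) (store s ''i'' 0 (Suc j))" using P unfolding P_def by (auto simp: less_Suc_eq)
      then show ?thesis using False by (simp add: schur_step_com_def s i)
    next
      case True
      have "P (Suc j) (store (store s ''A'' j (nv j)) ''i'' 0 (Suc j))"
        using P True unfolding P_def by (auto simp: less_Suc_eq)
      then show ?thesis using True nv jI by (simp add: schur_step_com_def s i A) (simp add: nv_def)
    qed
  qed (simp add: schur_step_com_def)
  show "expr_val (Var ''k'' \<^bold>* Var ''k'') s = k * k"
    if "\<And>x. x \<noteq> ''i'' \<Longrightarrow> x \<notin> writes schur_step_com \<Longrightarrow> s x = m x" for s
    using that inp by (simp add: writes_sieve_parts)
  show "\<forall>r<k. \<forall>c<k. s ''A'' (r * k + c) < N \<and>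
     (if p < r \<and> p < c then [int (s ''A'' (r * k + c)) = int (A0 (r * k + c)) - int (A0 (r * k + p)) * int y * int (A0 (p * k + c))] (mod int N)
      else s ''A'' (r * k + c) = A0 (r * k + c))" if "P (k * k) s" for s
  proof (intro allI impI)
    fix r c assume rc: "r < k" "c < k"
    have dm: "(r * k + c) div k = r" "(r * k + c) mod k = c" using rc by auto
    have eq: "s ''A'' (r * k + c) = (if p < r \<and> p < c then nv (r * k + c) else A0 (r * k + c))"
      using that cell_less[OF rc] rc unfolding P_def by (simp add: dm)
    show "s ''A'' (r * k + c) < N \<and>
     (if p < r \<and> p < c then [int (s ''A'' (r * k + c)) = int (A0 (r * k + c)) - int (A0 (r * k + p)) * int y * int (A0 (p * k + c))] (mod int N)
      else s ''A'' (r * k + c) = A0 (r * k + c))"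
    proof (cases "p < r \<and> p < c")
      case False
      then show ?thesis using eq assms(6)[OF rc] by auto
    next
      case True
      define w where "w = A0 (r * k + p) * y * A0 (p * k + c)"
      have "w mod N \<le> N" using bounds(8) by (simp add: less_imp_le)
      then have "int (nv (r * k + c)) = (int (A0 (r * k + c)) + (int N - int w mod int N)) mod int N"
        unfolding nv_def dm w_def[symmetric] by (simp only: zmod_int of_nat_add of_nat_diff)
      then have "[int (nv (r * k + c)) = int (A0 (r * k + c)) + (int N - int w mod int N)] (mod int N)"
        by (simp add: cong_def)
      also have "[int (A0 (r * k + c)) + (int N - int w mod int N) = int (A0 (r * k + c)) + (0 - int w)] (mod int N)"
        by (intro cong_add cong_diff cong_refl) (simp_all add: cong_def)
      finally have "[int (nv (r * k + c)) = int (A0 (r * k + c)) - int w] (mod int N)" by simp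
      moreover have "nv (r * k + c) < N" using bounds(8) by (simp add: nv_def)
      ultimately show ?thesis using True eq by (simp add: w_def)
    qed
  qed
qed (use bounds I in \<open>auto simp: writes_sieve_parts\<close>)

text \<open>That the trailing block is the identity modulo \<open>t\<close> makes the next pivot
  invertible. The final clause moves the determinant from the shrinking block into
  \<open>''g''\<close>.\<close>

definition elim_inv :: "int \<Rightarrow> nat \<Rightarrow> memory \<Rightarrow> bool" where
  "elim_inv D p s \<longleftrightarrow> (\<forall>r<k. \<forall>c<k. s ''A'' (r * k + c) < N) \<and>
     (\<forall>r<k. \<forall>c<k. p \<le> r \<longrightarrow> p \<le> c \<longrightarrow> [int (s ''A'' (r * k + c)) = of_bool (r = c)] (mod int t)) \<and>
     s ''g'' 0 \<le> N \<and>
     [int (s ''g'' 0) * det_fun (k - p) (\<lambda>i j. int (s ''A'' ((p + i) * k + (p + j)))) = D] (mod int N)"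

lemma tot_elimination_step:
  assumes "holds_input m" "m ''p'' 0 = p" "p < k" "elim_inv D p m"
  shows "tot V I (inverse_com ;; Set ''g'' (Var ''g'' \<^bold>* pivot_expr \<^bold>mod Var ''N'') ;; schur_com) m
    (5 * n + 24 * (k * k) + 16) (elim_inv D (Suc p))"
proof (rule tot_Seq)
  define A0 where "A0 = m ''A''"
  define X where "X = A0 (p * k + p)"
  have A0: "A0 (r * k + c) < N" if "r < k" "c < k" for r c using assms(4) that by (simp add: elim_inv_def A0_def)
  have At: "[int (A0 (r * k + c)) = of_bool (r = c)] (mod int t)" if "r < k" "c < k" "p \<le> r" "p \<le> c" for r c
    using assms(4) that by (simp add: elim_inv_def A0_def)
  have "[int X = 1] (mod int t)" using At[of p p] assms(3) by (simp add: X_def)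
  then have Xt: "int t dvd 1 - int X" by (simp add: cong_iff_dvd_diff dvd_diff_commute)
  show "tot V I inverse_com m (5 * n + 10) (\<lambda>s. [int (s ''y'' 0) * int X = 1] (mod int N))"
    using tot_inverse[OF assms(1-3) _ Xt] by (simp add: X_def A0_def)
  fix s1 assume s1: "[int (s1 ''y'' 0) * int X = 1] (mod int N)" "\<And>z. z \<notin> writes inverse_com \<Longrightarrow> s1 z = m z"
  define y where "y = s1 ''y'' 0"
  have fr1: "s1 ''A'' = A0" "s1 ''p'' 0 = p" "s1 ''g'' = m ''g''" using s1(2) assms(2) by (auto simp: writes_sieve_parts A0_def)
  have inp1: "holds_input s1" using assms(1) by (rule holds_input_frame) (auto simp: s1(2) writes_sieve_parts)
  define g' where "g' = m ''g'' 0 * X mod N"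
  have g': "g' < N" "g' < V" "[int g' = int (m ''g'' 0) * int X] (mod int N)"
    using bounds(8) N_lt by (auto simp: g'_def zmod_int cong_def intro: less_trans[OF mod_less_divisor])
  show "tot V I (Set ''g'' (Var ''g'' \<^bold>* pivot_expr \<^bold>mod Var ''N'') ;; schur_com) s1 (24 * (k * k) + 5) (elim_inv D (Suc p))"
  proof (rule tot_Seq)
    show "tot V I (Set ''g'' (Var ''g'' \<^bold>* pivot_expr \<^bold>mod Var ''N'')) s1 1 (\<lambda>s. s ''g'' 0 = g')"
      using I g'(2) holds_inputD[OF inp1] fr1 by (intro tot_wp) (auto simp: pivot_expr_def g'_def X_def)
    fix s2 assume s2: "s2 ''g'' 0 = g'" "\<And>z. z \<notin> writes (Set ''g'' (Var ''g'' \<^bold>* pivot_expr \<^bold>mod Var ''N'')) \<Longrightarrow> s2 z = s1 z"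
    have fr2: "s2 ''A'' = A0" "s2 ''p'' 0 = p" "s2 ''y'' 0 = y" using s2(2) fr1 by (auto simp: y_def)
    have inp2: "holds_input s2" using inp1 by (rule holds_input_frame) (auto simp: s2(2))
    show "tot V I schur_com s2 (24 * (k * k) + 3) (elim_inv D (Suc p))"
    proof (rule tot_mono[OF tot_schur[OF inp2 fr2(2) assms(3) fr2(3,1) A0] order_refl])
      fix s3 assume A3: "\<forall>r<k. \<forall>c<k. s3 ''A'' (r * k + c) < N \<and>
         (if p < r \<and> p < c then [int (s3 ''A'' (r * k + c)) = int (A0 (r * k + c)) - int (A0 (r * k + p)) * int y * int (A0 (p * k + c))] (mod int N)
          else s3 ''A'' (r * k + c) = A0 (r * k + c))"
        and fr3: "\<And>x. x \<notin> writes schur_com \<Longrightarrow> s3 x = s2 x"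
      have g3: "s3 ''g'' 0 = g'" using fr3 s2(1) by (simp add: writes_sieve_parts)
      let ?M = "\<lambda>r c. int (A0 (r * k + c))"
      let ?M' = "\<lambda>r c. int (s3 ''A'' (r * k + c))"
      have M': "[?M' r c = ?M r c - ?M r p * int y * ?M p c] (mod int N)" if "p < r" "r < k" "p < c" "c < k" for r c
        using A3 that by auto
      have 1: "[?M' r c = of_bool (r = c)] (mod int t)" if "r < k" "c < k" "Suc p \<le> r" "Suc p \<le> c" for r c
      proof -
        have "[?M' r c = ?M r c - ?M r p * int y * ?M p c] (mod int t)"
          using M'[of r c] that t_dvd_N by (auto intro: cong_dvd_modulus)
        \<comment> \<open>The entries of column \<open>p\<close> below the pivot are 0 modulo
          \<open>t\<close>, so the update is invisible modulo \<open>t\<close>.\<close>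
        also have "[?M r c - ?M r p * int y * ?M p c = of_bool (r = c) - 0 * int y * ?M p c] (mod int t)"
          using At[of r c] At[of r p] that assms(3) by (intro cong_diff cong_mult cong_refl) auto
        finally show ?thesis by simp
      qed
      have "[det_fun (k - p) (\<lambda>i j. ?M (p + i) (p + j)) = ?M p p * det_fun (k - Suc p) (\<lambda>i j. ?M' (Suc p + i) (Suc p + j))] (mod int N)"
        using s1(1) M' assms(3) by (intro det_fun_eliminate[where y = "int y"]) (auto simp: X_def y_def)
      then have "[int (m ''g'' 0) * det_fun (k - p) (\<lambda>i j. ?M (p + i) (p + j)) =
          int (m ''g'' 0) * (int X * det_fun (k - Suc p) (\<lambda>i j. ?M' (Suc p + i) (Suc p + j)))] (mod int N)"
        unfolding X_def by (intro cong_mult cong_refl)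
      moreover have "[int (m ''g'' 0) * det_fun (k - p) (\<lambda>i j. ?M (p + i) (p + j)) = D] (mod int N)"
        using assms(4) by (simp add: elim_inv_def A0_def)
      moreover have "[int g' * det_fun (k - Suc p) (\<lambda>i j. ?M' (Suc p + i) (Suc p + j)) =
         int (m ''g'' 0) * int X * det_fun (k - Suc p) (\<lambda>i j. ?M' (Suc p + i) (Suc p + j))] (mod int N)"
        using g'(3) by (intro cong_mult cong_refl)
      ultimately have "[int g' * det_fun (k - Suc p) (\<lambda>i j. ?M' (Suc p + i) (Suc p + j)) = D] (mod int N)"
        by (metis (no_types, lifting) cong_sym cong_trans mult.assoc)
      with 1 A3 g3 g'(1) show "elim_inv D (Suc p) s3" unfolding elim_inv_def by auto
    qed
  qed simp
qed simp

lemma tot_elimination: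
  assumes "holds_input m" "elim_inv D 0 m"
  shows "tot V I elimination_com m (k * (5 * n + 24 * (k * k) + 20) + 3)
     (\<lambda>s. s ''g'' 0 \<le> N \<and> [int (s ''g'' 0) = D] (mod int N))"
  unfolding elimination_com_def
proof (rule tot_For[where P = "elim_inv D"])
  let ?body = "inverse_com ;; Set ''g'' (Var ''g'' \<^bold>* pivot_expr \<^bold>mod Var ''N'') ;; schur_com"
  show "elim_inv D 0 (store m ''p'' 0 0)" using assms(2) by (simp add: elim_inv_def)
  fix j s assume j: "j < k" "elim_inv D j s" "s ''p'' 0 = j"
    and fr: "\<And>x. x \<noteq> ''p'' \<Longrightarrow> x \<notin> writes ?body \<Longrightarrow> s x = m x"
  have "holds_input s" using assms(1) by (rule holds_input_frame) (auto simp: fr writes_sieve_parts)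
  have store: "elim_inv D i (store s' ''p'' 0 v) = elim_inv D i s'" for i v s' by (simp add: elim_inv_def)
  from tot_elimination_step[OF \<open>holds_input s\<close> j(3,1,2)]
  show "tot V I ?body s (5 * n + 24 * (k * k) + 16) (\<lambda>s'. elim_inv D (Suc j) (store s' ''p'' 0 (Suc j)))"
    by (simp only: store)
next
  fix j s assume "\<And>x. x \<noteq> ''p'' \<Longrightarrow> x \<notin> writes (inverse_com ;; Set ''g'' (Var ''g'' \<^bold>* pivot_expr \<^bold>mod Var ''N'') ;; schur_com) \<Longrightarrow> s x = m x"
  then show "expr_val (Var ''k'') s = k" using holds_inputD[OF assms(1)] by (simp add: writes_sieve_parts)
next
  \<comment> \<open>The trailing block is now empty and has determinant 1.\<close>
  fix s assume "elim_inv D k s"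
  then show "s ''g'' 0 \<le> N \<and> [int (s ''g'' 0) = D] (mod int N)"
    by (simp add: elim_inv_def det_fun_def)
qed (use bounds I in \<open>auto simp: writes_sieve_parts algebra_simps\<close>)

definition summand :: "nat \<Rightarrow> int" where
  "summand x = sieve_sign k x * det_fun k (\<lambda>i j. of_bool (i = j) + int t * sieve_entry (digit q Z) x i j)"

definition summand_time :: nat where
  "summand_time = 14 * k + 5 * (k * k) + 34 * (k * k * k) + k * (5 * n + 24 * (k * k) + 20) + 30"

lemma tot_summand:
  assumes "holds_input m" "m ''x'' 0 = x" "x < 3 ^ k" "m ''acc'' 0 < N" "[int (m ''acc'' 0) = S] (mod int N)"
  shows "tot V I summand_com m summand_time (\<lambda>s. s ''acc'' 0 < N \<and> [int (s ''acc'' 0) = S + summand x] (mod int N))"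
  unfolding summand_com_def
proof (rule tot_Seq[OF tot_state[OF assms(1-3)]])
  let ?Q = "\<lambda>s. s ''acc'' 0 < N \<and> [int (s ''acc'' 0) = S + summand x] (mod int N)"
  let ?last = "Set ''acc'' ((Var ''acc'' \<^bold>+ Var ''g'') \<^bold>mod Var ''N'')"
  fix s1 assume s1: "s1 ''g'' 0 \<le> N \<and> [int (s1 ''g'' 0) = sieve_sign k x] (mod int N) \<and> (\<forall>p<k. s1 ''st'' p = digit 3 x p)"
    and fr1: "\<And>z. z \<notin> writes state_com \<Longrightarrow> s1 z = m z"
  have inp1: "holds_input s1" using assms(1) by (rule holds_input_frame) (auto simp: fr1 writes_sieve_parts)
  show "tot V I (identity_com ;; fill_com ;; elimination_com ;; ?last) s1
     (5 * (k * k) + 34 * (k * k * k) + k * (5 * n + 24 * (k * k) + 20) + 20) ?Q"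
  proof (rule tot_Seq[OF tot_identity[OF inp1]])
    fix s2 assume s2: "\<forall>i<k * k. s2 ''A'' i = of_bool (i div k = i mod k)"
      and fr2: "\<And>z. z \<notin> writes identity_com \<Longrightarrow> s2 z = s1 z"
    have inp2: "holds_input s2" using inp1 by (rule holds_input_frame) (auto simp: fr2 writes_sieve_parts)
    have st2: "\<forall>p<k. s2 ''st'' p = digit 3 x p" using s1 by (simp add: fr2 writes_sieve_parts)
    show "tot V I (fill_com ;; elimination_com ;; ?last) s2
      (34 * (k * k * k) + k * (5 * n + 24 * (k * k) + 20) + 15) ?Q"
    proof (rule tot_Seq[OF tot_fill[OF inp2 st2 s2]])
      let ?M = "\<lambda>r c. of_bool (r = c) + int t * sieve_entry (digit q Z) x r c"
      fix s3 assume s3: "holds_matrix s3 ?M" and fr3: "\<And>z. z \<notin> writes fill_com \<Longrightarrow> s3 z = s2 z"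
      have inp3: "holds_input s3" using inp2 by (rule holds_input_frame) (auto simp: fr3 writes_sieve_parts)
      have g3: "s3 ''g'' 0 \<le> N" "[int (s3 ''g'' 0) = sieve_sign k x] (mod int N)"
        using s1 by (simp_all add: fr2 fr3 writes_sieve_parts)
      \<comment> \<open>\<open>''g''\<close> enters with the sieve sign, so the product with all
        pivots is the signed determinant.\<close>
      have "elim_inv (summand x) 0 s3"
        unfolding elim_inv_def
      proof (intro conjI allI impI)
        fix r c assume rc: "r < k" "c < k"
        show "s3 ''A'' (r * k + c) < N" using s3 rc by (simp add: holds_matrix_def)
        have "[int (s3 ''A'' (r * k + c)) = ?M r c] (mod int N)"
          using s3 rc by (simp add: holds_matrix_def)
        then have "[int (s3 ''A'' (r * k + c)) = ?M r c] (mod int t)"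
          by (rule cong_dvd_modulus[OF _ t_dvd_N])
        also have "[?M r c = of_bool (r = c)] (mod int t)" by (simp add: cong_def)
        finally show "[int (s3 ''A'' (r * k + c)) = of_bool (r = c)] (mod int t)" .
      next
        have "[det_fun k (\<lambda>i j. int (s3 ''A'' (i * k + j))) = det_fun k ?M] (mod int N)"
          using s3 by (intro det_fun_cong_mod) (simp add: holds_matrix_def)
        then show "[int (s3 ''g'' 0) * det_fun (k - 0) (\<lambda>i j. int (s3 ''A'' ((0 + i) * k + (0 + j)))) = summand x] (mod int N)"
          unfolding summand_def using g3(2) by (auto intro: cong_mult)
      qed (use g3 in simp)
      note elim = tot_elimination[OF inp3 this]
      show "tot V I (elimination_com ;; ?last) s3 (k * (5 * n + 24 * (k * k) + 20) + 8) ?Q"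
      proof (rule tot_Seq[OF elim])
        fix s4 assume s4: "s4 ''g'' 0 \<le> N \<and> [int (s4 ''g'' 0) = summand x] (mod int N)"
          and fr4: "\<And>z. z \<notin> writes elimination_com \<Longrightarrow> s4 z = s3 z"
        have inp4: "holds_input s4" using inp3 by (rule holds_input_frame) (auto simp: fr4 writes_sieve_parts)
        have acc4: "s4 ''acc'' = m ''acc''" by (simp add: fr1 fr2 fr3 fr4 writes_sieve_parts)
        define r where "r = (m ''acc'' 0 + s4 ''g'' 0) mod N"
        have "[int (m ''acc'' 0) + int (s4 ''g'' 0) = S + summand x] (mod int N)"
          using assms(5) s4 by (intro cong_add) auto
        then have "[int r = S + summand x] (mod int N)" by (simp add: r_def zmod_int cong_def)
        moreover have "r < N" "r < V" using bounds(8) N_lt by (auto simp: r_def intro: less_trans[OF mod_less_divisor])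
        ultimately show "tot V I ?last s4 1 ?Q"
          using holds_inputD[OF inp4] I by (intro tot_wp) (auto simp: acc4 r_def)
      qed simp
    qed simp
  qed simp
qed (simp add: summand_time_def)

lemma summand_sum: "(\<Sum>x<3 ^ k. summand x) = perturbed_poly (int t) (digit q Z)"
  by (simp add: summand_def perturbed_poly_def)

lemma tot_sieve:
  assumes "holds_input m"
  shows "tot V I sieve_com m (3 ^ k * (summand_time + 4) + 10 * k + 30)
    (\<lambda>s. \<exists>acc. s ''out'' 0 = of_bool (t ^ k \<le> 2 * acc \<and> t ^ k \<le> 2 * (N - acc)) \<and> acc < N \<and>
       [int acc = perturbed_poly (int t) (digit q Z)] (mod int N))"
  unfolding sieve_com_def
proof (rule tot_Seq)
  note inp = holds_inputD[OF assms]
  show "tot V I (power_com ''K'' (Const 3) (Var ''k'')) m (5 * k + 5) (\<lambda>s. s ''K'' 0 = 3 ^ k)"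
    using inp bounds I by (intro tot_power_com) auto
  let ?out = "Set ''out'' ((Var ''T'' \<^bold>\<le> Const 2 \<^bold>* Var ''acc'') \<^bold>* (Var ''T'' \<^bold>\<le> Const 2 \<^bold>* (Var ''N'' \<^bold>- Var ''acc'')))"
  let ?Q = "\<lambda>s. \<exists>acc. s ''out'' 0 = of_bool (t ^ k \<le> 2 * acc \<and> t ^ k \<le> 2 * (N - acc)) \<and> acc < N \<and>
       [int acc = perturbed_poly (int t) (digit q Z)] (mod int N)"
  fix s1 assume s1: "s1 ''K'' 0 = 3 ^ k" and fr1: "\<And>z. z \<notin> writes (power_com ''K'' (Const 3) (Var ''k'')) \<Longrightarrow> s1 z = m z"
  have inp1: "holds_input s1" using assms by (rule holds_input_frame) (auto simp: fr1)
  have tk: "t ^ k < V"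
  proof -
    have "t ^ k \<le> N" unfolding N_def using t k_le_n by (intro power_increasing) auto
    then show ?thesis using N_lt by simp
  qed
  show "tot V I (power_com ''T'' (Var ''t'') (Var ''k'') ;; Set ''acc'' (Const 0) ;; For ''x'' (Var ''K'') summand_com ;; ?out) s1
     (3 ^ k * (summand_time + 4) + 5 * k + 20) ?Q"
  proof (rule tot_Seq)
    show "tot V I (power_com ''T'' (Var ''t'') (Var ''k'')) s1 (5 * k + 5) (\<lambda>s. s ''T'' 0 = t ^ k)"
      using holds_inputD[OF inp1] bounds I tk t by (intro tot_power_com) auto
    fix s2 assume s2: "s2 ''T'' 0 = t ^ k" and fr2: "\<And>z. z \<notin> writes (power_com ''T'' (Var ''t'') (Var ''k'')) \<Longrightarrow> s2 z = s1 z"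
    have inp2: "holds_input s2" using inp1 by (rule holds_input_frame) (auto simp: fr2)
    have K2: "s2 ''K'' 0 = 3 ^ k" using s1 by (simp add: fr2)
    show "tot V I (Set ''acc'' (Const 0) ;; For ''x'' (Var ''K'') summand_com ;; ?out) s2
       (3 ^ k * (summand_time + 4) + 10) ?Q"
    proof (rule tot_Seq)
      show "tot V I (Set ''acc'' (Const 0)) s2 1 (\<lambda>s. s ''acc'' 0 = 0)" using I V by (intro tot_wp) auto
      fix s3 assume s3: "s3 ''acc'' 0 = 0" and fr3: "\<And>z. z \<notin> writes (Set ''acc'' (Const 0)) \<Longrightarrow> s3 z = s2 z"
      have inp3: "holds_input s3" using inp2 by (rule holds_input_frame) (auto simp: fr3)
      have K3: "s3 ''K'' 0 = 3 ^ k" "s3 ''T'' 0 = t ^ k" using K2 s2 by (simp_all add: fr3)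
      show "tot V I (For ''x'' (Var ''K'') summand_com ;; ?out) s3 (3 ^ k * (summand_time + 4) + 5) ?Q"
      proof (rule tot_Seq)
        show "tot V I (For ''x'' (Var ''K'') summand_com) s3 (3 ^ k * (summand_time + 4) + 3)
          (\<lambda>s. s ''acc'' 0 < N \<and> [int (s ''acc'' 0) = (\<Sum>x<3 ^ k. summand x)] (mod int N))"
        proof (rule tot_For[where P = "\<lambda>j s. s ''acc'' 0 < N \<and> [int (s ''acc'' 0) = (\<Sum>x<j. summand x)] (mod int N)"])
          fix j s assume j: "j < 3 ^ k" "s ''acc'' 0 < N \<and> [int (s ''acc'' 0) = (\<Sum>x<j. summand x)] (mod int N)" "s ''x'' 0 = j"
            and fr: "\<And>y. y \<noteq> ''x'' \<Longrightarrow> y \<notin> writes summand_com \<Longrightarrow> s y = s3 y"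
          have inp: "holds_input s" using inp3 by (rule holds_input_frame) (auto simp: fr writes_sieve_parts)
          from tot_summand[OF inp j(3,1)] j(2)
          have "tot V I summand_com s summand_time (\<lambda>s'. s' ''acc'' 0 < N \<and> [int (s' ''acc'' 0) = (\<Sum>x<Suc j. summand x)] (mod int N))"
            by simp
          then show "tot V I summand_com s summand_time (\<lambda>s'. store s' ''x'' 0 (Suc j) ''acc'' 0 < N \<and>
             [int (store s' ''x'' 0 (Suc j) ''acc'' 0) = (\<Sum>x<Suc j. summand x)] (mod int N))"
            by simp
        next
          fix j s assume fr: "\<And>y. y \<noteq> ''x'' \<Longrightarrow> y \<notin> writes summand_com \<Longrightarrow> s y = s3 y"
          show "expr_val (Var ''K'') s = 3 ^ k" using K3 by (simp add: fr writes_sieve_parts)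
        qed (use s3 bounds I in \<open>auto simp: writes_sieve_parts\<close>)
        fix s4 assume s4: "s4 ''acc'' 0 < N \<and> [int (s4 ''acc'' 0) = (\<Sum>x<3 ^ k. summand x)] (mod int N)"
          and fr4: "\<And>z. z \<notin> writes (For ''x'' (Var ''K'') summand_com) \<Longrightarrow> s4 z = s3 z"
        have inp4: "holds_input s4" using inp3 by (rule holds_input_frame) (auto simp: fr4 writes_sieve_parts)
        have T4: "s4 ''T'' 0 = t ^ k" using K3 by (simp add: fr4 writes_sieve_parts)
        show "tot V I ?out s4 1 ?Q"
        proof (rule tot_wp)
          show "wp V I ?out ?Q s4"
            using s4 holds_inputD[OF inp4] T4 I V by (auto simp: summand_sum less_Suc_eq_le intro!: exI[of _ "s4 ''acc'' 0"])
        qed simp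
      qed simp
    qed simp
  qed simp
qed simp

end

subsection \<open>The deterministic part\<close>

text \<open>Weights below \<open>2 ^ n\<close> give the error bound; the exponent of
  \<open>t\<close> is explained by \<open>leading_bound\<close>.\<close>

definition params_com :: com where
  "params_com = (power_com ''t'' (Const 2) (Const 4 \<^bold>* ((Var ''n'' \<^bold>+ Const 1) \<^bold>* (Var ''n'' \<^bold>+ Const 1))) ;;
    power_com ''N'' (Var ''t'') (Var ''n'' \<^bold>+ Const 2) ;; power_com ''q'' (Const 2) (Var ''n''))"

definition decide_com :: com where
  "decide_com = (params_com ;; cover_com ;; collect_com ;;
    Cond (Op Less (Const 0) (Var ''k'') \<^bold>* (Var ''a'' \<^bold>\<le> Var ''k'')) sieve_com (Set ''out'' (Const 0)))"

definition rest_vertices :: "(nat \<Rightarrow> nat \<Rightarrow> bool) \<Rightarrow> nat \<Rightarrow> nat list" where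
  "rest_vertices E n = filter (\<lambda>v. v \<notin> set (found_cover E n)) [0..<n]"

text \<open>The answer as a function of the random number \<open>Z\<close> alone, so that
  probabilities become cardinalities.\<close>

definition verdict :: "(nat \<Rightarrow> nat \<Rightarrow> bool) \<Rightarrow> nat \<Rightarrow> nat \<Rightarrow> bool" where
  "verdict E n Z \<longleftrightarrow> 0 < length (found_cover E n) \<and> length (rest_vertices E n) \<le> length (found_cover E n) \<and>
     independent_split.sieve_poly (length (found_cover E n)) (length (rest_vertices E n)) E
       ((!) (found_cover E n)) ((!) (rest_vertices E n)) (digit (2 ^ n) Z) \<noteq> 0"

lemma nth_image_set: "(!) xs ` {..<length xs} = set xs"
  by (auto simp: set_conv_nth)

lemma found_cover_within:
  assumes "\<forall>u v. E u v \<longrightarrow> u < n \<and> v < n"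
  shows "distinct (found_cover E n)" "set (found_cover E n) \<subseteq> {..<n}"
    "\<And>u v. E u v \<Longrightarrow> u \<in> set (found_cover E n) \<or> v \<in> set (found_cover E n)"
  using found_cover[of "{..<n}" E n] assms by blast+

lemma independent_split_found:
  assumes E: "\<And>u v. E u v \<Longrightarrow> u < n \<and> v < n"
    and "0 < length (found_cover E n)" "length (rest_vertices E n) \<le> length (found_cover E n)"
  shows "independent_split n (length (found_cover E n)) (length (rest_vertices E n)) E
    ((!) (found_cover E n)) ((!) (rest_vertices E n))"
proof
  have "\<forall>u v. E u v \<longrightarrow> u < n \<and> v < n" using E by blast
  note fc = found_cover_within[OF this]
  have rest: "set (rest_vertices E n) = {..<n} - set (found_cover E n)" "distinct (rest_vertices E n)"
    by (auto simp: rest_vertices_def)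
  show "inj_on ((!) (found_cover E n)) {..<length (found_cover E n)}" using fc(1) by (intro inj_on_nth) auto
  show "inj_on ((!) (rest_vertices E n)) {..<length (rest_vertices E n)}" using rest(2) by (intro inj_on_nth) auto
  show "(!) (found_cover E n) ` {..<length (found_cover E n)} \<inter> (!) (rest_vertices E n) ` {..<length (rest_vertices E n)} = {}"
    "(!) (found_cover E n) ` {..<length (found_cover E n)} \<union> (!) (rest_vertices E n) ` {..<length (rest_vertices E n)} = {..<n}"
    unfolding nth_image_set rest(1) using fc(2) by auto
  fix r r' assume "r < length (rest_vertices E n)" "r' < length (rest_vertices E n)"
  then have "rest_vertices E n ! r \<notin> set (found_cover E n)" "rest_vertices E n ! r' \<notin> set (found_cover E n)"
    using rest(1) nth_mem by blast+
  then show "\<not> E (rest_vertices E n ! r) (rest_vertices E n ! r')" using fc(3) by blast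
qed fact+

text \<open>A nonzero value forces a nonzero coefficient, whatever the weights; hence there are no
  false positives.\<close>

lemma verdict_sound:
  assumes "\<And>u v. E u v \<Longrightarrow> u < n \<and> v < n" "verdict E n Z"
  shows "0 < n \<and> (\<exists>\<pi>. cyclic_successor n E \<pi>)"
proof -
  have v: "0 < length (found_cover E n)" "length (rest_vertices E n) \<le> length (found_cover E n)"
    using assms(2) by (auto simp: verdict_def)
  interpret independent_split n "length (found_cover E n)" "length (rest_vertices E n)" E
    "(!) (found_cover E n)" "(!) (rest_vertices E n)"
    by (rule independent_split_found[OF assms(1) v])
  have "found_cover E n ! 0 < n" by (rule cv_lt[OF v(1)])
  then have "0 < n" by simp
  moreover have "\<exists>\<pi>. cyclic_successor n E \<pi>"
    using assms(2) by (intro cyclic_successor_if_sieve_poly) (auto simp: verdict_def)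
  ultimately show ?thesis by blast
qed

text \<open>Both early rejections are ruled out by the cycle, and the remaining error is that of a
  root among \<open>n ^ 3\<close> digits.\<close>

lemma verdict_complete:
  assumes E: "\<And>u v. E u v \<Longrightarrow> u < n \<and> v < n" and "0 < n" and \<pi>: "cyclic_successor n E \<pi>"
  shows "2 ^ n * card {Z. Z < (2 ^ n) ^ (n ^ 3) \<and> \<not> verdict E n Z} \<le> n ^ 3 * (2 ^ n) ^ (n ^ 3)"
proof -
  have "\<forall>u v. E u v \<longrightarrow> u < n \<and> v < n" using E by blast
  note fc = found_cover_within[OF this]
  have rest: "set (rest_vertices E n) = {..<n} - set (found_cover E n)" "distinct (rest_vertices E n)"
    by (auto simp: rest_vertices_def)
  have perm: "\<pi> permutes {..<n}" and arc: "\<And>v. v < n \<Longrightarrow> E v (\<pi> v)"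
    using \<pi> by (auto simp: cyclic_successor_def)
  \<comment> \<open>The arc leaving an uncovered vertex must be covered at its head.\<close>
  have "\<pi> ` set (rest_vertices E n) \<subseteq> set (found_cover E n)"
  proof clarify
    fix v assume "v \<in> set (rest_vertices E n)"
    then show "\<pi> v \<in> set (found_cover E n)" using rest(1) fc(3)[OF arc[of v]] by auto
  qed
  then have "card (\<pi> ` set (rest_vertices E n)) \<le> card (set (found_cover E n))" by (intro card_mono) auto
  then have le: "length (rest_vertices E n) \<le> length (found_cover E n)"
    using rest(2) fc(1) card_image[OF inj_on_subset[OF permutes_inj[OF perm] subset_UNIV], of "set (rest_vertices E n)"]
    by (simp add: distinct_card)
  have pos: "0 < length (found_cover E n)"
    using fc(3)[OF arc[OF assms(2)]] by (cases "found_cover E n") auto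
  interpret independent_split n "length (found_cover E n)" "length (rest_vertices E n)" E
    "(!) (found_cover E n)" "(!) (rest_vertices E n)"
    by (rule independent_split_found[OF E pos le])
  have "length (found_cover E n) \<le> n"
    using fc(1,2) card_mono[of "{..<n}" "set (found_cover E n)"] by (simp add: distinct_card)
  then have "length (found_cover E n) ^ 3 \<le> n ^ 3" by (rule power_mono) simp
  from sieve_poly_zeros[OF \<pi> _ this, of "2 ^ n"] show ?thesis
    using pos le by (simp add: verdict_def)
qed

context machine
begin

lemma tot_params:
  assumes "holds_graph m" "(2 ^ (4 * ((n + 1) * (n + 1)))) ^ (n + 2) < V"
  shows "tot V I params_com m (20 * ((n + 1) * (n + 1)) + 10 * n + 30)
    (\<lambda>s. s ''t'' 0 = 2 ^ (4 * ((n + 1) * (n + 1))) \<and> s ''N'' 0 = (2 ^ (4 * ((n + 1) * (n + 1)))) ^ (n + 2) \<and> s ''q'' 0 = 2 ^ n)"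
proof -
  define h where "h = 4 * ((n + 1) * (n + 1))"
  define t :: nat where "t = 2 ^ h"
  have N: "t ^ (n + 2) < V" using assms(2) by (simp only: t_def h_def)
  have t1: "1 \<le> t" by (simp add: t_def)
  have "t \<le> t ^ (n + 2)" using t1 by (intro self_le_power) auto
  then have "t < V" using N by linarith
  then have tV: "2 ^ h < V" by (simp add: t_def)
  have hV: "h < V" using tV less_exp[of h] by linarith
  have nh: "n + 2 \<le> h" by (simp add: h_def)
  have "(2::nat) ^ n \<le> 2 ^ h" using nh by (intro power_increasing) auto
  then have qV: "2 ^ n < V" using tV by linarith
  have n: "m ''n'' 0 = n" using assms(1) by (simp add: holds_graph_def)
  have "tot V I params_com m (5 * h + 10 * n + 30) (\<lambda>s. s ''t'' 0 = t \<and> s ''N'' 0 = t ^ (n + 2) \<and> s ''q'' 0 = 2 ^ n)"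
    unfolding params_com_def
  proof (rule tot_Seq)
    show "tot V I (power_com ''t'' (Const 2) (Const 4 \<^bold>* ((Var ''n'' \<^bold>+ Const 1) \<^bold>* (Var ''n'' \<^bold>+ Const 1)))) m (5 * h + 5) (\<lambda>s. s ''t'' 0 = t)"
      unfolding t_def using tV hV I n by (intro tot_power_com) (auto simp: h_def)
    fix s1 assume s1: "s1 ''t'' 0 = t" and fr1: "\<And>z. z \<notin> writes (power_com ''t'' (Const 2) (Const 4 \<^bold>* ((Var ''n'' \<^bold>+ Const 1) \<^bold>* (Var ''n'' \<^bold>+ Const 1)))) \<Longrightarrow> s1 z = m z"
    have n1: "s1 ''n'' 0 = n" using n by (simp add: fr1)
    show "tot V I (power_com ''N'' (Var ''t'') (Var ''n'' \<^bold>+ Const 2) ;; power_com ''q'' (Const 2) (Var ''n'')) s1 (10 * n + 21)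
       (\<lambda>s. s ''t'' 0 = t \<and> s ''N'' 0 = t ^ (n + 2) \<and> s ''q'' 0 = 2 ^ n)"
    proof (rule tot_Seq)
      show "tot V I (power_com ''N'' (Var ''t'') (Var ''n'' \<^bold>+ Const 2)) s1 (5 * n + 15) (\<lambda>s. s ''N'' 0 = t ^ (n + 2))"
        using N hV nh I t1 n1 s1 by (intro tot_power_com) auto
      fix s2 assume s2: "s2 ''N'' 0 = t ^ (n + 2)" and fr2: "\<And>z. z \<notin> writes (power_com ''N'' (Var ''t'') (Var ''n'' \<^bold>+ Const 2)) \<Longrightarrow> s2 z = s1 z"
      have "tot V I (power_com ''q'' (Const 2) (Var ''n'')) s2 (5 * n + 5) (\<lambda>s. s ''q'' 0 = 2 ^ n)"
        using qV n_lt_V I n1 by (intro tot_power_com) (auto simp: fr2)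
      then show "tot V I (power_com ''q'' (Const 2) (Var ''n'')) s2 (5 * n + 5)
         (\<lambda>s. s ''t'' 0 = t \<and> s ''N'' 0 = t ^ (n + 2) \<and> s ''q'' 0 = 2 ^ n)"
        by (rule tot_mono) (use s1 s2 in \<open>auto simp: fr2\<close>)
    qed simp
  qed simp
  then show ?thesis by (rule tot_mono) (simp_all add: h_def t_def)
qed

text \<open>Estimating each factor by a power of 2 gives the total exponent
  \<open>4 * n * n + 4 * n + 1\<close>, which is less than
  \<open>4 * ((n + 1) * (n + 1))\<close>.\<close>

lemma leading_bound:
  assumes "0 < k" "k \<le> n"
  shows "2 * (3 ^ k * (fact k * (k * (k * k * 2 ^ n + 1) ^ k))) < (2 ^ (4 * ((n + 1) * (n + 1))) :: nat)"
proof -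
  have kn: "k \<le> 2 ^ n" using assms(2) less_exp[of n] by linarith
  have 1: "(3::nat) ^ k \<le> 2 ^ (2 * n)"
  proof -
    have "(3::nat) ^ k \<le> 4 ^ n" using assms(2) by (intro order_trans[OF power_mono[of 3 4 k] power_increasing]) auto
    then show ?thesis by (simp add: power_mult)
  qed
  have 2: "fact k \<le> (2 ^ (n * n) :: nat)"
  proof -
    have "fact k \<le> (k ^ k :: nat)" using fact_le_power[of k, where ?'a = nat] by simp
    also have "\<dots> \<le> (2 ^ n) ^ k" using kn by (rule power_mono) simp
    also have "\<dots> \<le> (2 ^ n) ^ n" using assms(2) by (intro power_increasing) auto
    finally show ?thesis by (simp add: power_mult)
  qed
  have 3: "(k * k * 2 ^ n + 1) ^ k \<le> 2 ^ ((3 * n + 1) * n)"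
  proof -
    have "k * k * 2 ^ n \<le> 2 ^ n * 2 ^ n * 2 ^ n" using kn by (intro mult_mono) auto
    then have "k * k * 2 ^ n \<le> 2 ^ (3 * n)" by (simp flip: power_add add: numeral_3_eq_3 add.assoc)
    moreover have "(1::nat) \<le> 2 ^ (3 * n)" by simp
    ultimately have "k * k * 2 ^ n + 1 \<le> 2 ^ (3 * n) + 2 ^ (3 * n)" by (rule add_mono)
    then have "k * k * 2 ^ n + 1 \<le> 2 ^ (3 * n + 1)" by simp
    then have "(k * k * 2 ^ n + 1) ^ k \<le> (2 ^ (3 * n + 1)) ^ k" by (rule power_mono) simp
    also have "\<dots> \<le> (2 ^ (3 * n + 1)) ^ n" using assms(2) by (intro power_increasing) auto
    finally show ?thesis by (simp only: power_mult)
  qed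
  have "2 * (3 ^ k * (fact k * (k * (k * k * 2 ^ n + 1) ^ k))) \<le> 2 ^ 1 * (2 ^ (2 * n) * (2 ^ (n * n) * (2 ^ n * 2 ^ ((3 * n + 1) * n))))"
    using 1 2 3 kn by (intro mult_mono) auto
  also have "\<dots> = 2 ^ (1 + (2 * n + (n * n + (n + (3 * n + 1) * n))))" by (simp only: power_add)
  also have "\<dots> < (2::nat) ^ (4 * ((n + 1) * (n + 1)))" by (intro power_strict_increasing) (auto simp: algebra_simps)
  finally show ?thesis .
qed

text \<open>The search and the sieve run one after the other, and the cover found has at most
  \<open>c\<close> vertices. So the exponential costs add up instead of multiplying.\<close>

lemma tot_decide:
  assumes "holds_graph m" "m ''Z'' 0 = Z" "Z < V" "n * n * n < V" "(2 ^ (4 * ((n + 1) * (n + 1)))) ^ (n + 2) < V"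
    "\<And>u v. E u v \<Longrightarrow> u < n \<and> v < n" "finite S" "\<And>u v. E u v \<Longrightarrow> u \<in> S \<or> v \<in> S" "card S = c" "c \<le> n"
  shows "tot V I decide_com m (3 ^ c * (500 * (n + 1) ^ 3)) (\<lambda>s. s ''out'' 0 \<noteq> 0 \<longleftrightarrow> verdict E n Z)"
proof -
  define t :: nat where "t = 2 ^ (4 * ((n + 1) * (n + 1)))"
  define N where "N = t ^ (n + 2)"
  define q :: nat where "q = 2 ^ n"
  let ?cs = "found_cover E n" and ?is = "rest_vertices E n"
  define k a where "k = length ?cs" and "a = length ?is"
  have kc: "k \<le> c" using found_cover(3)[of S E n] assms(6-9) by (simp add: k_def)
  \<comment> \<open>The budget of the sieve in units of \<open>3 ^ c * (n + 1) ^ 3\<close>: 136 for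
    the summands, at most 41 for the rest.\<close>
  define T3 where "T3 = 3 ^ c * (180 * (n + 1) ^ 3)"
  let ?Q = "\<lambda>s. s ''out'' 0 \<noteq> 0 \<longleftrightarrow> verdict E n Z"
  let ?last = "Cond (Op Less (Const 0) (Var ''k'') \<^bold>* (Var ''a'' \<^bold>\<le> Var ''k'')) sieve_com (Set ''out'' (Const 0))"
  let ?Tc = "3 ^ c * (24 * (n * n) + 5 * n + 22) + (24 * (n * n) + 5 * n + 40)"
  define M where "M = (n + 1) ^ 3"
  have p3: "1 \<le> (3::nat) ^ c" by simp
  have kn: "k \<le> n" using kc assms(10) by simp
  have M_le: "u * v * w \<le> M" if "u \<le> n + 1" "v \<le> n + 1" "w \<le> n + 1" for u v w
    unfolding M_def power3_eq_cube using that by (intro mult_le_mono)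
  have b: "1 \<le> M" "n \<le> M" "k \<le> M" "n * n \<le> M" "(n + 1) * (n + 1) \<le> M" "k * k \<le> M" "k * k * k \<le> M" "k * n \<le> M"
    using M_le[of 1 1 1] M_le[of n 1 1] M_le[of k 1 1] M_le[of n n 1] M_le[of "n + 1" "n + 1" 1]
      M_le[of k k 1] M_le[of k k k] M_le[of k n 1] kn by simp_all
  define x where "x = 3 ^ c * M"
  have x: "u \<le> r * x" if "u \<le> r * M" for u r
  proof -
    have "1 * (r * M) \<le> 3 ^ c * (r * M)" using p3 by (rule mult_right_mono) simp
    with that have "u \<le> 3 ^ c * (r * M)" by linarith
    then show ?thesis by (simp add: x_def ac_simps)
  qed
  have T3x: "T3 = 180 * x" by (simp add: T3_def M_def x_def)
  have sums: "20 * ((n + 1) * (n + 1)) + 10 * n + 30 + (?Tc + (20 * n + 20 + T3 + 1) + 1) + 1 \<le> 3 ^ c * (500 * (n + 1) ^ 3)"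
  proof -
    have "24 * (n * n) + 5 * n + 22 \<le> 51 * M" using b by linarith
    then have 1: "3 ^ c * (24 * (n * n) + 5 * n + 22) \<le> 3 ^ c * (51 * M)" by (rule mult_left_mono) simp
    have 2: "20 * ((n + 1) * (n + 1)) + 10 * n + 30 + ((24 * (n * n) + 5 * n + 40) + (20 * n + 20 + 1) + 1) + 1 \<le> 174 * x"
      using b by (intro x) linarith
    have "3 ^ c * (51 * M) = 51 * x" "3 ^ c * (500 * (n + 1) ^ 3) = 500 * x" by (simp_all add: x_def M_def)
    with 1 2 T3x show ?thesis by linarith
  qed
  show ?thesis
    unfolding decide_com_def
  proof (rule tot_Seq[OF tot_params[OF assms(1,5)]])
    fix s1 assume s1: "s1 ''t'' 0 = 2 ^ (4 * ((n + 1) * (n + 1))) \<and> s1 ''N'' 0 = (2 ^ (4 * ((n + 1) * (n + 1)))) ^ (n + 2) \<and> s1 ''q'' 0 = 2 ^ n"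
      and fr1: "\<And>x. x \<notin> writes params_com \<Longrightarrow> s1 x = m x"
    have g1: "holds_graph s1" using assms(1) by (simp add: holds_graph_def fr1 params_com_def)
    show "tot V I (cover_com ;; collect_com ;; ?last) s1 (?Tc + (20 * n + 20 + T3 + 1) + 1) ?Q"
    proof (rule tot_Seq[OF tot_cover[OF g1 assms(7-10)]])
      fix s2 assume s2: "holds_cover E n ?cs s2" and fr2: "\<And>x. x \<notin> writes cover_com \<Longrightarrow> s2 x = s1 x"
      have g2: "holds_graph s2" using g1 by (simp add: holds_graph_def fr2 writes_cover_com)
      have n2: "s2 ''n'' 0 = n" using g2 by (simp add: holds_graph_def)
      show "tot V I (collect_com ;; ?last) s2 (20 * n + 20 + T3 + 1) ?Q"
      proof (rule tot_Seq[OF tot_collect[OF n2 s2]])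
        fix s3 assume "let is = filter (\<lambda>v. v \<notin> set ?cs) [0..<n] in s3 ''a'' 0 = length is \<and> (\<forall>r<length is. s3 ''iv'' r = is ! r)"
          and fr3: "\<And>x. x \<notin> writes collect_com \<Longrightarrow> s3 x = s2 x"
        then have s3: "s3 ''a'' 0 = a" "\<And>r. r < a \<Longrightarrow> s3 ''iv'' r = ?is ! r"
          by (simp_all add: rest_vertices_def a_def Let_def)
        have k3: "s3 ''k'' 0 = k" "\<And>p. p < k \<Longrightarrow> s3 ''cv'' p = ?cs ! p"
          using s2 by (simp_all add: holds_cover_def k_def fr3 writes_collect_com)
        have g3: "holds_graph s3" using g2 by (simp add: holds_graph_def fr3 writes_collect_com)
        have p3: "s3 ''t'' 0 = t" "s3 ''N'' 0 = N" "s3 ''q'' 0 = q"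
          using s1 by (simp_all add: fr3 fr2 writes_collect_com writes_cover_com t_def N_def q_def)
        have Z3: "s3 ''Z'' 0 = Z" using assms(2)
          by (simp add: fr3 fr2 fr1 writes_collect_com writes_cover_com params_com_def)
        have T3: "10 * k + 30 + 3 ^ k * X \<le> T3 - 1" if "X \<le> 136 * M" for X
        proof -
          have "10 * k + 31 \<le> 41 * x" using b by (intro x) linarith
          moreover have "3 ^ k * X \<le> 3 ^ c * (136 * M)" using that kc by (intro mult_mono power_increasing) auto
          moreover have "3 ^ c * (136 * M) = 136 * x" by (simp add: x_def)
          ultimately show ?thesis using T3x by linarith
        qed
        show "tot V I ?last s3 T3 ?Q"
        proof (cases "0 < k \<and> a \<le> k")
          case False
          have T: "1 \<le> T3 - 1" using T3[of 0] by simp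
          show ?thesis
          proof (rule tot_Cond)
            show "tot V I (Set ''out'' (Const 0)) s3 (T3 - 1) ?Q"
              using False I V T by (intro tot_wp) (auto simp: verdict_def k_def a_def)
          qed (use False k3 s3 T in auto)
        next
          case True
          then have pos: "0 < length ?cs" "length ?is \<le> length ?cs" by (auto simp: k_def a_def)
          have tk: "2 \<le> t" unfolding t_def by (rule self_le_power[of 2, simplified]) simp
          interpret sieve_machine n V I k a E "(!) ?cs" "(!) ?is" t q Z N
          proof (intro sieve_machine.intro sieve_machine_axioms.intro)
            show "independent_split n k a E ((!) ?cs) ((!) ?is)"
              unfolding k_def a_def by (rule independent_split_found[OF assms(6) pos])
            show "machine n V I" by unfold_locales
            have "q * t = 2 ^ (n + 4 * ((n + 1) * (n + 1)))" by (simp only: q_def t_def power_add)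
            also have "\<dots> \<le> 2 ^ (4 * ((n + 1) * (n + 1)) * (n + 2))" by (intro power_increasing) (auto simp: algebra_simps)
            finally show "q * t \<le> N" by (simp only: N_def t_def power_mult)
          qed (use tk assms(3-5) in \<open>auto simp: q_def N_def t_def\<close>)
          have inp: "holds_input s3"
            using g3 k3 s3 p3 Z3 by (simp add: holds_input_def)
          have Tk: "3 ^ k * (summand_time + 4) + 10 * k + 30 \<le> T3 - 1"
          proof -
            have "k * (5 * n + 24 * (k * k) + 20) = 5 * (k * n) + 24 * (k * k * k) + 20 * k" by (simp add: algebra_simps)
            then have "summand_time + 4 \<le> 136 * M" unfolding summand_time_def using b by linarith
            from T3[OF this] show ?thesis by simp
          qed
          have "tot V I sieve_com s3 (T3 - 1) ?Q"
          proof (rule tot_mono[OF tot_sieve[OF inp] Tk])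
            fix s assume "\<exists>acc. s ''out'' 0 = of_bool (t ^ k \<le> 2 * acc \<and> t ^ k \<le> 2 * (N - acc)) \<and> acc < N \<and>
               [int acc = perturbed_poly (int t) (digit q Z)] (mod int N)"
            then obtain acc where acc: "s ''out'' 0 = of_bool (t ^ k \<le> 2 * acc \<and> t ^ k \<le> 2 * (N - acc))" "acc < N"
               "[int acc = perturbed_poly (int t) (digit q Z)] (mod int N)" by blast
            have dq: "digit q Z j < q" for j by (simp add: digit_def q_def)
            have "t ^ (k + 2) \<le> N" unfolding N_def using tk k_le_n by (intro power_increasing) auto
            from perturbed_poly_mod_threshold[of "digit q Z" q t, OF dq _ acc(3,2) this] leading_bound[of k] True k_le_n
            have "sieve_poly (digit q Z) \<noteq> 0 \<longleftrightarrow> t ^ k \<le> 2 * acc \<and> t ^ k \<le> 2 * (N - acc)"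
              by (simp add: q_def t_def)
            then show "?Q s" using acc(1) pos by (simp add: verdict_def k_def a_def q_def)
          qed
          then show ?thesis using True k3 s3 by (intro tot_Cond[where k = "T3 - 1"]) (use T3[of 0] in auto)
        qed
      qed simp
    qed simp_all
  qed (rule sums)
qed

end

subsection \<open>The random bits\<close>

text \<open>\<open>n ^ 4\<close> flips yield \<open>n ^ 3\<close> digits of \<open>n\<close> bits
  each, assembled into a single number.\<close>

definition random_com :: com where
  "random_com = (Set ''Z'' (Const 0) ;; For ''i'' (Var ''n'' \<^bold>* Var ''n'' \<^bold>* Var ''n'' \<^bold>* Var ''n'')
    (Flip ''f'' (Const 0) ;; Set ''Z'' (Const 2 \<^bold>* Var ''Z'' \<^bold>+ Var ''f'')))"

lemma halts_Flip:
  assumes "bounded_memory L I X m" "0 < L" "finite X" "card X \<le> K" "expr_size e \<le> C" "x \<in> X" "expr_val e m < I"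
  shows "halts (step_bound C L) (space_bound K L I) 1 (Flip x e) m
    (map_pmf (\<lambda>b. store m x (expr_val e m) (of_bool b)) (bernoulli_pmf (1 / 2)))"
proof -
  have "2 ^ 1 \<le> (2::nat) ^ L" using assms(2) by (intro power_increasing) auto
  then have b: "bounded_memory L I X (store m x (expr_val e m) (of_bool b))" for b
    using assms by (intro bounded_memory_store) auto
  have "halts (step_bound C L) (space_bound K L I) (Suc 0) (Flip x e) m
     (bind_pmf (step (Flip x e) m) (\<lambda>(c', m'). return_pmf m'))"
    using expr_cost_step_bound[OF assms(1,2,5)] space_le[OF _ assms(3,4)] assms(1) b
    by (intro halts.move) (auto intro!: halts.halt)
  then show ?thesis by (simp add: map_pmf_def bind_assoc_pmf bind_return_pmf)
qed

text \<open>The coin supplies the leading bit and thereby selects one of the two halves of the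
  range.\<close>

lemma uniform_Suc:
  "bind_pmf (bernoulli_pmf (1 / 2)) (\<lambda>b. map_pmf (\<lambda>r. of_bool b * 2 ^ j + r) (pmf_of_set {..<2 ^ j})) =
   pmf_of_set {..<(2::nat) ^ Suc j}"
proof (rule pmf_eqI)
  fix z :: nat
  have m: "map_pmf (\<lambda>r. c + r) (pmf_of_set {..<2 ^ j}) = pmf_of_set {c..<c + 2 ^ j}" for c :: nat
  proof -
    have "map_pmf (\<lambda>r. c + r) (pmf_of_set {..<2 ^ j}) = pmf_of_set ((\<lambda>r. c + r) ` {..<2 ^ j})"
      by (rule map_pmf_of_set_inj) (auto simp: lessThan_empty_iff)
    then show ?thesis by (simp add: lessThan_atLeast0 add.commute)
  qed
  have ne: "{2 ^ j..<2 ^ j + 2 ^ j} \<noteq> ({} :: nat set)" "{0..<2 ^ j} \<noteq> ({} :: nat set)" "{..<2 ^ Suc j} \<noteq> ({} :: nat set)"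
    by (auto simp: lessThan_empty_iff)
  have "pmf (bind_pmf (bernoulli_pmf (1 / 2)) (\<lambda>b. map_pmf (\<lambda>r. of_bool b * 2 ^ j + r) (pmf_of_set {..<2 ^ j}))) z =
    pmf (pmf_of_set {2 ^ j..<2 ^ j + 2 ^ j}) z * (1 / 2) + pmf (pmf_of_set {0..<2 ^ j}) z * (1 / 2)"
    by (simp only: m pmf_bind) (simp add: field_simps)
  also have "\<dots> = pmf (pmf_of_set {..<2 ^ Suc j}) z"
    unfolding pmf_of_set[OF ne(1) finite_atLeastLessThan] pmf_of_set[OF ne(2) finite_atLeastLessThan]
      pmf_of_set[OF ne(3) finite_lessThan]
    by (auto simp: indicator_def field_simps)
  finally show "pmf (bind_pmf (bernoulli_pmf (1 / 2)) (\<lambda>b. map_pmf (\<lambda>r. of_bool b * 2 ^ j + r) (pmf_of_set {..<2 ^ j}))) z =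
    pmf (pmf_of_set {..<2 ^ Suc j}) z" .
qed

text \<open>Induction on the number \<open>j\<close> of flips to come: the bits drawn so far end up
  shifted by \<open>j\<close> places. Only the distribution of \<open>''Z''\<close> is tracked;
  about the rest of the memory bounds and framing are enough.\<close>

lemma halts_random_loop:
  fixes n L I Kc C :: nat and X :: "string set"
  defines "H \<equiv> halts (step_bound C L) (space_bound Kc L I)"
    and "e \<equiv> Var ''n'' \<^bold>* Var ''n'' \<^bold>* Var ''n'' \<^bold>* Var ''n''"
    and "c \<equiv> Flip ''f'' (Const 0) ;; Set ''Z'' (Const 2 \<^bold>* Var ''Z'' \<^bold>+ Var ''f'')"
    and "K \<equiv> n * n * n * n"
  assumes X: "finite X" "card X \<le> Kc" "{''i'', ''f'', ''Z''} \<subseteq> X" and C: "20 \<le> C" and L: "0 < L" "K \<le> L" and I: "0 < I"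
    and "j \<le> K" "bounded_memory L I X m" "m ''i'' 0 = K - j" "m ''n'' 0 = n" "m ''Z'' 0 < 2 ^ (K - j)"
  shows "\<exists>\<mu>. H (7 * j + 1) (While (Op Less (Var ''i'') e) (c ;; Set ''i'' (Var ''i'' \<^bold>+ Const 1))) m \<mu> \<and>
    map_pmf (\<lambda>s. s ''Z'' 0) \<mu> = map_pmf (\<lambda>r. m ''Z'' 0 * 2 ^ j + r) (pmf_of_set {..<2 ^ j}) \<and>
    (\<forall>s\<in>set_pmf \<mu>. bounded_memory L I X s \<and> (\<forall>x. x \<notin> {''i'', ''f'', ''Z''} \<longrightarrow> s x = m x))"
  using assms(12-)
proof (induction j arbitrary: m)
  let ?inc = "Set ''i'' (Var ''i'' \<^bold>+ Const 1)"
  let ?w = "While (Op Less (Var ''i'') e) (c ;; ?inc)"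
  case 0
  have "big (2 ^ L) I ?w m 1 m" using 0 by (intro big.WhileF) (simp add: e_def K_def)
  then have "H 1 ?w m (return_pmf m) \<and> bounded_memory L I X m"
    unfolding H_def using X C L 0 by (intro halts_big[where X = X]) (auto simp: e_def c_def)
  moreover have "pmf_of_set {..<2 ^ 0} = return_pmf (0::nat)" by (simp add: lessThan_Suc pmf_of_set_singleton)
  ultimately show ?case by (intro exI[of _ "return_pmf m"]) simp
next
  let ?inc = "Set ''i'' (Var ''i'' \<^bold>+ Const 1)"
  let ?w = "While (Op Less (Var ''i'') e) (c ;; ?inc)"
  case (Suc j)
  define z where "z = m ''Z'' 0"
  define i where "i = K - Suc j"
  have i: "K - j = Suc i" "i < K" using Suc.prems(1) by (auto simp: i_def)
  have z: "z < 2 ^ i" using Suc.prems(5) by (simp add: z_def i_def)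
  define mb where "mb b = store m ''f'' 0 (of_bool b)" for b
  define mc where "mc b = store (store (mb b) ''Z'' 0 (2 * z + of_bool b)) ''i'' 0 (Suc i)" for b
  have KL: "(2::nat) ^ K \<le> 2 ^ L" using L(2) by (intro power_increasing) auto
  have "(2::nat) ^ 1 \<le> 2 ^ L" using L(1) by (intro power_increasing) auto
  then have two: "2 \<le> (2::nat) ^ L" by simp
  have iL: "Suc i < 2 ^ L" using i(2) L(2) less_exp[of L] by linarith
  have "2 * z + 1 < 2 ^ Suc i" using z by simp
  also have "(2::nat) ^ Suc i \<le> 2 ^ K" using i by (intro power_increasing) auto
  finally have zL: "2 * z + 1 < 2 ^ L" using KL by linarith
  have bb: "bounded_memory L I X (mb b)" for b
    unfolding mb_def using Suc.prems(2) X I two by (intro bounded_memory_store) auto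
  have bc: "bounded_memory L I X (mc b)" for b
    unfolding mc_def using bb X I zL iL by (intro bounded_memory_store) auto
  have flip: "H 1 (Flip ''f'' (Const 0)) m (map_pmf mb (bernoulli_pmf (1 / 2)))"
  proof -
    have "H 1 (Flip ''f'' (Const 0)) m
      (map_pmf (\<lambda>b. store m ''f'' (expr_val (Const 0) m) (of_bool b)) (bernoulli_pmf (1 / 2)))"
      unfolding H_def using X C I by (intro halts_Flip[OF Suc.prems(2) L(1)]) auto
    then show ?thesis by (simp add: mb_def[abs_def])
  qed
  have set: "H 1 (Set ''Z'' (Const 2 \<^bold>* Var ''Z'' \<^bold>+ Var ''f'')) (mb b) (return_pmf (store (mb b) ''Z'' 0 (2 * z + of_bool b)))" for b
  proof -
    have "big (2 ^ L) I (Set ''Z'' (Const 2 \<^bold>* Var ''Z'' \<^bold>+ Var ''f'')) (mb b) 1 (store (mb b) ''Z'' 0 (2 * z + of_bool b))"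
      using big.Assign[of "Const 0" "mb b" I "Const 2 \<^bold>* Var ''Z'' \<^bold>+ Var ''f''" "2 ^ L" "''Z''"] I zL
      by (auto simp: mb_def z_def)
    then show ?thesis unfolding H_def using X C L bb by (intro conjunct1[OF halts_big[where X = X]]) auto
  qed
  have inc: "H 1 ?inc (store (mb b) ''Z'' 0 (2 * z + of_bool b)) (return_pmf (mc b))" for b
  proof -
    let ?m = "store (mb b) ''Z'' 0 (2 * z + of_bool b)"
    have mi: "?m ''i'' 0 = i" using Suc.prems(3) by (simp add: mb_def i_def)
    have bm: "bounded_memory L I X ?m" using bb X I zL by (intro bounded_memory_store) auto
    have "big (2 ^ L) I ?inc ?m 1 (mc b)"
      using big.Assign[of "Const 0" ?m I "Var ''i'' \<^bold>+ Const 1" "2 ^ L" "''i''"] I iL mi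
      by (simp add: mc_def)
    then show ?thesis unfolding H_def using X C L bm by (intro conjunct1[OF halts_big[where X = X]]) auto
  qed
  have W: "1 \<le> step_bound C L" by (simp add: step_bound_def)
  have "H (1 + 1 + 1) c m (bind_pmf (map_pmf mb (bernoulli_pmf (1 / 2)))
     (\<lambda>s. return_pmf (store s ''Z'' 0 (2 * z + s ''f'' 0))))"
    unfolding c_def H_def using flip set W
    by (intro halts_Seq) (auto simp: H_def mb_def)
  then have c: "H 3 c m (map_pmf (\<lambda>b. store (mb b) ''Z'' 0 (2 * z + of_bool b)) (bernoulli_pmf (1 / 2)))"
    by (simp add: map_pmf_def bind_assoc_pmf bind_return_pmf mb_def numeral_3_eq_3)
  have "H (3 + 1 + 1) (c ;; ?inc) m (bind_pmf (map_pmf (\<lambda>b. store (mb b) ''Z'' 0 (2 * z + of_bool b)) (bernoulli_pmf (1 / 2)))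
     (\<lambda>s. return_pmf (store s ''i'' 0 (Suc i))))"
    using c inc W unfolding H_def by (intro halts_Seq) (auto simp: mc_def)
  then have body: "H 5 (c ;; ?inc) m (map_pmf mc (bernoulli_pmf (1 / 2)))"
    by (simp add: map_pmf_def bind_assoc_pmf bind_return_pmf mc_def eval_nat_numeral)
  have mc: "mc b ''i'' 0 = K - j" "mc b ''n'' 0 = n" "mc b ''Z'' 0 = 2 * z + of_bool b" "mc b ''Z'' 0 < 2 ^ (K - j)" for b
    using Suc.prems(4) z i(1) by (auto simp: mc_def mb_def)
  have "\<exists>\<nu>. H (7 * j + 1) ?w (mc b) \<nu> \<and>
    map_pmf (\<lambda>s. s ''Z'' 0) \<nu> = map_pmf (\<lambda>r. mc b ''Z'' 0 * 2 ^ j + r) (pmf_of_set {..<2 ^ j}) \<and>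
    (\<forall>s\<in>set_pmf \<nu>. bounded_memory L I X s \<and> (\<forall>x. x \<notin> {''i'', ''f'', ''Z''} \<longrightarrow> s x = mc b x))" for b
    using Suc.prems(1) bc mc by (intro Suc.IH) auto
  then obtain \<nu> where \<nu>: "\<And>b. H (7 * j + 1) ?w (mc b) (\<nu> b)"
    "\<And>b. map_pmf (\<lambda>s. s ''Z'' 0) (\<nu> b) = map_pmf (\<lambda>r. mc b ''Z'' 0 * 2 ^ j + r) (pmf_of_set {..<2 ^ j})"
    "\<And>b. \<forall>s\<in>set_pmf (\<nu> b). bounded_memory L I X s \<and> (\<forall>x. x \<notin> {''i'', ''f'', ''Z''} \<longrightarrow> s x = mc b x)"
    by metis
  \<comment> \<open>The coin can be read off the memory, so the continuation can be turned into a
    function of the memory, as \<open>halts_Seq\<close> demands.\<close>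
  have mc_inj: "b = b'" if "mc b = mc b'" for b b'
    using arg_cong[OF that, of "\<lambda>s. s ''f'' 0"] by (cases b; cases b') (simp_all add: mc_def mb_def)
  define \<nu>' where "\<nu>' s = \<nu> (THE b. s = mc b)" for s
  have \<nu>': "\<nu>' (mc b) = \<nu> b" for b
    unfolding \<nu>'_def using mc_inj by (intro arg_cong[of _ _ \<nu>] the_equality) auto
  let ?\<mu> = "bind_pmf (bernoulli_pmf (1 / 2)) \<nu>"
  have "H (5 + (7 * j + 1) + 1) ((c ;; ?inc) ;; ?w) m (bind_pmf (map_pmf mc (bernoulli_pmf (1 / 2))) \<nu>')"
    using body \<nu>(1) W unfolding H_def by (intro halts_Seq) (auto simp: \<nu>')
  then have seq: "H (7 * j + 7) ((c ;; ?inc) ;; ?w) m ?\<mu>" by (simp add: bind_map_pmf \<nu>' add.commute)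
  have cond: "expr_val (Op Less (Var ''i'') e) m \<noteq> 0"
    using Suc.prems(3,4) i by (simp add: e_def K_def i_def)
  have "H (Suc (7 * j + 7)) ?w m (bind_pmf (step ?w m) (\<lambda>_. ?\<mu>))"
    unfolding H_def
  proof (rule halts.move)
    show "step_cost ?w m \<le> step_bound C L"
      using expr_cost_step_bound[OF Suc.prems(2) L(1), of "Op Less (Var ''i'') e" C] C by (simp add: e_def)
    show "Defs.space m \<le> space_bound Kc L I" by (rule space_le[OF Suc.prems(2) X(1,2)])
    fix c' m' assume "(c', m') \<in> set_pmf (step ?w m)"
    then have "c' = ((c ;; ?inc) ;; ?w)" "m' = m" using cond by auto
    then show "halts (step_bound C L) (space_bound Kc L I) (7 * j + 7) c' m' ?\<mu>" using seq by (simp add: H_def)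
  qed simp
  then have "H (7 * Suc j + 1) ?w m ?\<mu>" using cond by (simp add: bind_return_pmf del: expr_val.simps)
  moreover have "map_pmf (\<lambda>s. s ''Z'' 0) ?\<mu> = map_pmf (\<lambda>r. m ''Z'' 0 * 2 ^ Suc j + r) (pmf_of_set {..<2 ^ Suc j})"
  proof -
    have "map_pmf (\<lambda>s. s ''Z'' 0) ?\<mu> = bind_pmf (bernoulli_pmf (1 / 2))
        (\<lambda>b. map_pmf (\<lambda>r. (2 * z + of_bool b) * 2 ^ j + r) (pmf_of_set {..<2 ^ j}))"
      by (simp add: map_bind_pmf \<nu>(2) mc(3))
    also have "\<dots> = map_pmf (\<lambda>r. z * 2 ^ Suc j + r) (bind_pmf (bernoulli_pmf (1 / 2))
        (\<lambda>b. map_pmf (\<lambda>r. of_bool b * 2 ^ j + r) (pmf_of_set {..<2 ^ j})))"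
      by (simp add: map_bind_pmf pmf.map_comp o_def algebra_simps)
    finally show ?thesis unfolding uniform_Suc z_def .
  qed
  moreover have "\<forall>s\<in>set_pmf ?\<mu>. bounded_memory L I X s \<and> (\<forall>x. x \<notin> {''i'', ''f'', ''Z''} \<longrightarrow> s x = m x)"
  proof
    fix s assume "s \<in> set_pmf ?\<mu>"
    then obtain b where "s \<in> set_pmf (\<nu> b)" by auto
    with \<nu>(3)[of b] show "bounded_memory L I X s \<and> (\<forall>x. x \<notin> {''i'', ''f'', ''Z''} \<longrightarrow> s x = m x)"
      by (auto simp: mc_def mb_def)
  qed
  ultimately show ?case by blast
qed

lemma halts_random:
  assumes X: "finite X" "card X \<le> Kc" "{''i'', ''f'', ''Z''} \<subseteq> X" and C: "20 \<le> C" and L: "0 < L" "n ^ 4 \<le> L" and I: "0 < I"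
    and m: "bounded_memory L I X m" "m ''n'' 0 = n"
  shows "\<exists>\<mu>. halts (step_bound C L) (space_bound Kc L I) (7 * n ^ 4 + 5) random_com m \<mu> \<and>
    map_pmf (\<lambda>s. s ''Z'' 0) \<mu> = pmf_of_set {..<2 ^ n ^ 4} \<and>
    (\<forall>s\<in>set_pmf \<mu>. bounded_memory L I X s \<and> (\<forall>x. x \<notin> {''i'', ''f'', ''Z''} \<longrightarrow> s x = m x))"
proof -
  let ?H = "halts (step_bound C L) (space_bound Kc L I)"
  have n4: "n ^ 4 = n * n * n * n" by (simp add: power4_eq_xxxx)
  define m1 where "m1 = store m ''Z'' 0 0"
  define m2 where "m2 = store m1 ''i'' 0 0"
  have b1: "bounded_memory L I X m1" unfolding m1_def using m X I by (intro bounded_memory_store) auto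
  have b2: "bounded_memory L I X m2" unfolding m2_def using b1 X I by (intro bounded_memory_store) auto
  have "big (2 ^ L) I (Set ''Z'' (Const 0)) m 1 m1"
    using big.Assign[of "Const 0" m I "Const 0" "2 ^ L" "''Z''"] I by (simp add: m1_def)
  then have 1: "?H 1 (Set ''Z'' (Const 0)) m (return_pmf m1)"
    using X C L m by (intro conjunct1[OF halts_big[where X = X]]) auto
  have "big (2 ^ L) I (Set ''i'' (Const 0)) m1 1 m2"
    using big.Assign[of "Const 0" m1 I "Const 0" "2 ^ L" "''i''"] I by (simp add: m2_def)
  then have 2: "?H 1 (Set ''i'' (Const 0)) m1 (return_pmf m2)"
    using X C L b1 by (intro conjunct1[OF halts_big[where X = X]]) auto
  let ?w = "While (Op Less (Var ''i'') (Var ''n'' \<^bold>* Var ''n'' \<^bold>* Var ''n'' \<^bold>* Var ''n''))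
     ((Flip ''f'' (Const 0) ;; Set ''Z'' (Const 2 \<^bold>* Var ''Z'' \<^bold>+ Var ''f'')) ;; Set ''i'' (Var ''i'' \<^bold>+ Const 1))"
  let ?K = "n * n * n * n"
  have "\<exists>\<mu>. ?H (7 * ?K + 1) ?w m2 \<mu> \<and>
     map_pmf (\<lambda>s. s ''Z'' 0) \<mu> = map_pmf (\<lambda>r. m2 ''Z'' 0 * 2 ^ ?K + r) (pmf_of_set {..<2 ^ ?K}) \<and>
     (\<forall>s\<in>set_pmf \<mu>. bounded_memory L I X s \<and> (\<forall>x. x \<notin> {''i'', ''f'', ''Z''} \<longrightarrow> s x = m2 x))"
    using L(2) m(2) by (intro halts_random_loop[OF X C L(1) _ I _ b2]) (simp_all add: n4 m2_def m1_def)
  then obtain \<mu> where \<mu>: "?H (7 * n ^ 4 + 1) ?w m2 \<mu>"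
     "map_pmf (\<lambda>s. s ''Z'' 0) \<mu> = map_pmf (\<lambda>r. m2 ''Z'' 0 * 2 ^ n ^ 4 + r) (pmf_of_set {..<2 ^ n ^ 4})"
     "\<forall>s\<in>set_pmf \<mu>. bounded_memory L I X s \<and> (\<forall>x. x \<notin> {''i'', ''f'', ''Z''} \<longrightarrow> s x = m2 x)"
    unfolding n4[symmetric] by blast
  have "?H (1 + (1 + (7 * n ^ 4 + 1) + 1) + 1) random_com m (bind_pmf (return_pmf m1) (\<lambda>_. bind_pmf (return_pmf m2) (\<lambda>_. \<mu>)))"
    unfolding random_com_def For_def using 1 2 \<mu>(1) by (intro halts_Seq) (auto simp: step_bound_def)
  then have "?H (7 * n ^ 4 + 5) random_com m \<mu>" by (simp add: bind_return_pmf eval_nat_numeral)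
  moreover have "map_pmf (\<lambda>s. s ''Z'' 0) \<mu> = pmf_of_set {..<2 ^ n ^ 4}" using \<mu>(2) by (simp add: m2_def m1_def)
  moreover have "\<forall>s\<in>set_pmf \<mu>. bounded_memory L I X s \<and> (\<forall>x. x \<notin> {''i'', ''f'', ''Z''} \<longrightarrow> s x = m x)"
    using \<mu>(3) by (simp add: m2_def m1_def)
  ultimately show ?thesis by blast
qed

subsection \<open>Correctness and running time\<close>

definition hamiltonicity_com :: com where
  "hamiltonicity_com = (random_com ;; decide_com)"

lemma independence_number_attained:
  fixes G :: "(nat, 'b) pre_digraph"
  assumes "verts G = {..<n}"
  obtains S where "independent_set G S" "card S = independence_number G" "S \<subseteq> {..<n}"
proof -
  let ?A = "{S. independent_set G S}"
  have "?A \<subseteq> Pow {..<n}" using assms by (auto simp: independent_set_def)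
  then have "finite ?A" by (rule finite_subset) simp
  moreover have "{} \<in> ?A" by (simp add: independent_set_def)
  ultimately have "independence_number G \<in> card ` ?A"
    unfolding independence_number_def by (intro Max_in) auto
  then obtain S where "independent_set G S" "independence_number G = card S" by blast
  moreover from this assms have "S \<subseteq> {..<n}" by (auto simp: independent_set_def)
  ultimately show ?thesis using that by simp
qed

definition all_names :: "string set" where
  "all_names = insert ''n'' (insert ''arc'' (writes hamiltonicity_com))"

lemma all_names: "finite all_names" "card all_names \<le> 40" "{''i'', ''f'', ''Z''} \<subseteq> all_names"
proof -
  let ?l = "[''n'', ''arc'', ''Z'', ''i'', ''f'', ''t'', ''N'', ''q'', ''d'', ''y'', ''w'', ''C'', ''cv'', ''k'', ''go'', ''b'',
    ''a'', ''iv'', ''K'', ''T'', ''x'', ''out'', ''g'', ''st'', ''p'', ''A'', ''z'', ''acc'']"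
  have "all_names \<subseteq> set ?l"
    by (auto simp: all_names_def hamiltonicity_com_def random_com_def decide_com_def params_com_def
        writes_cover_com writes_collect_com writes_sieve_com)
  then have "card all_names \<le> card (set ?l)" by (intro card_mono) auto
  also have "\<dots> \<le> length ?l" by (rule card_length)
  finally show "card all_names \<le> 40" by simp
  show "finite all_names" by (simp add: all_names_def finite_writes)
  show "{''i'', ''f'', ''Z''} \<subseteq> all_names"
    by (auto simp: all_names_def hamiltonicity_com_def random_com_def)
qed

text \<open>Descends with the bound \<open>C\<close> held fixed, instead of evaluating nested
  maxima.\<close>

lemma max_expr_size_leI:
  "max_expr_size Skip \<le> C"
  "expr_size e1 + expr_size e2 \<le> C \<Longrightarrow> max_expr_size (Assign x e1 e2) \<le> C"
  "max_expr_size c1 \<le> C \<Longrightarrow> max_expr_size c2 \<le> C \<Longrightarrow> max_expr_size (Seq c1 c2) \<le> C"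
  "expr_size e \<le> C \<Longrightarrow> max_expr_size c1 \<le> C \<Longrightarrow> max_expr_size c2 \<le> C \<Longrightarrow> max_expr_size (Cond e c1 c2) \<le> C"
  "expr_size e \<le> C \<Longrightarrow> max_expr_size c \<le> C \<Longrightarrow> max_expr_size (While e c) \<le> C"
  "expr_size e + 3 \<le> C \<Longrightarrow> max_expr_size c \<le> C \<Longrightarrow> 6 \<le> C \<Longrightarrow> max_expr_size (For i e c) \<le> C"
  by simp_all

lemma max_expr_size_decide_com: "max_expr_size decide_com \<le> 100"
  unfolding decide_com_def params_com_def power_com_def cover_com_def cover_attempt_com_def cover_step_com_def
    collect_com_def sieve_com_def summand_com_def state_com_def identity_com_def fill_com_def fill_step_com_def
    elimination_com_def inverse_com_def schur_com_def schur_step_com_def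
  by (intro max_expr_size_leI)
    (simp_all add: pivot_expr_def plus_cell_def minus_cell_def row_expr_def tail_expr_def head_expr_def)

text \<open>The modulus \<open>N\<close> has at most \<open>8 * (n + 1) ^ 3\<close> bits before
  adding one and the random number at most \<open>n ^ 4\<close>; both fit.\<close>

definition bit_bound :: "nat \<Rightarrow> nat" where "bit_bound n = 9 * (n + 1) ^ 4"
definition cell_bound :: "nat \<Rightarrow> nat" where "cell_bound n = (n + 1) ^ 2"

lemma bit_bound:
  "0 < bit_bound n" "n ^ 4 \<le> bit_bound n" "n * n * n < 2 ^ bit_bound n"
  "(2 ^ (4 * ((n + 1) * (n + 1)))) ^ (n + 2) < (2::nat) ^ bit_bound n"
  "machine n (2 ^ bit_bound n) (cell_bound n)"
proof -
  define M where "M = (n + 1) ^ 4"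
  have M_le: "u * v * w * x \<le> M" if "u \<le> n + 1" "v \<le> n + 1" "w \<le> n + 1" "x \<le> n + 1" for u v w x
    unfolding M_def power4_eq_xxxx using that by (intro mult_le_mono)
  have b: "1 \<le> M" "n \<le> M" "n * n \<le> M" "n * n * n \<le> M" "n * n * n * n \<le> M" "(n + 1) * (n + 1) * (n + 1) \<le> M"
    using M_le[of 1 1 1 1] M_le[of n 1 1 1] M_le[of n n 1 1] M_le[of n n n 1] M_le[of n n n n] M_le[of "n + 1" "n + 1" "n + 1" 1]
    by simp_all
  have L: "bit_bound n = 9 * M" by (simp add: bit_bound_def M_def)
  show "0 < bit_bound n" using b(1) L by simp
  show "n ^ 4 \<le> bit_bound n" using b(5) L by (simp add: power4_eq_xxxx)
  have lt: "u < 2 ^ bit_bound n" if "u \<le> 9 * M" for u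
    using that less_exp[of "bit_bound n"] L by linarith
  show "n * n * n < 2 ^ bit_bound n" using b(4) by (intro lt) linarith
  have "4 * ((n + 1) * (n + 1)) * (n + 2) \<le> 4 * ((n + 1) * (n + 1)) * (2 * (n + 1))" by (intro mult_left_mono) auto
  also have "\<dots> = 8 * ((n + 1) * (n + 1) * (n + 1))" by (simp add: algebra_simps)
  also have "\<dots> < bit_bound n" using b(1,6) L by linarith
  finally have "(2::nat) ^ (4 * ((n + 1) * (n + 1)) * (n + 2)) < 2 ^ bit_bound n"
    by (intro power_strict_increasing) auto
  then show "(2 ^ (4 * ((n + 1) * (n + 1)))) ^ (n + 2) < (2::nat) ^ bit_bound n" by (simp only: power_mult)
  show "machine n (2 ^ bit_bound n) (cell_bound n)"
  proof
    show "n * n < 2 ^ bit_bound n" using b(3) by (intro lt) linarith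
    have "(3::nat) ^ n \<le> 4 ^ n" by (intro power_mono) auto
    also have "\<dots> = 2 ^ (2 * n)" by (simp add: power_mult)
    also have "\<dots> < 2 ^ bit_bound n" using b(1,2) L by (intro power_strict_increasing) auto
    finally show "3 ^ n < (2::nat) ^ bit_bound n" .
    show "3 < (2::nat) ^ bit_bound n" using b(1) by (intro lt) linarith
    show "n * n < cell_bound n" "n < cell_bound n" by (simp_all add: cell_bound_def power2_eq_square)
  qed
qed

lemma bounded_graph_input:
  assumes "verts G = {..<n}"
  shows "bounded_memory (bit_bound n) (cell_bound n) all_names (graph_input G)"
  unfolding bounded_memory_def
proof (intro allI)
  fix x i
  have "n < 2 ^ n" by (rule less_exp)
  also have "(2::nat) ^ n \<le> 2 ^ bit_bound n"
  proof (intro power_increasing)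
    have "n * 1 \<le> n * n ^ 3" by (cases "n = 0") (auto intro: mult_left_mono)
    then have "n \<le> n ^ 4" by (simp add: eval_nat_numeral)
    then show "n \<le> bit_bound n" using bit_bound(2)[of n] by simp
  qed simp
  finally have "n < 2 ^ bit_bound n" .
  moreover have "1 < (2::nat) ^ bit_bound n" using bit_bound(1) by (intro one_less_power) auto
  moreover have "n * n < cell_bound n" "0 < cell_bound n" by (simp_all add: cell_bound_def power2_eq_square)
  ultimately show "graph_input G x i < 2 ^ bit_bound n \<and> (graph_input G x i \<noteq> 0 \<longrightarrow> x \<in> all_names \<and> i < cell_bound n)"
    using assms by (auto simp: graph_input_def Let_def all_names_def)
qed

text \<open>The complement of a maximum independent set is a vertex cover with \<open>c\<close>
  vertices. It bounds the running time without being known to the program.\<close>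

lemma hamiltonicity_correct:
  fixes G :: "(nat, nat \<times> nat) pre_digraph"
  assumes G: "digraph G" "verts G = {..<n}"
  defines "c \<equiv> n - independence_number G"
  shows "\<exists>\<mu>. halts (step_bound 100 (bit_bound n)) (space_bound 40 (bit_bound n) (cell_bound n))
      (7 * n ^ 4 + 5 + 3 ^ c * (500 * (n + 1) ^ 3) + 1) hamiltonicity_com (graph_input G) \<mu> \<and>
    (hamiltonian G \<longrightarrow> measure_pmf.prob \<mu> rejecting \<le> real n ^ 3 / 2 ^ n) \<and>
    (\<not> hamiltonian G \<longrightarrow> measure_pmf.prob \<mu> accepting = 0)"
proof -
  interpret digraph G by fact
  define E where "E = (\<lambda>u v. u \<rightarrow>\<^bsub>G\<^esub> v)"
  have E: "u < n \<and> v < n" if "E u v" for u v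
    using adj_in_verts[of u v] that G(2) by (auto simp: E_def)
  have ham: "hamiltonian G \<longleftrightarrow> 0 < n \<and> (\<exists>\<pi>. cyclic_successor n E \<pi>)"
    unfolding E_def by (rule hamiltonian_iff_cyclic_successor[OF G])
  obtain S0 where S0: "independent_set G S0" "card S0 = independence_number G" "S0 \<subseteq> {..<n}"
    by (rule independence_number_attained[OF G(2)])
  define S where "S = {..<n} - S0"
  have S: "finite S" "card S = c" "c \<le> n"
    using S0(2,3) by (auto simp: S_def c_def card_Diff_subset finite_subset)
  have cov: "u \<in> S \<or> v \<in> S" if "E u v" for u v
  proof -
    \<comment> \<open>\<open>independent_set\<close> says nothing about loops, so a loop could
      escape the cover; a digraph has none.\<close>
    have "u \<noteq> v" using that adj_not_same by (auto simp: E_def)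
    then show ?thesis using that S0(1) E[OF that] by (auto simp: S_def independent_set_def E_def)
  qed
  let ?L = "bit_bound n" and ?I = "cell_bound n"
  let ?H = "halts (step_bound 100 ?L) (space_bound 40 ?L ?I)"
  interpret M: machine n "2 ^ ?L" ?I E by (rule bit_bound(5))
  have I: "0 < ?I" by (simp add: cell_bound_def)
  have n0: "graph_input G ''n'' 0 = n" using G(2) by (simp add: graph_input_def)
  obtain \<mu>1 where \<mu>1: "?H (7 * n ^ 4 + 5) random_com (graph_input G) \<mu>1"
    "map_pmf (\<lambda>s. s ''Z'' 0) \<mu>1 = pmf_of_set {..<2 ^ n ^ 4}"
    "\<forall>s\<in>set_pmf \<mu>1. bounded_memory ?L ?I all_names s \<and> (\<forall>x. x \<notin> {''i'', ''f'', ''Z''} \<longrightarrow> s x = graph_input G x)"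
    using halts_random[OF all_names _ bit_bound(1,2) I bounded_graph_input[OF G(2)] n0, of 100] by auto
  have set_Z: "s ''Z'' 0 < 2 ^ n ^ 4" if "s \<in> set_pmf \<mu>1" for s
  proof -
    have "s ''Z'' 0 \<in> set_pmf (map_pmf (\<lambda>s. s ''Z'' 0) \<mu>1)" using that by simp
    then show ?thesis unfolding \<mu>1(2) by (subst (asm) set_pmf_of_set) (auto simp: lessThan_empty_iff)
  qed
  have "\<exists>s'. ?H (3 ^ c * (500 * (n + 1) ^ 3)) decide_com s (return_pmf s') \<and> (s' ''out'' 0 \<noteq> 0 \<longleftrightarrow> verdict E n (s ''Z'' 0))"
    if s: "s \<in> set_pmf \<mu>1" for s
  proof -
    have bs: "bounded_memory ?L ?I all_names s" and fr: "\<And>x. x \<notin> {''i'', ''f'', ''Z''} \<Longrightarrow> s x = graph_input G x"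
      using \<mu>1(3) s by auto
    have g: "M.holds_graph s" unfolding M.holds_graph_def using G(2) by (simp add: fr graph_input_def Let_def E_def)
    have "(2::nat) ^ n ^ 4 \<le> 2 ^ ?L" using bit_bound(2) by (intro power_increasing) auto
    then have Z: "s ''Z'' 0 < 2 ^ ?L" using set_Z[OF s] by linarith
    from M.tot_decide[OF g refl Z bit_bound(3,4) E S(1) cov S(2,3)]
    obtain T s' where T: "big (2 ^ ?L) ?I decide_com s T s'" "T \<le> 3 ^ c * (500 * (n + 1) ^ 3)"
      "s' ''out'' 0 \<noteq> 0 \<longleftrightarrow> verdict E n (s ''Z'' 0)" unfolding tot_def by blast
    have "writes decide_com \<subseteq> all_names" by (auto simp: all_names_def hamiltonicity_com_def)
    from halts_big[OF T(1) bs this max_expr_size_decide_com bit_bound(1) all_names(1,2)] T(2,3)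
    show ?thesis by (blast intro: halts_mono)
  qed
  \<comment> \<open>Once the random number is drawn, nothing is left to chance, so the final memory
    is a function of the one at that moment.\<close>
  then obtain F where F: "\<And>s. s \<in> set_pmf \<mu>1 \<Longrightarrow> ?H (3 ^ c * (500 * (n + 1) ^ 3)) decide_com s (return_pmf (F s))"
    "\<And>s. s \<in> set_pmf \<mu>1 \<Longrightarrow> F s ''out'' 0 \<noteq> 0 \<longleftrightarrow> verdict E n (s ''Z'' 0)" by metis
  define \<mu> where "\<mu> = map_pmf F \<mu>1"
  have H: "?H (7 * n ^ 4 + 5 + 3 ^ c * (500 * (n + 1) ^ 3) + 1) hamiltonicity_com (graph_input G) \<mu>"
    unfolding hamiltonicity_com_def \<mu>_def map_pmf_def using \<mu>1(1) F(1)
    by (intro halts_Seq) (auto simp: step_bound_def)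
  have rej: "measure_pmf.prob \<mu> rejecting = real (card {Z. Z < 2 ^ n ^ 4 \<and> \<not> verdict E n Z}) / 2 ^ n ^ 4"
  proof -
    have "rejecting = (\<lambda>s. s ''out'' 0 \<noteq> 0) -` {False}" unfolding rejecting_def vimage_def by simp
    then have "measure_pmf.prob \<mu> rejecting = measure_pmf.prob (map_pmf (\<lambda>s. s ''out'' 0 \<noteq> 0) \<mu>) {False}"
      by (simp only: measure_map_pmf)
    also have "map_pmf (\<lambda>s. s ''out'' 0 \<noteq> 0) \<mu> = map_pmf (\<lambda>s. verdict E n (s ''Z'' 0)) \<mu>1"
      unfolding \<mu>_def pmf.map_comp o_def by (rule map_pmf_cong) (use F(2) in simp_all)
    also have "\<dots> = map_pmf (verdict E n) (pmf_of_set {..<2 ^ n ^ 4})"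
      unfolding \<mu>1(2)[symmetric] pmf.map_comp o_def ..
    also have "measure_pmf.prob \<dots> {False} = measure_pmf.prob (pmf_of_set {..<2 ^ n ^ 4}) {Z. \<not> verdict E n Z}"
      unfolding measure_map_pmf by (rule arg_cong[of _ _ "measure_pmf.prob _"]) auto
    also have "\<dots> = real (card ({..<2 ^ n ^ 4} \<inter> {Z. \<not> verdict E n Z})) / real (card {..<(2::nat) ^ n ^ 4})"
      by (rule measure_pmf_of_set) (auto simp: lessThan_empty_iff)
    also have "{..<2 ^ n ^ 4} \<inter> {Z. \<not> verdict E n Z} = {Z. Z < 2 ^ n ^ 4 \<and> \<not> verdict E n Z}" by auto
    finally show ?thesis by simp
  qed
  have "measure_pmf.prob \<mu> rejecting \<le> real n ^ 3 / 2 ^ n" if h: "hamiltonian G"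
  proof -
    obtain \<pi> where \<pi>: "0 < n" "cyclic_successor n E \<pi>" using h ham by blast
    \<comment> \<open>Drawing \<open>n ^ 4\<close> bits is the same as drawing \<open>n ^ 3\<close>
      digits below \<open>2 ^ n\<close>.\<close>
    have p: "((2::nat) ^ n) ^ (n ^ 3) = 2 ^ n ^ 4" by (simp flip: power_mult power_Suc)
    define r where "r = card {Z. Z < 2 ^ n ^ 4 \<and> \<not> verdict E n Z}"
    have "2 ^ n * r \<le> n ^ 3 * 2 ^ n ^ 4" using verdict_complete[OF E \<pi>] unfolding p r_def .
    then have "real (2 ^ n * r) \<le> real (n ^ 3 * 2 ^ n ^ 4)" by (simp only: of_nat_le_iff)
    then have "2 ^ n * real r \<le> real n ^ 3 * 2 ^ n ^ 4" by simp
    then show ?thesis unfolding rej r_def[symmetric] by (simp add: field_simps)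
  qed
  moreover have "measure_pmf.prob \<mu> accepting = 0" if h: "\<not> hamiltonian G"
  proof -
    have "\<not> verdict E n Z" for Z
    proof
      assume v: "verdict E n Z"
      have "0 < n \<and> (\<exists>\<pi>. cyclic_successor n E \<pi>)" by (rule verdict_sound[OF _ v]) (rule E)
      with h ham show False by blast
    qed
    then have "set_pmf \<mu> \<inter> accepting = {}" using F(2) by (auto simp: \<mu>_def accepting_def)
    then show ?thesis by (simp add: measure_pmf_zero_iff)
  qed
  ultimately show ?thesis using H by blast
qed

theorem theorem3:
  "\<exists>(c :: com) (p :: nat poly) (q :: nat poly) (\<epsilon> :: nat \<Rightarrow> real).
     \<epsilon> \<longlonglongrightarrow> 0 \<and>
     (\<forall>(G :: (nat, nat \<times> nat) pre_digraph) n.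
        digraph G \<and> verts G = {..<n} \<longrightarrow>
        (\<exists>\<mu>. halts_within c (graph_input G)
               (poly p n * 3 ^ (n - independence_number G)) (poly q n) \<mu> \<and>
             (hamiltonian G \<longrightarrow> measure_pmf.prob \<mu> rejecting \<le> \<epsilon> n) \<and>
             (\<not> hamiltonian G \<longrightarrow> measure_pmf.prob \<mu> accepting = 0)))"
proof -
  \<comment> \<open>The first factor bounds the number of steps divided by the exponential; the
    second is the cost of one step, \<open>step_bound\<close> for expressions of size at most
    100.\<close>
  define p :: "nat poly" where "p = ([:7:] * [:0, 1:] ^ 4 + [:6:] + [:500:] * [:1, 1:] ^ 3) *
    ([:101:] + [:90000:] * [:1, 1:] ^ 4)"
  define q :: "nat poly" where "q = [:40:] * [:1, 1:] ^ 2 * ([:1, 1:] ^ 2 + [:9:] * [:1, 1:] ^ 4)"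
  have lim: "(\<lambda>n. real n ^ 3 / 2 ^ n) \<longlonglongrightarrow> 0" by real_asymp
  have main: "\<exists>\<mu>. halts_within hamiltonicity_com (graph_input G) (poly p n * 3 ^ (n - independence_number G)) (poly q n) \<mu> \<and>
     (hamiltonian G \<longrightarrow> measure_pmf.prob \<mu> rejecting \<le> real n ^ 3 / 2 ^ n) \<and>
     (\<not> hamiltonian G \<longrightarrow> measure_pmf.prob \<mu> accepting = 0)"
    if G: "digraph G" "verts G = {..<n}" for G :: "(nat, nat \<times> nat) pre_digraph" and n
  proof -
    obtain \<mu> where \<mu>: "halts (step_bound 100 (bit_bound n)) (space_bound 40 (bit_bound n) (cell_bound n))
        (7 * n ^ 4 + 5 + 3 ^ (n - independence_number G) * (500 * (n + 1) ^ 3) + 1) hamiltonicity_com (graph_input G) \<mu>"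
      "hamiltonian G \<longrightarrow> measure_pmf.prob \<mu> rejecting \<le> real n ^ 3 / 2 ^ n"
      "\<not> hamiltonian G \<longrightarrow> measure_pmf.prob \<mu> accepting = 0"
      using hamiltonicity_correct[OF G] by blast
    define c where "c = n - independence_number G"
    have W: "step_bound 100 (bit_bound n) = 101 + 90000 * (n + 1) ^ 4"
      by (simp add: step_bound_def bit_bound_def)
    \<comment> \<open>Lets the polynomial terms outside the search and the sieve be absorbed into
      the exponential factor.\<close>
    have "1 \<le> (3::nat) ^ c" by simp
    then have "1 * (7 * n ^ 4 + 6) \<le> 3 ^ c * (7 * n ^ 4 + 6)" by (rule mult_right_mono) simp
    then have "7 * n ^ 4 + 5 + 3 ^ c * (500 * (n + 1) ^ 3) + 1 \<le> (7 * n ^ 4 + 6 + 500 * (n + 1) ^ 3) * 3 ^ c"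
      by (simp add: algebra_simps)
    then have "(7 * n ^ 4 + 5 + 3 ^ c * (500 * (n + 1) ^ 3) + 1) * step_bound 100 (bit_bound n) \<le>
       (7 * n ^ 4 + 6 + 500 * (n + 1) ^ 3) * 3 ^ c * (101 + 90000 * (n + 1) ^ 4)"
      unfolding W by (rule mult_right_mono) simp
    also have "\<dots> = poly p n * 3 ^ c" by (simp add: p_def add.commute)
    finally have T: "(7 * n ^ 4 + 5 + 3 ^ c * (500 * (n + 1) ^ 3) + 1) * step_bound 100 (bit_bound n) \<le> poly p n * 3 ^ c" .
    have S: "space_bound 40 (bit_bound n) (cell_bound n) \<le> poly q n"
      by (simp add: space_bound_def bit_bound_def cell_bound_def q_def add.commute)
    show ?thesis
      using halts_within_if_halts[OF \<mu>(1) T[unfolded c_def] S] \<mu>(2,3) by blast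
  qed
  show ?thesis
    by (rule exI[of _ hamiltonicity_com], rule exI[of _ p], rule exI[of _ q], rule exI[of _ "\<lambda>n. real n ^ 3 / 2 ^ n"],
        intro conjI[OF lim] allI impI, elim conjE, rule main)
qed

end
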